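(* Let $\omega\in\mathbb{R}\setminus\mathbb{Q}$ be badly approximable and let $r\in[0,3)$. Let $h_0(x,x')=\frac12(x-x')^2$. Then there is a constant $C>0$, independent of $\epsilon$, such that for every sufficiently small $\epsilon>0$ there exists a real trigonometric polynomial $R_N(x)$ (of period $1$) of degree \[N\le C\epsilon^{-\frac{3}{2(3-r)}}\] with $\|R_N\|_{C^r}<\epsilon$ such that the exact area-preserving twist map generated by $h_0(x,x')+R_N(x')$ admits no invariant circle with frequency $\omega$.
   Context: An irrational $\omega$ is badly approximable if it is $0$-well approximable but not $\mu$-well approximable for any $\mu>0$, where $\omega$ is $\mu$-well approximable if there are infinitely many $q\in\mathbb{N}$ and integers $p$ with $|q\omega-p|<q^{-1-\mu}$ (equivalently, the partial quotients of its continued fraction are bounded). A function $h(x,x')$ with $h(x+1,x'+1)=h(x,x')$ generates the map $F(x,y)=(x',y')$ of $\mathbb{R}^2$ given implicitly by $y=-\partial_1h(x,x')$, $y'=\partial_2h(x,x')$, which induces an exact area-preserving twist map $f$ of the cylinder $\mathbb{T}\times\mathbb{R}$. An invariant circle is an $f$-invariant simple closed curve not homotopic to a point; it has frequency $\omega$ if the restriction of $f$ to it has rotation number $\omega$. For $u\in C^r(\mathbb{T})$, $\|u\|_{C^r}=\max_{0\le j\le r}\max_{x}|u^{(j)}(x)|$ over integer orders $j\le r$. *)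

theory Defs
  imports "HOL-Analysis.Analysis"
begin

definition mu_well_approximable :: "real \<Rightarrow> real \<Rightarrow> bool" where
  "mu_well_approximable \<mu> \<omega> \<longleftrightarrow>
     infinite {q::nat. q > 0 \<and> (\<exists>p::int. \<bar>real q * \<omega> - real_of_int p\<bar> < real q powr (-1 - \<mu>))}"

definition badly_approximable :: "real \<Rightarrow> bool" where
  "badly_approximable \<omega> \<longleftrightarrow> \<omega> \<notin> \<rat> \<and>
     mu_well_approximable 0 \<omega> \<and> (\<forall>\<mu>>0. \<not> mu_well_approximable \<mu> \<omega>)"

definition gen_rel :: "(real \<Rightarrow> real \<Rightarrow> real) \<Rightarrow> real \<times> real \<Rightarrow> real \<times> real \<Rightarrow> bool" where
  "gen_rel h z z' \<longleftrightarrow>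
     ((\<lambda>t. h t (fst z')) has_real_derivative (- snd z)) (at (fst z)) \<and>
     ((\<lambda>t. h (fst z) t) has_real_derivative (snd z')) (at (fst z'))"

definition twist_map :: "(real \<Rightarrow> real \<Rightarrow> real) \<Rightarrow> real \<times> real \<Rightarrow> real \<times> real" where
  "twist_map h z = (THE z'. gen_rel h z z')"

text \<open>Invariant circle of the cylinder map induced by the lift F, with frequency omega,
  expressed via its lift to R^2: Gamma = range gamma with gamma continuous, injective,
  gamma(t+1) = gamma(t) + (1,0) (a simple closed non-contractible curve on the cylinder),
  F(Gamma) = Gamma, and the rotation number of F on Gamma equals omega.\<close>
definition has_invariant_circle_freq :: "(real \<times> real \<Rightarrow> real \<times> real) \<Rightarrow> real \<Rightarrow> bool" where
  "has_invariant_circle_freq F \<omega> \<longleftrightarrow>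
     (\<exists>\<gamma>::real \<Rightarrow> real \<times> real.
        continuous_on UNIV \<gamma> \<and> inj \<gamma> \<and> (\<forall>t. \<gamma> (t + 1) = \<gamma> t + (1, 0)) \<and>
        F ` range \<gamma> = range \<gamma> \<and>
        (\<forall>z\<in>range \<gamma>. (\<lambda>n. fst ((F ^^ n) z) / real n) \<longlonglongrightarrow> \<omega>))"

definition trig_poly :: "nat \<Rightarrow> (nat \<Rightarrow> real) \<Rightarrow> (nat \<Rightarrow> real) \<Rightarrow> real \<Rightarrow> real" where
  "trig_poly N a b x = (\<Sum>k\<le>N. a k * cos (2 * pi * real k * x) + b k * sin (2 * pi * real k * x))"

definition Cr_norm :: "real \<Rightarrow> (real \<Rightarrow> real) \<Rightarrow> real" where
  "Cr_norm r u = (SUP j\<in>{j::nat. real j \<le> r}. SUP x. \<bar>(deriv ^^ j) u x\<bar>)"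

end

theory Submission
  imports Defs "HOL-Real_Asymp.Real_Asymp"
begin

text \<open>The map generated by (x - x')^2 / 2 + R x' is (x, y) \<mapsto> (x + y, y + R' (x + y)).
  Let t1 x be the last parameter at which an invariant circle meets the vertical over x. The next and
  the previous abscissa of that point, \<psi> x and \<theta> x, satisfy \<psi> + \<theta> = 2 id + R', and
  \<theta> z < w implies z < \<psi> w. As R' has mean zero, Young's equality for monotone functions forces
  \<psi> and \<theta> to be monotone, hence continuous, and the circle is the graph of a homeomorphism
  g = \<psi> with g + inv g = 2 id + R' (Birkhoff's theorem). The orbits on this graph minimize the action.

  If r < 1 it suffices to take R = \<epsilon>/2 cos (2 \<pi> N x) with R'' < -2 somewhere. If r \<ge> 1, let q be a
  denominator with 0 < q \<omega> - p < 1/q (q may be negative) and take R x = S (q x) / q^2, where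
  S = sin^2 (\<pi> x) (2 A + a K (x - c)), A \<approx> \<bar>q\<bar> powr (-3/2), and K is a power of the Fejer kernel.
  In the rescaled frame an orbit moves so slowly that it comes exponentially close to the integers
  before and after it passes c. The centre c is chosen in a gap of a nearly action minimizing
  transition from 0 to 1 for the potential without bump, so that passing through c is not minimal.\<close>

section \<open>Invariant circles are graphs\<close>

text \<open>The exponents are tuned at r = 1. Only integer orders enter the norm, so with m the
  integer part of r the perturbation has size about q^(m - 2) q^(-3/2) = q^(m - 7/2). Wells of depth
  q^(-3/2) make the integers hyperbolic with rate about q^(-3/4), while an orbit needs about q steps
  to advance by 1; the ends of a transition are thus known up to exp(- const q^(1/4)), which is
  negligible against the bump height, a power of q. The gap found for the bump has width about
  q^(-3/4), and the bump must be somewhat narrower to be small outside it: its degree is about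
  q^(27/32), which gives N of order q^(59/32). The definition of badly approximable controls how
  sparse the usable denominators are only up to a small power. The loss granted is Q \<le>
  q^(60/59), and 59/32 * 60/59 / (5/2) = 3/4 is exactly the exponent demanded at r = 1. For m = 0
  the same count gives 15/28, more than the 1/2 demanded at r = 0; hence the separate construction
  for r < 1.\<close>

definition invariant_graph :: "(real \<Rightarrow> real) \<Rightarrow> real \<Rightarrow> (real \<Rightarrow> real) \<Rightarrow> bool" where
  "invariant_graph R' \<rho> g \<longleftrightarrow>
     continuous_on UNIV g \<and> strict_mono g \<and> surj g \<and> (\<forall>x. g (x + 1) = g x + 1) \<and>
     (\<forall>x. g (g x) + x = 2 * g x + R' (g x)) \<and> (\<forall>x. (\<lambda>n. (g ^^ n) x / real n) \<longlonglongrightarrow> \<rho>)"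

lemma twist_map_eq:
  assumes "\<And>x. (R has_real_derivative R' x) (at x)"
  shows "twist_map (\<lambda>x x'. (x - x')\<^sup>2 / 2 + R x') (x, y) = (x + y, y + R' (x + y))"
proof -
  have d1: "((\<lambda>t. (t - x')\<^sup>2 / 2 + R x') has_real_derivative (x - x')) (at x)" for x x' :: real
    by (auto intro!: derivative_eq_intros)
  have d2: "((\<lambda>t. (x - t)\<^sup>2 / 2 + R t) has_real_derivative (x' - x + R' x')) (at x')" for x x' :: real
    by (auto intro!: derivative_eq_intros assms)
  have "gen_rel (\<lambda>x x'. (x - x')\<^sup>2 / 2 + R x') (x, y) z' \<longleftrightarrow> z' = (x + y, y + R' (x + y))" for z'
  proof
    assume "gen_rel (\<lambda>x x'. (x - x')\<^sup>2 / 2 + R x') (x, y) z'"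
    then have "- y = x - fst z'" "snd z' = fst z' - x + R' (fst z')"
      unfolding gen_rel_def using DERIV_unique[OF _ d1] DERIV_unique[OF _ d2] by auto
    then show "z' = (x + y, y + R' (x + y))"
      by (auto simp: prod_eq_iff algebra_simps)
  next
    assume "z' = (x + y, y + R' (x + y))"
    then show "gen_rel (\<lambda>x x'. (x - x')\<^sup>2 / 2 + R x') (x, y) z'"
      unfolding gen_rel_def using d1[of "x + y" x] d2[of x "x + y"] by (auto simp: algebra_simps)
  qed
  then show ?thesis unfolding twist_map_def by (intro the_equality) blast+
qed

text \<open>Cut the interval into \<open>Suc n\<close> equal pieces: the increments of
  \<open>Z\<close> telescope, so the total error is \<open>(y - x) * (Z y - Z x)\<close> divided by
  \<open>Suc n\<close>, which tends to 0. This replaces differentiation where \<open>\<phi>\<close>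
  is built from a function that is merely monotone.\<close>

lemma mono_if_quadratic_lower_bound:
  fixes \<phi> Z :: "real \<Rightarrow> real"
  assumes "mono Z" and q: "\<And>x y. x \<le> y \<Longrightarrow> \<phi> y - \<phi> x \<ge> - (y - x) * (Z y - Z x)" and "x \<le> y"
  shows "\<phi> x \<le> \<phi> y"
proof -
  have main: "\<phi> y - \<phi> x \<ge> - ((y - x) * (Z y - Z x)) * inverse (real (Suc n))" for n
  proof -
    define t where "t k = x + real k * ((y - x) / real (Suc n))" for k
    have t0: "t 0 = x" "t (Suc n) = y" by (auto simp: t_def field_simps)
    have dt: "t (Suc k) - t k = (y - x) / real (Suc n)" for k
      unfolding t_def of_nat_Suc[of k] distrib_right by simp
    have le: "t k \<le> t (Suc k)" for k
      using dt[of k] \<open>x \<le> y\<close> by (smt (verit) divide_nonneg_nonneg of_nat_0_le_iff)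
    have "\<phi> y - \<phi> x = (\<Sum>k<Suc n. \<phi> (t (Suc k)) - \<phi> (t k))"
      using sum_lessThan_telescope[of "\<lambda>k. \<phi> (t k)" "Suc n"] by (simp only: t0)
    also have "\<dots> \<ge> (\<Sum>k<Suc n. - ((y - x) / real (Suc n)) * (Z (t (Suc k)) - Z (t k)))"
      using q[OF le] dt by (intro sum_mono) metis
    also have "(\<Sum>k<Suc n. - ((y - x) / real (Suc n)) * (Z (t (Suc k)) - Z (t k)))
       = - ((y - x) / real (Suc n)) * (Z y - Z x)"
      using sum_lessThan_telescope[of "\<lambda>k. Z (t k)" "Suc n"] by (simp only: sum_distrib_left[symmetric] t0)
    finally show ?thesis by (simp add: field_simps)
  qed
  have "(\<lambda>n. - ((y - x) * (Z y - Z x)) * inverse (real (Suc n))) \<longlonglongrightarrow> - ((y - x) * (Z y - Z x)) * 0"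
    by (intro tendsto_intros LIMSEQ_inverse_real_of_nat)
  then have "\<phi> y - \<phi> x \<ge> - ((y - x) * (Z y - Z x)) * 0"
    by (rule LIMSEQ_le_const2) (use main in auto)
  then show ?thesis by simp
qed

text \<open>Let \<open>Z\<close> be the largest nondecreasing minorant of \<open>\<psi>\<close>. On
  the curve z = \<open>Z w\<close> the partial derivative \<open>\<psi> w - z\<close> of
  \<open>f\<close> is nonnegative, and just above the curve \<open>\<theta> z - w\<close> is
  nonnegative by \<open>H\<close>. So \<open>\<phi>\<close> is nondecreasing along the curve. It
  also returns to its value after one period, because \<open>R\<close> does; hence it cannot grow
  strictly, as it would where \<open>\<psi>\<close> exceeds \<open>Z\<close>.\<close>

lemma zero_flux_imp_mono:
  fixes \<psi> \<theta> R R' :: "real \<Rightarrow> real"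
  assumes R: "\<And>x. (R has_real_derivative R' x) (at x)" and Rper: "\<And>x. R (x + 1) = R x"
    and meas: "\<psi> \<in> borel_measurable borel"
    and per: "\<And>x. \<psi> (x + 1) = \<psi> x + 1"
    and bd: "\<And>x. \<bar>\<psi> x - x\<bar> \<le> B"
    and sum: "\<And>x. \<psi> x + \<theta> x = 2 * x + R' x"
    and H: "\<And>w z. \<theta> z < w \<Longrightarrow> z \<le> \<psi> w"
    and rc: "\<And>x e. e > 0 \<Longrightarrow> \<exists>d>0. \<forall>s\<in>{x..x + d}. \<psi> s > \<psi> x - e"
  shows "mono \<psi>"
proof -
  have bd1: "x - B \<le> \<psi> x" "\<psi> x \<le> x + B" for x using bd[of x] by (auto simp: abs_le_iff)
  have B0: "B \<ge> 0" using bd[of 0] by linarith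
  have int: "\<psi> integrable_on {a..b}" for a b
  proof (rule measurable_bounded_by_integrable_imp_integrable)
    show "\<psi> \<in> borel_measurable (lebesgue_on {a..b})"
      using meas by (intro measurable_restrict_space1 measurable_completion) simp
    show "(\<lambda>x. \<bar>a\<bar> + \<bar>b\<bar> + B) integrable_on {a..b}" by (rule integrable_const_ivl)
    show "{a..b} \<in> sets lebesgue" by simp
    fix x assume "x \<in> {a..b}"
    then show "norm (\<psi> x) \<le> \<bar>a\<bar> + \<bar>b\<bar> + B" using bd1[of x] by auto
  qed
  define Z where "Z x = Inf (\<psi> ` {x..})" for x
  have bb: "bdd_below (\<psi> ` {x..})" for x
  proof (rule bdd_belowI)
    fix y assume "y \<in> \<psi> ` {x..}"
    then obtain s where "x \<le> s" "y = \<psi> s" by auto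
    then show "x - B \<le> y" using bd1(1)[of s] by simp
  qed
  have Zle: "Z x \<le> \<psi> s" if "x \<le> s" for x s
    unfolding Z_def by (rule cInf_lower) (use bb that in auto)
  have Zge: "c \<le> Z x" if "\<And>s. x \<le> s \<Longrightarrow> c \<le> \<psi> s" for c x
    unfolding Z_def by (rule cInf_greatest) (use that in auto)
  have Zmono: "mono Z"
    by (intro monoI Zge Zle) auto
  have Zbd: "x - B \<le> Z x" "Z x \<le> x + B" for x
  proof -
    show "x - B \<le> Z x"
    proof (rule Zge)
      fix s assume "x \<le> s"
      then show "x - B \<le> \<psi> s" using bd1(1)[of s] by simp
    qed
    show "Z x \<le> x + B" using Zle[of x x] bd1(2)[of x] by simp
  qed
  have Zper: "Z (x + 1) = Z x + 1" for x
  proof (rule antisym)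
    have "Z (x + 1) - 1 \<le> Z x"
    proof (rule Zge)
      fix s assume "x \<le> s"
      then show "Z (x + 1) - 1 \<le> \<psi> s" using Zle[of "x + 1" "s + 1"] per[of s] by auto
    qed
    then show "Z (x + 1) \<le> Z x + 1" by simp
    show "Z x + 1 \<le> Z (x + 1)"
    proof (rule Zge)
      fix s assume "x + 1 \<le> s"
      then show "Z x + 1 \<le> \<psi> s" using Zle[of x "s - 1"] per[of "s - 1"] by auto
    qed
  qed
  have ZH: "w \<le> \<theta> z" if "Z w < z" for w z
  proof (rule ccontr)
    assume "\<not> w \<le> \<theta> z"
    then have "z \<le> Z w" by (intro Zge H) auto
    with that show False by simp
  qed
  show "mono \<psi>"
  proof (rule ccontr)
    assume "\<not> mono \<psi>"
    have "\<exists>x0. Z x0 < \<psi> x0"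
    proof (rule ccontr)
      assume "\<nexists>x0. Z x0 < \<psi> x0"
      then have "Z x = \<psi> x" for x using Zle[of x x] by (metis order_refl order_le_less)
      then have "Z = \<psi>" by auto
      with Zmono \<open>\<not> mono \<psi>\<close> show False by simp
    qed
    then obtain x0 where x0: "Z x0 < \<psi> x0" by blast
    define \<eta> where "\<eta> = (\<psi> x0 - Z x0) / 2"
    have \<eta>: "\<eta> > 0" using x0 by (simp add: \<eta>_def)
    obtain d where d: "d > 0" "\<And>s. s \<in> {x0..x0 + d} \<Longrightarrow> \<psi> s > \<psi> x0 - \<eta>"
      using rc[OF \<eta>, of x0] by blast
    define \<beta> where "\<beta> = min d 1"
    have \<beta>: "0 < \<beta>" "\<beta> \<le> 1" "\<And>s. s \<in> {x0..x0 + \<beta>} \<Longrightarrow> \<psi> s \<ge> Z x0 + \<eta>"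
    proof -
      show "0 < \<beta>" "\<beta> \<le> 1" using d(1) by (auto simp: \<beta>_def)
      fix s assume "s \<in> {x0..x0 + \<beta>}"
      then have "\<psi> x0 - \<eta> < \<psi> s" by (intro d(2)) (auto simp: \<beta>_def)
      moreover have "\<psi> x0 - \<eta> = Z x0 + \<eta>" by (simp add: \<eta>_def field_simps)
      ultimately show "\<psi> s \<ge> Z x0 + \<eta>" by simp
    qed
    \<comment> \<open>Just to the right of \<open>x0\<close> the values of \<open>\<psi>\<close>
      stay above \<open>Z x0\<close> by \<open>\<eta>\<close> and do not contribute to the infimum,
      so \<open>Z\<close> is flat there. Hence the gain \<open>\<beta> * \<eta>\<close> in
      \<open>\<phi>\<close> is not consumed by the error term with \<open>Z y - Z x\<close>.\<close>
    have Zb: "Z (x0 + \<beta>) = Z x0"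
    proof (rule antisym)
      show "Z x0 \<le> Z (x0 + \<beta>)" using Zmono \<beta> by (simp add: monoD)
      have "min (Z (x0 + \<beta>)) (Z x0 + \<eta>) \<le> Z x0"
      proof (rule Zge)
        fix s assume "x0 \<le> s"
        show "min (Z (x0 + \<beta>)) (Z x0 + \<eta>) \<le> \<psi> s"
        proof (cases "s \<le> x0 + \<beta>")
          case True
          then show ?thesis using \<beta>(3)[of s] \<open>x0 \<le> s\<close> by auto
        next
          case False
          then show ?thesis using Zle[of "x0 + \<beta>" s] by auto
        qed
      qed
      then show "Z (x0 + \<beta>) \<le> Z x0" using \<eta> by (auto simp: min_def split: if_splits)
    qed
    define c where "c = x0 - B - 1"
    define P where "P x = integral {c..x} \<psi>" for x
    have Pd: "P y - P x = integral {x..y} \<psi>" if "c \<le> x" "x \<le> y" for x y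
      using Henstock_Kurzweil_Integration.integral_combine[OF that int] by (simp add: P_def)
    \<comment> \<open>f is a function with partial derivatives \<psi> w - z and \<theta> z - w, periodic along the diagonal.\<close>
    define f where "f w z = P w + (z\<^sup>2 + R z - P z) - w * z" for w z
    define \<phi> where "\<phi> x = f x (Z x)" for x
    have chi: "(z2\<^sup>2 + R z2 - P z2) - (z1\<^sup>2 + R z1 - P z1) \<ge> x1 * (z2 - z1)"
      if "c \<le> z1" "z1 \<le> z2" "z1 = Z x1" for x1 z1 z2
    proof -
      have "((\<lambda>z. 2 * z + R' z) has_integral (z2\<^sup>2 + R z2 - (z1\<^sup>2 + R z1))) {z1..z2}"
        using that(2)
        by (intro fundamental_theorem_of_calculus)
           (auto intro!: derivative_eq_intros DERIV_subset[OF R]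
                 simp: has_real_derivative_iff_has_vector_derivative[symmetric])
      then have "((\<lambda>z. (2 * z + R' z) - \<psi> z) has_integral (z2\<^sup>2 + R z2 - (z1\<^sup>2 + R z1)) - (P z2 - P z1)) {z1..z2}"
        unfolding Pd[OF that(1,2)] by (intro has_integral_diff integrable_integral int)
      then have 1: "(\<theta> has_integral (z2\<^sup>2 + R z2 - (z1\<^sup>2 + R z1)) - (P z2 - P z1)) {z1..z2}"
        by (rule has_integral_eq_rhs[OF has_integral_eq[rotated]]) (use sum in \<open>auto simp: algebra_simps eq_diff_eq\<close>)
      \<comment> \<open>The bound \<open>x1 \<le> \<theta> z\<close> is known only strictly above
        \<open>Z x1\<close>; altering the integrand at the single point \<open>z1\<close> leaves the
        integral unchanged.\<close>
      have 2: "((\<lambda>z. if z = z1 then \<theta> z1 else x1) has_integral (x1 * (z2 - z1))) {z1..z2}"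
        by (rule has_integral_spike_finite[of "{z1}" _ _ "\<lambda>_. x1"])
           (use has_integral_const_real[of x1 z1 z2] that in \<open>auto simp: mult.commute\<close>)
      have "x1 * (z2 - z1) \<le> (z2\<^sup>2 + R z2 - (z1\<^sup>2 + R z1)) - (P z2 - P z1)"
        by (rule has_integral_le[OF 2 1]) (use ZH that in auto)
      then show ?thesis by linarith
    qed
    \<comment> \<open>Move from (x, Z x) to (x, Z y), where \<open>chi\<close> makes the change
      nonnegative, and then to (y, Z y). Replacing Z y by Z x in the second change produces the last
      term.\<close>
    have step: "\<phi> y - \<phi> x \<ge> integral {x..y} \<psi> - Z x * (y - x) - (y - x) * (Z y - Z x)"
      if "x0 \<le> x" "x \<le> y" for x y
    proof -
      have "c \<le> Z x" using Zbd(1)[of x] that by (simp add: c_def)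
      moreover have "Z x \<le> Z y" using Zmono that by (simp add: monoD)
      ultimately have 1: "((Z y)\<^sup>2 + R (Z y) - P (Z y)) - ((Z x)\<^sup>2 + R (Z x) - P (Z x)) \<ge> x * (Z y - Z x)"
        by (rule chi) simp
      have 2: "P y - P x = integral {x..y} \<psi>" using that B0 by (intro Pd) (auto simp: c_def)
      show ?thesis using 1 2 unfolding \<phi>_def f_def by (simp add: algebra_simps)
    qed
    have lower: "integral {x..y} \<psi> \<ge> (y - x) * b" if "x \<le> y" "\<And>s. s \<in> {x..y} \<Longrightarrow> b \<le> \<psi> s" for x y b
      using has_integral_le[OF has_integral_const_real[of b x y] integrable_integral[OF int[of x y]]] that
      by auto
    have step2: "\<phi> y - \<phi> x \<ge> - (y - x) * (Z y - Z x)" if "x0 \<le> x" "x \<le> y" for x y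
      using step[OF that] lower[of x y "Z x"] Zle[of x] that by (auto simp: algebra_simps)
    have mon: "\<phi> (x0 + \<beta>) \<le> \<phi> (x0 + 1)"
    proof -
      \<comment> \<open>The estimate holds to the right of \<open>x0\<close> only. Freezing the
        argument at \<open>x0\<close> extends it to the whole line, as the monotonicity lemma
        requires.\<close>
      let ?m = "\<lambda>x. max x0 x"
      have "\<phi> (?m (x0 + \<beta>)) \<le> \<phi> (?m (x0 + 1))"
      proof (rule mono_if_quadratic_lower_bound[where Z = "\<lambda>x. Z (?m x)" and \<phi> = "\<lambda>x. \<phi> (?m x)"])
        show "mono (\<lambda>x. Z (?m x))" using Zmono by (auto intro!: monoI monoD[OF Zmono])
        show "- (y - x) * (Z (?m y) - Z (?m x)) \<le> \<phi> (?m y) - \<phi> (?m x)" if "x \<le> y" for x y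
        proof -
          have "?m x \<le> ?m y" using that by auto
          then have "Z (?m x) \<le> Z (?m y)" using Zmono by (simp add: monoD)
          moreover have "?m y - ?m x \<le> y - x" using that by auto
          ultimately have "- (y - x) * (Z (?m y) - Z (?m x)) \<le> - (?m y - ?m x) * (Z (?m y) - Z (?m x))"
            by (intro mult_right_mono) auto
          also have "\<dots> \<le> \<phi> (?m y) - \<phi> (?m x)" using \<open>?m x \<le> ?m y\<close> by (intro step2) auto
          finally show ?thesis .
        qed
      qed (use \<beta> in auto)
      then show ?thesis using \<beta> by (simp add: max_def)
    qed
    have "\<phi> (x0 + \<beta>) - \<phi> x0 \<ge> \<beta> * (Z x0 + \<eta>) - Z x0 * \<beta>"
      using step[of x0 "x0 + \<beta>"] lower[of x0 "x0 + \<beta>" "Z x0 + \<eta>"] \<beta> Zb by auto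
    then have inc: "\<phi> (x0 + \<beta>) - \<phi> x0 > 0" using mult_pos_pos[OF \<beta>(1) \<eta>] by (simp add: algebra_simps)
    have Pp: "P (x + 1) - P x - x = P (y + 1) - P y - y" if "c \<le> x" "c \<le> y" for x y
    proof -
      have *: "P (y + 1) - P y - y = P (x + 1) - P x - x" if "c \<le> x" "x \<le> y" for x y
      proof -
        have "integral {x + 1..y + 1} \<psi> = integral {x..y} (\<lambda>s. \<psi> (s + 1))"
          using integral_shift_real_ivl[of "x + 1" 1 "y + 1" \<psi>] by simp
        also have "\<dots> = integral {x..y} (\<lambda>s. \<psi> s + 1)" by (simp add: per)
        also have "\<dots> = integral {x..y} \<psi> + integral {x..y} (\<lambda>s. 1)"
          by (intro Henstock_Kurzweil_Integration.integral_add int integrable_const_ivl)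
        also have "\<dots> = integral {x..y} \<psi> + (y - x)" using that by simp
        finally have "P (y + 1) - P (x + 1) = P y - P x + (y - x)"
          using Pd[of x y] Pd[of "x + 1" "y + 1"] that by simp
        then show ?thesis by simp
      qed
      show ?thesis using *[of x y] *[of y x] that by linarith
    qed
    have "\<phi> (x0 + 1) = \<phi> x0"
    proof -
      have "c \<le> Z x0" "c \<le> x0" using Zbd(1)[of x0] B0 by (auto simp: c_def)
      then have "P (x0 + 1) - P x0 - x0 = P (Z x0 + 1) - P (Z x0) - Z x0" by (intro Pp) auto
      then show ?thesis unfolding \<phi>_def f_def Zper Rper by (simp add: algebra_simps power2_eq_square)
    qed
    with inc mon show False by simp
  qed
qed

section \<open>From an invariant curve to the graph of a homeomorphism\<close>

lemma unit_shift_of_int: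
  fixes f :: "real \<Rightarrow> real"
  assumes f1: "\<And>x. f (x + 1) = f x + 1"
  shows "f (t + of_int i) = f t + of_int i"
proof -
  have fn: "f (t + real n) = f t + real n" for t n
  proof (induction n)
    case (Suc n)
    have "f (t + real (Suc n)) = f ((t + real n) + 1)" by (simp add: ac_simps)
    then show ?case using Suc f1[of "t + real n"] by simp
  qed simp
  show ?thesis
  proof (cases "i \<ge> 0")
    case True then show ?thesis using fn[of t "nat i"] by simp
  next
    case False then show ?thesis using fn[of "t + of_int i" "nat (- i)"] by simp
  qed
qed

lemma unit_shift_displacement_bound:
  fixes f :: "real \<Rightarrow> real"
  assumes "\<And>x. f (x + 1) = f x + 1" and f0: "\<And>x. x \<in> {0..1} \<Longrightarrow> \<bar>f x - x\<bar> \<le> C"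
  shows "\<bar>f x - x\<bar> \<le> C"
proof -
  have "frac x \<in> {0..1}" using frac_lt_1[of x] by simp
  moreover have "f x = f (frac x) + of_int \<lfloor>x\<rfloor>"
    using unit_shift_of_int[of f "frac x" "\<lfloor>x\<rfloor>", OF assms(1)] by (simp add: frac_def)
  ultimately show ?thesis using f0[of "frac x"] by (simp add: frac_def)
qed

lemma continuous_inj_unit_shift_imp_strict_mono:
  fixes f :: "real \<Rightarrow> real"
  assumes "continuous_on UNIV f" "inj f" and f1: "\<And>x. f (x + 1) = f x + 1"
  shows "strict_mono f"
proof (rule strict_monoI)
  fix s t :: real assume st: "s < t"
  obtain n where n: "t < s + of_int n" using ex_less_of_int[of "t - s"] by (auto simp: algebra_simps)
  have "f s < f t \<and> f t < f (s + of_int n) \<or> f (s + of_int n) < f t \<and> f t < f s"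
    by (rule continuous_inj_imp_mono[OF st n])
       (auto intro: continuous_on_subset[OF assms(1)] inj_on_subset[OF assms(2)])
  moreover have "0 < real_of_int n" using st n by linarith
  ultimately show "f s < f t" using unit_shift_of_int[of f s n, OF f1] by auto
qed

lemma continuous_on_interval_bounded:
  fixes f :: "real \<Rightarrow> real"
  assumes "continuous_on {a..b} f"
  obtains M where "\<And>x. x \<in> {a..b} \<Longrightarrow> \<bar>f x\<bar> \<le> M"
proof -
  have "compact (f ` {a..b})" by (intro compact_continuous_image assms) auto
  then obtain M where "\<forall>y\<in>f ` {a..b}. norm y \<le> M"
    using compact_imp_bounded[of "f ` {a..b}"] unfolding bounded_iff by blast
  then show ?thesis by (intro that[of M]) auto
qed

text \<open>A continuous injection of the line need not have a continuous inverse. Here the abscissa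
  determines the parameter up to \<open>B\<close>, so locally only a compact parameter interval
  matters, and there compactness gives continuity.\<close>

lemma continuous_on_inv_curve:
  fixes \<gamma> k :: "real \<Rightarrow> real \<times> real"
  assumes \<gamma>: "continuous_on UNIV \<gamma>" "inj \<gamma>" and bd: "\<And>t. \<bar>fst (\<gamma> t) - t\<bar> \<le> B"
    and k: "continuous_on UNIV k" "range k \<subseteq> range \<gamma>"
  shows "continuous_on UNIV (\<lambda>x. inv \<gamma> (k x))"
proof -
  have "isCont (\<lambda>x. inv \<gamma> (k x)) x" for x
  proof -
    let ?I = "{x - 1..x + 1}"
    have kI: "continuous_on ?I k" using k(1) continuous_on_subset by blast
    have "continuous_on ?I (\<lambda>y. fst (k y))" by (intro continuous_intros kI)
    then obtain M where M: "\<And>y. y \<in> ?I \<Longrightarrow> \<bar>fst (k y)\<bar> \<le> M"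
      using continuous_on_interval_bounded by blast
    let ?S = "{-M - B..M + B}"
    have inS: "k y \<in> \<gamma> ` ?S" if "y \<in> ?I" for y
    proof -
      obtain t where t: "k y = \<gamma> t" using k(2) by auto
      then have "t \<in> ?S" using M[OF that] bd[of t] by (auto simp: abs_le_iff)
      then show ?thesis using t by auto
    qed
    have "continuous_on (\<gamma> ` ?S) (inv \<gamma>)"
      by (rule continuous_on_inv) (use \<gamma> continuous_on_subset in \<open>auto\<close>)
    then have "continuous_on ?I (\<lambda>x. inv \<gamma> (k x))"
      by (rule continuous_on_compose2[OF _ kI]) (use inS in auto)
    then show ?thesis by (rule continuous_on_interior) simp
  qed
  then show ?thesis by (simp add: continuous_on_eq_continuous_at)
qed

text \<open>On the parameter line the dynamics is a homeomorphism \<open>G\<close>, even if the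
  curve folds over itself. The selection \<open>t1\<close> may jump, so that \<open>\<psi>\<close>
  and \<open>\<theta>\<close> are at first only measurable and continuous from the right;
  \<open>zero_flux_imp_mono\<close> asks for no more.\<close>

lemma graph_of_invariant_circle:
  fixes R R' :: "real \<Rightarrow> real"
  assumes R: "\<And>x. (R has_real_derivative R' x) (at x)" and Rper: "\<And>x. R (x + 1) = R x"
    and R'c: "continuous_on UNIV R'"
    and circ: "has_invariant_circle_freq (twist_map (\<lambda>x x'. (x - x')\<^sup>2 / 2 + R x')) \<omega>"
  obtains g where "invariant_graph R' \<omega> g"
proof -
  define F where "F = twist_map (\<lambda>x x'. (x - x')\<^sup>2 / 2 + R x')"
  have F: "F (x, y) = (x + y, y + R' (x + y))" for x y
    unfolding F_def by (rule twist_map_eq[OF R])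
  have R'per: "R' (x + 1) = R' x" for x
  proof -
    have "((\<lambda>x. R (x + 1)) has_real_derivative R' (x + 1)) (at x)"
      using R[of "x + 1"] by (simp add: DERIV_shift)
    then show ?thesis using DERIV_unique[OF R[of x]] by (simp add: Rper)
  qed
  obtain \<gamma> :: "real \<Rightarrow> real \<times> real" where circ': "continuous_on UNIV \<gamma> \<and> inj \<gamma> \<and> (\<forall>t. \<gamma> (t + 1) = \<gamma> t + (1, 0)) \<and> F ` range \<gamma> = range \<gamma> \<and>
        (\<forall>z\<in>range \<gamma>. (\<lambda>n. fst ((F ^^ n) z) / real n) \<longlonglongrightarrow> \<omega>)"
    using circ[unfolded has_invariant_circle_freq_def, folded F_def] ..
  have \<gamma>: "continuous_on UNIV \<gamma>" "inj \<gamma>" "\<And>t. \<gamma> (t + 1) = \<gamma> t + (1, 0)" "F ` range \<gamma> = range \<gamma>"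
    using circ' by blast+
  have rot: "(\<lambda>n. fst ((F ^^ n) (\<gamma> t)) / real n) \<longlonglongrightarrow> \<omega>" for t
    using circ' by blast
  have Fc: "continuous_on UNIV (\<lambda>t. F (\<gamma> t))"
  proof -
    have "(\<lambda>t. F (\<gamma> t)) = (\<lambda>t. (fst (\<gamma> t) + snd (\<gamma> t), snd (\<gamma> t) + R' (fst (\<gamma> t) + snd (\<gamma> t))))"
      by (rule ext) (simp add: F[symmetric])
    moreover have "continuous_on UNIV (\<lambda>t. R' (fst (\<gamma> t) + snd (\<gamma> t)))"
      by (intro continuous_on_compose2[OF R'c] continuous_intros \<gamma>(1)) auto
    ultimately show ?thesis by (simp only:) (intro continuous_intros \<gamma>(1))
  qed
  have F_inj: "inj F"
  proof (rule injI)
    fix z z' assume *: "F z = F z'"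
    obtain x y x' y' where "z = (x, y)" "z' = (x', y')" by (metis surj_pair)
    then show "z = z'" using * by (auto simp: F)
  qed
  define X where "X t = fst (\<gamma> t)" for t
  have Xc: "continuous_on UNIV X" unfolding X_def by (intro continuous_intros \<gamma>(1))
  have X1: "X (t + 1) = X t + 1" for t unfolding X_def \<gamma>(3) by simp
  obtain B where B: "\<And>t. \<bar>X t - t\<bar> \<le> B"
  proof -
    have "continuous_on {0..1} (\<lambda>t. X t - t)"
      by (intro continuous_intros continuous_on_subset[OF Xc]) auto
    then obtain B where "\<And>t. t \<in> {0..1} \<Longrightarrow> \<bar>X t - t\<bar> \<le> B"
      using continuous_on_interval_bounded by blast
    then show ?thesis using unit_shift_displacement_bound[of X, OF X1] that by blast
  qed
  have Bl: "t - B \<le> X t" and Bu: "X t \<le> t + B" for t using B[of t] by (auto simp: abs_le_iff)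
  define G where "G t = inv \<gamma> (F (\<gamma> t))" for t
  have G: "\<gamma> (G t) = F (\<gamma> t)" for t
    unfolding G_def using \<gamma>(4) by (intro f_inv_into_f) auto
  have Gc: "continuous_on UNIV G"
    unfolding G_def by (rule continuous_on_inv_curve[OF \<gamma>(1,2) _ Fc]) (use B \<gamma>(4) in \<open>auto simp: X_def\<close>)
  have Ginj: "inj G"
    proof (rule injI)
    fix s t assume "G s = G t"
    then have "F (\<gamma> s) = F (\<gamma> t)" by (simp flip: G)
    then show "s = t" using F_inj \<gamma>(2) by (simp add: inj_eq)
  qed
  have F1: "F (z + (1, 0)) = F z + (1, 0)" for z
  proof -
    have "R' (x + 1 + y) = R' (x + y)" for x y using R'per[of "x + y"] by (simp add: ac_simps)
    then show ?thesis by (cases z) (simp add: F)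
  qed
  have G1: "G (t + 1) = G t + 1" for t
  proof -
    have "\<gamma> (G (t + 1)) = \<gamma> (G t + 1)" by (simp add: G \<gamma>(3) F1)
    then show ?thesis using \<gamma>(2) by (simp add: inj_eq)
  qed
  have Gmono: "strict_mono G"
    by (rule continuous_inj_unit_shift_imp_strict_mono[OF Gc Ginj G1])
  have Gless: "G s < G t \<longleftrightarrow> s < t" for s t using Gmono by (simp add: strict_mono_less)
  have Gsurj: "surj G"
  proof -
    have "\<exists>s. t = G s" for t
    proof -
      have "\<gamma> t \<in> F ` range \<gamma>" using \<gamma>(4) by simp
      then obtain s where "\<gamma> t = F (\<gamma> s)" by auto
      then show ?thesis using G \<gamma>(2) by (metis inj_eq)
    qed
    then show ?thesis by (auto simp: surj_def)
  qed
  define H where "H = inv G"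
  have GH: "G (H t) = t" "H (G t) = t" for t
    using Gsurj Ginj by (auto simp: H_def surj_f_inv_f)
  have XG: "X (G t) = fst (\<gamma> t) + snd (\<gamma> t)" for t
    using F[of "fst (\<gamma> t)" "snd (\<gamma> t)"] by (simp add: X_def G)
  have sndG: "snd (\<gamma> (G t)) = snd (\<gamma> t) + R' (X (G t))" for t
    using F[of "fst (\<gamma> t)" "snd (\<gamma> t)"] by (simp add: XG) (simp add: G)
  have eq: "X (G t) + X (H t) = 2 * X t + R' (X t)" for t
    using XG[of t] XG[of "H t"] sndG[of "H t"] by (simp add: GH X_def)
  have XGc: "continuous_on UNIV (\<lambda>t. X (G t))" unfolding XG by (intro continuous_intros \<gamma>(1))

  define t1 where "t1 x = Sup {t. X t \<le> x}" for x
  have bdd: "bdd_above {t. X t \<le> x}" for x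
    proof (rule bdd_aboveI)
    fix t assume "t \<in> {t. X t \<le> x}"
    then show "t \<le> x + B" using Bl[of t] by simp
  qed
  have ne: "{t. X t \<le> x} \<noteq> {}" for x
    using Bu[of "x - B"] by (auto intro!: exI[of _ "x - B"])
  have clo: "closed {t. X t \<le> x}" for x
    by (intro closed_Collect_le continuous_intros Xc)
  have t1le: "X (t1 x) \<le> x" for x
    using closed_contains_Sup[OF ne bdd clo, of x] by (simp add: t1_def)
  have t1gt: "x < X t" if "t1 x < t" for x t
    using cSup_upper[OF _ bdd, of t x] that by (force simp: t1_def)
  have t1: "X (t1 x) = x" for x
  proof (rule ccontr)
    assume "X (t1 x) \<noteq> x"
    then have l: "X (t1 x) < x" using t1le[of x] by simp
    have "t1 x \<le> t1 x + 1" "x \<le> X (t1 x + 1)" using t1gt[of x "t1 x + 1"] by auto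
    then obtain t where t: "t1 x \<le> t" "X t = x"
      using IVT'[of X "t1 x" x "t1 x + 1"] l continuous_on_subset[OF Xc] by auto
    then show False using t1gt[of x t] l by (cases "t = t1 x") auto
  qed
  have t1ge: "x \<le> X t" if "t1 x \<le> t" for x t
    using t1[of x] t1gt[of x t] that by (cases "t = t1 x") auto
  have t1mono: "t1 x < t1 y" if "x < y" for x y
  proof (rule ccontr)
    assume "\<not> t1 x < t1 y"
    then have "y \<le> X (t1 x)" by (intro t1ge) simp
    then show False using that t1[of x] by simp
  qed
  have t1per: "t1 (x + 1) = t1 x + 1" for x
  proof (rule antisym)
    show "t1 (x + 1) \<le> t1 x + 1"
    proof (rule ccontr)
      assume "\<not> ?thesis"
      then have "x < X (t1 (x + 1) - 1)" by (intro t1gt) simp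
      then show False using X1[of "t1 (x + 1) - 1"] t1[of "x + 1"] by simp
    qed
    show "t1 x + 1 \<le> t1 (x + 1)"
    proof (rule ccontr)
      assume "\<not> ?thesis"
      then have "x + 1 < X (t1 x + 1)" by (intro t1gt) simp
      then show False using X1[of "t1 x"] t1[of x] by simp
    qed
  qed
  \<comment> \<open>On a compact range of parameters at least \<open>e\<close> beyond
    \<open>t1 x\<close>, the minimum of \<open>X\<close> exceeds x. Abscissas slightly beyond x
    therefore have their last parameter before that range.\<close>
  have t1rc: "\<exists>d>0. \<forall>s\<in>{x..x + d}. t1 s < t1 x + e" if e: "e > 0" for x e
  proof -
    let ?S = "{t1 x + e..max (t1 x + e) (x + 1 + B)}"
    have "\<exists>m\<in>?S. \<forall>t\<in>?S. X m \<le> X t"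
      by (intro continuous_attains_inf continuous_on_subset[OF Xc]) auto
    then obtain m where m: "m \<in> ?S" "\<And>t. t \<in> ?S \<Longrightarrow> X m \<le> X t" by blast
    have mx: "X m > x" using m(1) e by (intro t1gt) auto
    define d where "d = min 1 ((X m - x) / 2)"
    have "t1 s < t1 x + e" if "s \<in> {x..x + d}" for s
    proof (rule ccontr)
      assume "\<not> ?thesis"
      moreover have "t1 s \<le> s + B" using Bl[of "t1 s"] t1[of s] by simp
      ultimately have "t1 s \<in> ?S" using that by (auto simp: d_def)
      then have "X m \<le> s" using m(2)[of "t1 s"] t1[of s] by simp
      moreover have "s \<le> x + (X m - x) / 2" using that by (auto simp: d_def)
      ultimately show False using mx by (simp add: field_simps)
    qed
    moreover have "d > 0" using mx by (simp add: d_def)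
    ultimately show ?thesis by blast
  qed
  have t1meas: "t1 \<in> borel_measurable borel"
    using t1mono by (intro borel_measurable_mono monoI) (metis less_eq_real_def)
  have H1: "H (t + 1) = H t + 1" for t
    using G1[of "H t"] Ginj by (metis GH inj_eq)
  define \<psi> where "\<psi> x = X (G (t1 x))" for x
  define \<theta> where "\<theta> x = X (H (t1 x))" for x
  have sum: "\<psi> x + \<theta> x = 2 * x + R' x" for x using eq[of "t1 x"] by (simp add: \<psi>_def \<theta>_def t1)
  have \<psi>per: "\<psi> (x + 1) = \<psi> x + 1" for x by (simp add: \<psi>_def t1per G1 X1)
  have \<theta>per: "\<theta> (x + 1) = \<theta> x + 1" for x by (simp add: \<theta>_def t1per H1 X1)
  have \<psi>rc: "\<exists>d>0. \<forall>s\<in>{x..x + d}. \<bar>\<psi> s - \<psi> x\<bar> < e" if e: "e > 0" for x e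
  proof -
    have "isCont (\<lambda>t. X (G t)) (t1 x)" using XGc by (simp add: continuous_on_eq_continuous_at)
    then obtain \<eta> where \<eta>: "\<eta> > 0" "\<And>t. \<bar>t - t1 x\<bar> < \<eta> \<Longrightarrow> \<bar>X (G t) - X (G (t1 x))\<bar> < e"
      using e unfolding continuous_at_eps_delta by (auto simp: dist_real_def)
    obtain d where d: "d > 0" "\<And>s. s \<in> {x..x + d} \<Longrightarrow> t1 s < t1 x + \<eta>"
      using t1rc[OF \<eta>(1), of x] by blast
    have "\<bar>\<psi> s - \<psi> x\<bar> < e" if "s \<in> {x..x + d}" for s
    proof -
      have "t1 x \<le> t1 s" using t1mono[of x s] that by (cases "x = s") auto
      then show ?thesis unfolding \<psi>_def using d(2)[OF that] by (intro \<eta>(2)) auto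
    qed
    then show ?thesis using d(1) by blast
  qed
  have \<psi>m: "\<psi> \<in> borel_measurable borel"
    unfolding \<psi>_def using measurable_compose[OF t1meas borel_measurable_continuous_onI[OF XGc]] by simp
  have R'm: "R' \<in> borel_measurable borel" by (rule borel_measurable_continuous_onI[OF R'c])
  have \<theta>eq: "\<theta> = (\<lambda>x. 2 * x + R' x - \<psi> x)" using sum by (auto simp: algebra_simps eq_diff_eq)
  have \<theta>m: "\<theta> \<in> borel_measurable borel" unfolding \<theta>eq using \<psi>m R'm by measurable
  \<comment> \<open>Only the order preservation of \<open>G\<close> enters: from \<open>t1 w\<close>
    on, abscissas are at least w, so \<open>H (t1 z)\<close> precedes \<open>t1 w\<close>; applying
    \<open>G\<close> puts \<open>t1 z\<close> before \<open>G (t1 w)\<close>.\<close>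
  have key: "z < \<psi> w" if "\<theta> z < w" for w z
  proof -
    have "H (t1 z) < t1 w"
    proof (rule ccontr)
      assume "\<not> ?thesis"
      then have "w \<le> X (H (t1 z))" by (intro t1ge) simp
      with that show False by (simp add: \<theta>_def)
    qed
    then have "t1 z < G (t1 w)" using Gless[of "H (t1 z)" "t1 w"] by (simp add: GH)
    then show ?thesis unfolding \<psi>_def by (rule t1gt)
  qed
  have t1bd: "t1 0 \<le> t1 x \<and> t1 x \<le> t1 1" if "x \<in> {0..1}" for x
    using t1mono[of 0 x] t1mono[of x 1] that by (cases "x = 0"; cases "x = 1") auto
  obtain C1 where C1: "\<And>x. \<bar>\<psi> x - x\<bar> \<le> C1"
  proof -
    obtain C where C: "\<And>t. t \<in> {t1 0..t1 1} \<Longrightarrow> \<bar>X (G t)\<bar> \<le> C"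
      using continuous_on_interval_bounded continuous_on_subset[OF XGc subset_UNIV] by blast
    have "\<bar>\<psi> x - x\<bar> \<le> C + 1" if "x \<in> {0..1}" for x
      using C[of "t1 x"] t1bd[OF that] that unfolding \<psi>_def by (auto simp: abs_le_iff)
    then show ?thesis using unit_shift_displacement_bound[of \<psi>, OF \<psi>per] that by blast
  qed
  obtain C2 where C2: "\<And>x. \<bar>\<theta> x - x\<bar> \<le> C2"
  proof -
    obtain C where C: "\<And>t. t \<in> {0..1} \<Longrightarrow> \<bar>R' t\<bar> \<le> C"
      using continuous_on_interval_bounded continuous_on_subset[OF R'c subset_UNIV] by blast
    have "\<bar>\<theta> x - x\<bar> \<le> C + C1" if "x \<in> {0..1}" for x
      using C[OF that] C1[of x] unfolding \<theta>eq by (auto simp: abs_le_iff)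
    then show ?thesis using unit_shift_displacement_bound[of \<theta>, OF \<theta>per] that by blast
  qed
  have \<psi>mono: "mono \<psi>"
  proof (rule zero_flux_imp_mono[OF R Rper \<psi>m \<psi>per C1 sum])
    show "z \<le> \<psi> w" if "\<theta> z < w" for w z using key[OF that] by simp
    show "\<exists>d>0. \<forall>s\<in>{x..x + d}. \<psi> x - e < \<psi> s" if "e > 0" for x e
      using \<psi>rc[OF that, of x] by (smt (verit))
  qed
  \<comment> \<open>The contrapositive of \<open>key\<close> is the same hypothesis with future and
    past exchanged, so the flux argument applies to \<open>\<theta>\<close> as well.\<close>
  have \<theta>mono: "mono \<theta>"
  proof (rule zero_flux_imp_mono[OF R Rper \<theta>m \<theta>per C2])
    show "\<theta> x + \<psi> x = 2 * x + R' x" for x using sum[of x] by simp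
    show "z \<le> \<theta> w" if "\<psi> z < w" for w z using key[of w z] that by force
    show "\<exists>d>0. \<forall>s\<in>{x..x + d}. \<theta> x - e < \<theta> s" if e: "e > 0" for x e
    proof -
      obtain d where d: "d > 0" "\<And>s. s \<in> {x..x + d} \<Longrightarrow> \<bar>\<psi> s - \<psi> x\<bar> < e / 2"
        using \<psi>rc[of "e / 2" x] e by auto
      have "isCont R' x" using R'c by (simp add: continuous_on_eq_continuous_at)
      from this[unfolded continuous_at_eps_delta, rule_format, of "e / 2"] e
      obtain d' where d': "d' > 0" "\<And>s. \<bar>s - x\<bar> < d' \<Longrightarrow> \<bar>R' s - R' x\<bar> < e / 2"
        unfolding dist_real_def by (metis half_gt_zero)
      have "\<theta> x - e < \<theta> s" if "s \<in> {x..x + min d (d' / 2)}" for s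
      proof -
        have "s \<in> {x..x + d}" "\<bar>s - x\<bar> < d'" "x \<le> s" using that d' by auto
        then show ?thesis using d(2)[of s] d'(2)[of s] unfolding \<theta>eq by (smt (verit) field_sum_of_halves)
      qed
      then show ?thesis using d(1) d'(1) by (intro exI[of _ "min d (d' / 2)"]) auto
    qed
  qed
  \<comment> \<open>Two nondecreasing functions with continuous sum are continuous, since the
    increment of either is dominated by that of the sum.\<close>
  have \<psi>c: "continuous_on UNIV \<psi>"
  proof -
    have "isCont \<psi> x" for x
    proof -
      have "isCont (\<lambda>x. 2 * x + R' x) x"
        using R'c by (intro continuous_intros) (simp add: continuous_on_eq_continuous_at)
      then have "(\<lambda>y. 2 * y + R' y) \<midarrow>x\<rightarrow> 2 * x + R' x" by (simp add: isCont_def)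
      then have 0: "((\<lambda>y. \<bar>(2 * y + R' y) - (2 * x + R' x)\<bar>) \<longlongrightarrow> 0) (at x)"
        by (simp add: LIM_zero tendsto_rabs_zero)
      have "\<bar>\<psi> y - \<psi> x\<bar> \<le> \<bar>(2 * y + R' y) - (2 * x + R' x)\<bar>" for y
        using monoD[OF \<psi>mono, of x y] monoD[OF \<psi>mono, of y x] monoD[OF \<theta>mono, of x y] monoD[OF \<theta>mono, of y x]
          sum[of x] sum[of y] by linarith
      then have "((\<lambda>y. \<psi> y - \<psi> x) \<longlongrightarrow> 0) (at x)"
        by (intro Lim_null_comparison[OF _ 0]) (auto intro!: always_eventually)
      then show ?thesis by (simp add: isCont_def LIM_zero_iff)
    qed
    then show ?thesis by (simp add: continuous_on_eq_continuous_at)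
  qed
  have \<gamma>t1: "\<gamma> (t1 x) = (x, \<psi> x - x)" for x
    using XG[of "t1 x"] t1[of x] by (simp add: prod_eq_iff \<psi>_def X_def)
  have t1c: "continuous_on UNIV t1"
  proof -
    have 1: "continuous_on UNIV (\<lambda>x. (x, \<psi> x - x))" by (intro continuous_intros \<psi>c)
    have "range (\<lambda>x. (x, \<psi> x - x)) \<subseteq> range \<gamma>" using \<gamma>t1 by (auto intro: range_eqI[OF sym])
    then have "continuous_on UNIV (\<lambda>x. inv \<gamma> (x, \<psi> x - x))"
      by (intro continuous_on_inv_curve[OF \<gamma>(1,2) _ 1]) (use B in \<open>auto simp: X_def\<close>)
    moreover have "inv \<gamma> (x, \<psi> x - x) = t1 x" for x using \<gamma>t1[of x] \<gamma>(2) by (metis inv_f_f)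
    ultimately show ?thesis by simp
  qed
  \<comment> \<open>Being continuous, \<open>t1\<close> omits no parameter: every point of the
    circle is the last, hence the only one over its abscissa.\<close>
  have t1surj: "\<exists>x. t = t1 x" for t
  proof -
    have "t1 (t - B) \<le> t" using Bl[of "t1 (t - B)"] t1[of "t - B"] by simp
    moreover have "t \<le> t1 (t + B)" using Bu[of "t1 (t + B)"] t1[of "t + B"] by simp
    moreover have "t - B \<le> t + B" using B[of 0] by linarith
    ultimately show ?thesis using IVT'[of t1 "t - B" t "t + B"] continuous_on_subset[OF t1c] by auto
  qed
  have t1X: "t1 (X t) = t" for t using t1surj[of t] t1 by auto
  have t1\<psi>: "t1 (\<psi> x) = G (t1 x)" for x by (simp add: \<psi>_def t1X)
  have Xmono: "strict_mono X"
    by (rule strict_monoI) (metis t1X t1mono linorder_less_linear order_less_asym)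
  show thesis
  proof (rule that[of \<psi>], unfold invariant_graph_def, intro conjI allI)
    show "strict_mono \<psi>"
      by (rule strict_monoI) (simp add: \<psi>_def strict_mono_less[OF Xmono] Gless t1mono)
    show "surj \<psi>"
      unfolding surj_def \<psi>_def by (metis t1 t1surj GH(1))
    show "\<psi> (\<psi> x) + x = 2 * \<psi> x + R' (\<psi> x)" for x
    proof -
      have "\<theta> (\<psi> x) = x" by (simp add: \<theta>_def t1\<psi> GH t1)
      then show ?thesis using sum[of "\<psi> x"] by simp
    qed
    show "(\<lambda>n. (\<psi> ^^ n) x / real n) \<longlonglongrightarrow> \<omega>" for x
    proof -
      have "(F ^^ n) (\<gamma> (t1 x)) = \<gamma> (t1 ((\<psi> ^^ n) x))" for n
        by (induction n) (simp_all add: t1\<psi> G)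
      then have "fst ((F ^^ n) (\<gamma> (t1 x))) = (\<psi> ^^ n) x" for n using t1 by (simp add: X_def)
      then show ?thesis using rot[of "t1 x"] by simp
    qed
  qed (use \<psi>c \<psi>per in auto)
qed

section \<open>Trigonometric polynomials\<close>

text \<open>Degree at most \<open>N\<close> and Wiener norm, the absolute sum of the coefficients,
  at most \<open>C\<close>. This norm dominates the supremum, is submultiplicative, and pays a
  factor \<open>2 * pi * N\<close> per derivative, so all later estimates are bookkeeping of
  \<open>N\<close> and \<open>C\<close>.\<close>

definition trig_bounded :: "nat \<Rightarrow> real \<Rightarrow> (real \<Rightarrow> real) \<Rightarrow> bool" where
  "trig_bounded N C f \<longleftrightarrow> (\<exists>a b. f = trig_poly N a b \<and> (\<Sum>k\<le>N. \<bar>a k\<bar> + \<bar>b k\<bar>) \<le> C)"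

lemma trig_bounded_weaken: "trig_bounded N C f \<Longrightarrow> C \<le> D \<Longrightarrow> trig_bounded N D f"
  unfolding trig_bounded_def using order_trans by blast

lemma trig_bounded_add:
  assumes "trig_bounded N C f" "trig_bounded N D g"
  shows "trig_bounded N (C + D) (\<lambda>x. f x + g x)"
proof -
  obtain a b a' b' where f: "f = trig_poly N a b" "(\<Sum>k\<le>N. \<bar>a k\<bar> + \<bar>b k\<bar>) \<le> C"
    and g: "g = trig_poly N a' b'" "(\<Sum>k\<le>N. \<bar>a' k\<bar> + \<bar>b' k\<bar>) \<le> D"
    using assms unfolding trig_bounded_def by auto
  have "(\<lambda>x. f x + g x) = trig_poly N (\<lambda>k. a k + a' k) (\<lambda>k. b k + b' k)"
    by (simp add: fun_eq_iff f g trig_poly_def sum.distrib[symmetric] algebra_simps)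
  moreover have "(\<Sum>k\<le>N. \<bar>a k + a' k\<bar> + \<bar>b k + b' k\<bar>) \<le> (\<Sum>k\<le>N. (\<bar>a k\<bar> + \<bar>b k\<bar>) + (\<bar>a' k\<bar> + \<bar>b' k\<bar>))"
    by (intro sum_mono) linarith
  then have "(\<Sum>k\<le>N. \<bar>a k + a' k\<bar> + \<bar>b k + b' k\<bar>) \<le> C + D" using f g by (simp add: sum.distrib)
  ultimately show ?thesis unfolding trig_bounded_def by blast
qed

lemma trig_bounded_scale:
  assumes "trig_bounded N C f"
  shows "trig_bounded N (\<bar>c\<bar> * C) (\<lambda>x. c * f x)"
proof -
  obtain a b where f: "f = trig_poly N a b" "(\<Sum>k\<le>N. \<bar>a k\<bar> + \<bar>b k\<bar>) \<le> C"
    using assms unfolding trig_bounded_def by auto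
  have "(\<lambda>x. c * f x) = trig_poly N (\<lambda>k. c * a k) (\<lambda>k. c * b k)"
    by (simp add: fun_eq_iff f trig_poly_def sum_distrib_left algebra_simps)
  moreover have "(\<Sum>k\<le>N. \<bar>c * a k\<bar> + \<bar>c * b k\<bar>) \<le> \<bar>c\<bar> * C"
    using mult_left_mono[OF f(2), of "\<bar>c\<bar>"] by (simp add: sum_distrib_left abs_mult distrib_left)
  ultimately show ?thesis unfolding trig_bounded_def by blast
qed

text \<open>Frequencies are integers because the product formulas produce differences of frequencies
  of either sign.\<close>

lemma trig_bounded_cos_sin:
  assumes "\<bar>j\<bar> \<le> int N"
  shows "trig_bounded N 1 (\<lambda>x. cos (2 * pi * of_int j * x))" "trig_bounded N 1 (\<lambda>x. sin (2 * pi * of_int j * x))"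
proof -
  define k where "k = nat \<bar>j\<bar>"
  have k: "k \<le> N" using assms by (simp add: k_def)
  have cos: "trig_bounded N 1 (\<lambda>x. cos (2 * pi * real k * x))"
    unfolding trig_bounded_def
    by (rule exI[of _ "\<lambda>i. if i = k then 1 else 0"], rule exI[of _ "\<lambda>_. 0"])
       (use k in \<open>auto simp: trig_poly_def fun_eq_iff if_distrib[of "\<lambda>c. c * _"] cong: if_cong\<close>)
  have sin: "trig_bounded N 1 (\<lambda>x. sin (2 * pi * real k * x))"
    unfolding trig_bounded_def
    by (rule exI[of _ "\<lambda>_. 0"], rule exI[of _ "\<lambda>i. if i = k then 1 else 0"])
       (use k in \<open>auto simp: trig_poly_def fun_eq_iff if_distrib[of "\<lambda>c. c * _"] cong: if_cong\<close>)
  show "trig_bounded N 1 (\<lambda>x. cos (2 * pi * of_int j * x))"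
    using cos by (cases "j \<ge> 0") (auto simp: k_def)
  show "trig_bounded N 1 (\<lambda>x. sin (2 * pi * of_int j * x))"
    using sin trig_bounded_scale[OF sin, of "-1"] by (cases "j \<ge> 0") (auto simp: k_def)
qed

lemma trig_bounded_const: "trig_bounded N \<bar>c\<bar> (\<lambda>x. c)"
  using trig_bounded_scale[OF trig_bounded_cos_sin(1)[of 0 N], of c] by simp

lemma trig_bounded_sum:
  assumes "finite I" "\<And>i. i \<in> I \<Longrightarrow> trig_bounded N (C i) (f i)"
  shows "trig_bounded N (\<Sum>i\<in>I. C i) (\<lambda>x. \<Sum>i\<in>I. f i x)"
  using assms
proof (induction I rule: finite_induct)
  case empty then show ?case using trig_bounded_const[of N 0] by simp
next
  case (insert i I) then show ?case using trig_bounded_add[of N "C i" "f i"] by simp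
qed

text \<open>A bound on a linear operation follows from its bound on the basis functions.\<close>
lemma trig_bounded_expand:
  assumes f: "trig_bounded N C f" and "0 \<le> B"
    and c: "\<And>k. k \<le> N \<Longrightarrow> trig_bounded M B (\<lambda>x. T (cos (2 * pi * real k * h x)) x)"
    and s: "\<And>k. k \<le> N \<Longrightarrow> trig_bounded M B (\<lambda>x. T (sin (2 * pi * real k * h x)) x)"
    and T: "\<And>y x. T y x = y * t x"
  shows "trig_bounded M (C * B) (\<lambda>x. T (f (h x)) x)"
proof -
  obtain a b where ab: "f = trig_poly N a b" "(\<Sum>k\<le>N. \<bar>a k\<bar> + \<bar>b k\<bar>) \<le> C"
    using f unfolding trig_bounded_def by auto
  have "trig_bounded M (\<Sum>k\<le>N. \<bar>a k\<bar> * B + \<bar>b k\<bar> * B)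
    (\<lambda>x. \<Sum>k\<le>N. a k * T (cos (2 * pi * real k * h x)) x + b k * T (sin (2 * pi * real k * h x)) x)"
    by (intro trig_bounded_sum trig_bounded_add trig_bounded_scale c s) auto
  also have "(\<lambda>x. \<Sum>k\<le>N. a k * T (cos (2 * pi * real k * h x)) x + b k * T (sin (2 * pi * real k * h x)) x)
      = (\<lambda>x. T (f (h x)) x)"
    by (simp add: fun_eq_iff T ab trig_poly_def sum_distrib_left sum_distrib_right algebra_simps)
  finally show ?thesis
    by (rule trig_bounded_weaken)
       (use mult_right_mono[OF ab(2) \<open>0 \<le> B\<close>] in \<open>simp add: sum_distrib_right distrib_right\<close>)
qed

lemma trig_bounded_degree_mono:
  assumes "trig_bounded N C f" "N \<le> M"
  shows "trig_bounded M C f"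
proof -
  have "trig_bounded M (C * 1) (\<lambda>x. f x * 1)"
    by (rule trig_bounded_expand[OF assms(1), where h = "\<lambda>x. x" and T = "\<lambda>y x. y * 1" and t = "\<lambda>x. 1"])
       (use trig_bounded_cos_sin[of "int k" M for k] assms(2) in auto)
  then show ?thesis by simp
qed

lemma trig_bounded_dilate:
  assumes "trig_bounded N C f"
  shows "trig_bounded (N * nat \<bar>q\<bar>) C (\<lambda>x. f (of_int q * x))"
proof -
  have *: "\<bar>int k * q\<bar> \<le> int (N * nat \<bar>q\<bar>)" if "k \<le> N" for k
    using that by (simp add: abs_mult mult_right_mono)
  have "trig_bounded (N * nat \<bar>q\<bar>) (C * 1) (\<lambda>x. f (of_int q * x) * 1)"
    by (rule trig_bounded_expand[OF assms(1), where h = "\<lambda>x. of_int q * x" and T = "\<lambda>y x. y * 1" and t = "\<lambda>x. 1"])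
       (use trig_bounded_cos_sin[OF *] in \<open>auto simp: mult.assoc\<close>)
  then show ?thesis by simp
qed

lemma trig_bounded_shift:
  assumes "trig_bounded N C f"
  shows "trig_bounded N (2 * C) (\<lambda>x. f (x - c))"
proof -
  have b: "trig_bounded N 1 (\<lambda>x. cos (2 * pi * real k * x))" "trig_bounded N 1 (\<lambda>x. sin (2 * pi * real k * x))"
    if "k \<le> N" for k using trig_bounded_cos_sin[of "int k" N] that by auto
  have lin: "trig_bounded N 2 (\<lambda>x. \<alpha> * cos (2 * pi * real k * x) + \<beta> * sin (2 * pi * real k * x))"
    if "k \<le> N" "\<bar>\<alpha>\<bar> \<le> 1" "\<bar>\<beta>\<bar> \<le> 1" for k \<alpha> \<beta>
    using trig_bounded_weaken[OF trig_bounded_add[OF trig_bounded_scale[OF b(1)[OF that(1)], of \<alpha>]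
        trig_bounded_scale[OF b(2)[OF that(1)], of \<beta>]], of 2] that by simp
  have "trig_bounded N (C * 2) (\<lambda>x. f (x - c) * 1)"
  proof (rule trig_bounded_expand[OF assms(1), where h = "\<lambda>x. x - c" and T = "\<lambda>y x. y * 1" and t = "\<lambda>x. 1"])
    fix k assume k: "k \<le> N"
    have "cos (2 * pi * real k * (x - c)) = cos (2 * pi * real k * c) * cos (2 * pi * real k * x) + sin (2 * pi * real k * c) * sin (2 * pi * real k * x)" for x
      unfolding right_diff_distrib cos_diff by simp
    then show "trig_bounded N 2 (\<lambda>x. cos (2 * pi * real k * (x - c)) * 1)" using lin[OF k] by simp
    have "sin (2 * pi * real k * (x - c)) = - sin (2 * pi * real k * c) * cos (2 * pi * real k * x) + cos (2 * pi * real k * c) * sin (2 * pi * real k * x)" for x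
      unfolding right_diff_distrib sin_diff by simp
    then show "trig_bounded N 2 (\<lambda>x. sin (2 * pi * real k * (x - c)) * 1)"
      using lin[OF k, of "- sin (2 * pi * real k * c)" "cos (2 * pi * real k * c)"] by simp
  qed auto
  then show ?thesis by (simp add: mult.commute)
qed

lemma trig_bounded_mult:
  assumes f: "trig_bounded N C f" and g: "trig_bounded M D g" and "0 \<le> D"
  shows "trig_bounded (N + M) (C * D) (\<lambda>x. f x * g x)"
proof -
  have half: "trig_bounded L 1 (\<lambda>x. (p x + \<sigma> * q x) / 2)"
    if "trig_bounded L 1 p" "trig_bounded L 1 q" "\<bar>\<sigma>\<bar> = 1" for L p q and \<sigma> :: real
    using trig_bounded_scale[OF trig_bounded_add[OF that(1) trig_bounded_scale[OF that(2), of \<sigma>]], of "1 / 2"] that(3)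
    by simp
  have B: "trig_bounded (N + M) 1 (\<lambda>x. cos (2 * pi * real l * x) * cos (2 * pi * real k * x))"
    "trig_bounded (N + M) 1 (\<lambda>x. sin (2 * pi * real l * x) * sin (2 * pi * real k * x))"
    "trig_bounded (N + M) 1 (\<lambda>x. cos (2 * pi * real l * x) * sin (2 * pi * real k * x))"
    "trig_bounded (N + M) 1 (\<lambda>x. sin (2 * pi * real l * x) * cos (2 * pi * real k * x))"
    if "k \<le> N" "l \<le> M" for k l
  proof -
    have j: "\<bar>int k - int l\<bar> \<le> int (N + M)" "\<bar>int k + int l\<bar> \<le> int (N + M)" using that by auto
    note c = trig_bounded_cos_sin[OF j(1)] trig_bounded_cos_sin[OF j(2)]
    have e: "2 * pi * of_int (int k - int l) * x = 2 * pi * real k * x - 2 * pi * real l * x"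
      "2 * pi * of_int (int k + int l) * x = 2 * pi * real k * x + 2 * pi * real l * x" for x
      by (simp_all add: algebra_simps)
    show "trig_bounded (N + M) 1 (\<lambda>x. cos (2 * pi * real l * x) * cos (2 * pi * real k * x))"
      using half[OF c(1) c(3), of 1] unfolding e cos_diff cos_add by (simp add: mult.commute)
    show "trig_bounded (N + M) 1 (\<lambda>x. sin (2 * pi * real l * x) * sin (2 * pi * real k * x))"
      using half[OF c(1) c(3), of "-1"] unfolding e cos_diff cos_add by (simp add: mult.commute)
    show "trig_bounded (N + M) 1 (\<lambda>x. cos (2 * pi * real l * x) * sin (2 * pi * real k * x))"
      using half[OF c(4) c(2), of 1] unfolding e sin_diff sin_add by (simp add: mult.commute)
    show "trig_bounded (N + M) 1 (\<lambda>x. sin (2 * pi * real l * x) * cos (2 * pi * real k * x))"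
      using half[OF c(4) c(2), of "-1"] unfolding e sin_diff sin_add by (simp add: mult.commute)
  qed
  have inner: "trig_bounded (N + M) (D * 1) (\<lambda>x. g x * t x)"
    if "\<And>l. l \<le> M \<Longrightarrow> trig_bounded (N + M) 1 (\<lambda>x. cos (2 * pi * real l * x) * t x)"
      "\<And>l. l \<le> M \<Longrightarrow> trig_bounded (N + M) 1 (\<lambda>x. sin (2 * pi * real l * x) * t x)" for t
    by (rule trig_bounded_expand[OF g, where h = "\<lambda>x. x" and T = "\<lambda>y x. y * t x" and t = t]) (use that in auto)
  show ?thesis
  proof (rule trig_bounded_expand[OF f \<open>0 \<le> D\<close>, where h = "\<lambda>x. x" and T = "\<lambda>y x. y * g x" and t = g])
    fix k assume k: "k \<le> N"
    show "trig_bounded (N + M) D (\<lambda>x. cos (2 * pi * real k * x) * g x)"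
      using inner[of "\<lambda>x. cos (2 * pi * real k * x)", OF B(1)[OF k] B(4)[OF k]] by (simp add: mult.commute)
    show "trig_bounded (N + M) D (\<lambda>x. sin (2 * pi * real k * x) * g x)"
      using inner[of "\<lambda>x. sin (2 * pi * real k * x)", OF B(3)[OF k] B(2)[OF k]] by (simp add: mult.commute)
  qed auto
qed

lemma trig_bounded_abs_le:
  assumes "trig_bounded N C f"
  shows "\<bar>f x\<bar> \<le> C"
proof -
  obtain a b where ab: "f = trig_poly N a b" "(\<Sum>k\<le>N. \<bar>a k\<bar> + \<bar>b k\<bar>) \<le> C"
    using assms unfolding trig_bounded_def by auto
  have "\<bar>f x\<bar> \<le> (\<Sum>k\<le>N. \<bar>a k\<bar> + \<bar>b k\<bar>)"
    unfolding ab trig_poly_def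
  proof (rule order_trans[OF sum_abs sum_mono])
    fix k
    have "\<bar>a k * cos y + b k * sin y\<bar> \<le> \<bar>a k\<bar> * \<bar>cos y\<bar> + \<bar>b k\<bar> * \<bar>sin y\<bar>" for y
      by (metis abs_mult abs_triangle_ineq)
    also have "\<bar>a k\<bar> * \<bar>cos y\<bar> + \<bar>b k\<bar> * \<bar>sin y\<bar> \<le> \<bar>a k\<bar> + \<bar>b k\<bar>" for y
      by (intro add_mono mult_left_le) auto
    finally show "\<bar>a k * cos (2 * pi * real k * x) + b k * sin (2 * pi * real k * x)\<bar> \<le> \<bar>a k\<bar> + \<bar>b k\<bar>" .
  qed
  then show ?thesis using ab(2) by simp
qed

lemma trig_poly_has_derivative:
  "(trig_poly N a b has_real_derivative
     trig_poly N (\<lambda>k. 2 * pi * real k * b k) (\<lambda>k. - (2 * pi * real k * a k)) x) (at x)"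
  unfolding trig_poly_def
  by (rule DERIV_sum[THEN DERIV_cong]) (auto intro!: derivative_eq_intros)

lemma trig_poly_periodic: "trig_poly N a b (x + 1) = trig_poly N a b x"
proof -
  have "2 * pi * real k * (x + 1) = 2 * pi * real k * x + 2 * pi * of_int (int k)" for k by (simp add: algebra_simps)
  then show ?thesis unfolding trig_poly_def by (simp add: cos_add sin_add del: of_int_of_nat_eq)
qed

lemma trig_bounded_deriv:
  assumes "trig_bounded N C f"
  shows "(f has_real_derivative deriv f x) (at x)" "trig_bounded N (2 * pi * real N * C) (deriv f)"
    "f (x + 1) = f x"
proof -
  obtain a b where ab: "f = trig_poly N a b" "(\<Sum>k\<le>N. \<bar>a k\<bar> + \<bar>b k\<bar>) \<le> C"
    using assms unfolding trig_bounded_def by auto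
  have f': "deriv f = trig_poly N (\<lambda>k. 2 * pi * real k * b k) (\<lambda>k. - (2 * pi * real k * a k))"
    unfolding ab by (intro ext DERIV_imp_deriv trig_poly_has_derivative)
  then show "(f has_real_derivative deriv f x) (at x)"
    using trig_poly_has_derivative ab by metis
  show "f (x + 1) = f x" by (simp add: ab trig_poly_periodic)
  have "(\<Sum>k\<le>N. \<bar>2 * pi * real k * b k\<bar> + \<bar>- (2 * pi * real k * a k)\<bar>) \<le> (\<Sum>k\<le>N. 2 * pi * real N * (\<bar>a k\<bar> + \<bar>b k\<bar>))"
  proof (rule sum_mono)
    fix k assume "k \<in> {..N}"
    then have "2 * pi * real k * (\<bar>a k\<bar> + \<bar>b k\<bar>) \<le> 2 * pi * real N * (\<bar>a k\<bar> + \<bar>b k\<bar>)"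
      by (intro mult_right_mono mult_left_mono) auto
    then show "\<bar>2 * pi * real k * b k\<bar> + \<bar>- (2 * pi * real k * a k)\<bar> \<le> 2 * pi * real N * (\<bar>a k\<bar> + \<bar>b k\<bar>)"
      by (simp add: abs_mult algebra_simps)
  qed
  also have "\<dots> \<le> 2 * pi * real N * C" unfolding sum_distrib_left[symmetric] using ab(2) by (intro mult_left_mono) auto
  finally show "trig_bounded N (2 * pi * real N * C) (deriv f)" unfolding f' trig_bounded_def by blast
qed

lemma trig_bounded_funpow_deriv:
  assumes "trig_bounded N C f"
  shows "trig_bounded N ((2 * pi * real N) ^ j * C) ((deriv ^^ j) f)"
proof (induction j)
  case (Suc j)
  then show ?case using trig_bounded_deriv(2)[OF Suc] by (simp add: mult.assoc)
qed (use assms in simp)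

lemma funpow_deriv_add_trig:
  assumes "trig_bounded N C f" "trig_bounded M D g"
  shows "(deriv ^^ j) (\<lambda>x. f x + g x) = (\<lambda>x. (deriv ^^ j) f x + (deriv ^^ j) g x)"
proof (induction j)
  case (Suc j)
  show ?case
    unfolding funpow.simps comp_def Suc
    by (intro ext DERIV_imp_deriv DERIV_add trig_bounded_deriv(1)[OF trig_bounded_funpow_deriv[OF assms(1)]]
        trig_bounded_deriv(1)[OF trig_bounded_funpow_deriv[OF assms(2)]])
qed simp

lemma Cr_norm_le:
  assumes "0 \<le> r" "\<And>j x. real j \<le> r \<Longrightarrow> \<bar>(deriv ^^ j) u x\<bar> \<le> B"
  shows "Cr_norm r u \<le> B"
  unfolding Cr_norm_def
  by (rule cSUP_least[OF _ cSUP_least]) (use assms in \<open>auto intro!: exI[of _ 0]\<close>)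

section \<open>The Fejer kernel as a localized bump\<close>

text \<open>The Fejer kernel divided by n, i.e. the squared modulus of the mean of n characters, so
  that the peak at the integers has height 1.\<close>

definition fejer :: "nat \<Rightarrow> real \<Rightarrow> real" where
  "fejer n x = ((\<Sum>k<n. cos (2 * pi * real k * x)) / real n)\<^sup>2 + ((\<Sum>k<n. sin (2 * pi * real k * x)) / real n)\<^sup>2"

lemma fejer_nonneg: "0 \<le> fejer n x" by (simp add: fejer_def)

lemma fejer_0: "n > 0 \<Longrightarrow> fejer n 0 = 1" by (simp add: fejer_def)

lemma trig_bounded_fejer:
  assumes "n > 0"
  shows "trig_bounded (2 * n) 2 (fejer n)"
proof -
  have 1: "trig_bounded n 1 (\<lambda>x. (\<Sum>k<n. cos (2 * pi * real k * x)) / real n)"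
    "trig_bounded n 1 (\<lambda>x. (\<Sum>k<n. sin (2 * pi * real k * x)) / real n)"
  proof -
    have "trig_bounded n 1 (\<lambda>x. cos (2 * pi * real k * x))" "trig_bounded n 1 (\<lambda>x. sin (2 * pi * real k * x))"
      if "k \<in> {..<n}" for k using trig_bounded_cos_sin[of "int k" n] that by auto
    then have s: "trig_bounded n (\<Sum>k<n. 1) (\<lambda>x. \<Sum>k<n. cos (2 * pi * real k * x))"
      "trig_bounded n (\<Sum>k<n. 1) (\<lambda>x. \<Sum>k<n. sin (2 * pi * real k * x))"
      by (intro trig_bounded_sum; simp)+
    show "trig_bounded n 1 (\<lambda>x. (\<Sum>k<n. cos (2 * pi * real k * x)) / real n)"
      using trig_bounded_scale[OF s(1), where c = "1 / real n"] assms by simp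
    show "trig_bounded n 1 (\<lambda>x. (\<Sum>k<n. sin (2 * pi * real k * x)) / real n)"
      using trig_bounded_scale[OF s(2), where c = "1 / real n"] assms by simp
  qed
  have "trig_bounded (n + n) (1 * 1 + 1 * 1) (fejer n)"
    unfolding fejer_def power2_eq_square by (intro trig_bounded_add trig_bounded_mult 1) auto
  then show ?thesis by (simp add: mult_2)
qed

text \<open>Geometric series: the sum of characters times 1 - z equals 1 - z^n, of modulus at most
  2, while the squared modulus of 1 - z is \<open>4 * (sin (pi * x))\<^sup>2\<close>.\<close>

lemma fejer_decay:
  assumes "n > 0"
  shows "fejer n x * (sin (pi * x))\<^sup>2 \<le> 1 / (real n)\<^sup>2"
proof -
  define z where "z = cis (2 * pi * x)"
  define Z where "Z = (\<Sum>k<n. z ^ k)"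
  have zk: "z ^ k = cis (2 * pi * real k * x)" for k unfolding z_def Complex.DeMoivre by (simp add: ac_simps)
  have "(norm Z)\<^sup>2 = (\<Sum>k<n. cos (2 * pi * real k * x))\<^sup>2 + (\<Sum>k<n. sin (2 * pi * real k * x))\<^sup>2"
    by (simp add: cmod_power2 Z_def Re_sum Im_sum zk)
  then have Z: "fejer n x = (norm Z)\<^sup>2 / (real n)\<^sup>2"
    by (simp add: fejer_def power_divide add_divide_distrib)
  have "(1 - z) * Z = 1 - z ^ n" unfolding Z_def by (rule one_diff_power_eq[symmetric])
  then have "norm (1 - z) * norm Z = norm (1 - z ^ n)" by (metis norm_mult)
  also have "\<dots> \<le> 2" using norm_triangle_ineq4[of 1 "z ^ n"] by (simp add: zk)
  finally have "(norm (1 - z) * norm Z)\<^sup>2 \<le> 2\<^sup>2" by (intro power_mono) auto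
  moreover have "(norm (1 - z))\<^sup>2 = 4 * (sin (pi * x))\<^sup>2"
  proof -
    have "cos (2 * (pi * x)) = 1 - 2 * (sin (pi * x))\<^sup>2" by (rule cos_double_sin)
    moreover have "(norm (1 - z))\<^sup>2 = 2 - 2 * cos (2 * (pi * x))"
      using sin_cos_squared_add[of "2 * (pi * x)"]
      by (simp add: cmod_power2 z_def power2_diff mult.assoc)
    ultimately show ?thesis by simp
  qed
  ultimately have "(norm Z)\<^sup>2 * (sin (pi * x))\<^sup>2 \<le> 1" by (simp add: power_mult_distrib mult.commute)
  then show ?thesis using divide_right_mono[of _ 1 "(real n)\<^sup>2"] by (simp add: Z)
qed

section \<open>Minimizing orbits\<close>

lemma invariant_graphD:
  assumes "invariant_graph S' \<rho> g"
  shows "isCont g x" "g x < g y \<longleftrightarrow> x < y" "g x \<le> g y \<longleftrightarrow> x \<le> y" "\<exists>z. y = g z" "g (x + 1) = g x + 1"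
    "g (g x) + x = 2 * g x + S' (g x)" "(\<lambda>n. (g ^^ n) x / real n) \<longlonglongrightarrow> \<rho>"
    "(g ^^ n) x < (g ^^ n) y \<longleftrightarrow> x < y" "(g ^^ n) x \<le> (g ^^ n) y \<longleftrightarrow> x \<le> y"
proof -
  have m: "strict_mono g" using assms by (simp add: invariant_graph_def)
  then have mn: "strict_mono (g ^^ n)" by (induction n) (auto simp: strict_mono_def)
  show "g x < g y \<longleftrightarrow> x < y" "g x \<le> g y \<longleftrightarrow> x \<le> y"
    "(g ^^ n) x < (g ^^ n) y \<longleftrightarrow> x < y" "(g ^^ n) x \<le> (g ^^ n) y \<longleftrightarrow> x \<le> y"
    using m mn by (auto simp: strict_mono_less strict_mono_less_eq)
  show "\<exists>z. y = g z" using assms unfolding invariant_graph_def surj_def by blast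
qed (use assms in \<open>auto simp: invariant_graph_def continuous_on_eq_continuous_at\<close>)

text \<open>If w is a primitive of g - id, the function (a - b)^2 / 2 + S b + w a - w b is minimal,
  and constant, exactly on the graph b = g a.\<close>
lemma invariant_graph_minimizing:
  fixes S S' :: "real \<Rightarrow> real" and y :: "nat \<Rightarrow> real"
  assumes ig: "invariant_graph S' \<rho> g" and S: "\<And>x. (S has_real_derivative S' x) (at x)"
    and y: "y 0 = x" "y k = (g ^^ k) x"
  shows "(\<Sum>i<k. ((g ^^ i) x - (g ^^ Suc i) x)\<^sup>2 / 2 + S ((g ^^ Suc i) x))
    \<le> (\<Sum>i<k. (y i - y (Suc i))\<^sup>2 / 2 + S (y (Suc i)))"
proof -
  note g = invariant_graphD[OF ig]
  have "isCont (\<lambda>x. g x - x) x" for x using g(1) by (intro continuous_intros)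
  then obtain w where "\<And>x. (w has_vector_derivative (g x - x)) (at x)"
    using einterval_antiderivative[of "-\<infinity>" "\<infinity>" "\<lambda>x. g x - x"] by auto
  then have w: "(w has_real_derivative (g x - x)) (at x)" for x
    by (simp add: has_real_derivative_iff_has_vector_derivative)
  define \<Phi> where "\<Phi> a b = (a - b)\<^sup>2 / 2 + S b + w a - w b" for a b
  have da: "((\<lambda>a. \<Phi> a b) has_real_derivative (g a - b)) (at a)" for a b
    unfolding \<Phi>_def by (auto intro!: derivative_eq_intros w simp: diff_divide_distrib)
  have db: "((\<lambda>b. \<Phi> a b) has_real_derivative (c - a)) (at (g c))" for a c
    unfolding \<Phi>_def using g(6)[of c] by (auto intro!: derivative_eq_intros w S simp: diff_divide_distrib)
  have min_a: "\<Phi> c (g c) \<le> \<Phi> a (g c)" for a c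
  proof (cases "a \<le> c")
    case True
    have "\<exists>y. ((\<lambda>a. \<Phi> a (g c)) has_real_derivative y) (at t) \<and> y \<le> 0" if "t \<le> c" for t
      using da[of "g c" t] that g(3)[of t c] by (intro exI[of _ "g t - g c"]) auto
    then show ?thesis by (intro DERIV_nonpos_imp_nonincreasing[OF True]) auto
  next
    case False
    have D: "\<exists>y. ((\<lambda>a. \<Phi> a (g c)) has_real_derivative y) (at t) \<and> 0 \<le> y" if "c \<le> t" for t
      using da[of "g c" t] that g(3)[of c t] by (intro exI[of _ "g t - g c"]) auto
    from False have "c \<le> a" by simp
    then show ?thesis by (rule DERIV_nonneg_imp_nondecreasing) (rule D)
  qed
  have min_b: "\<Phi> a (g a) \<le> \<Phi> a b" for a b
  proof (cases "g a \<le> b")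
    case True
    have "\<exists>y. ((\<lambda>b. \<Phi> a b) has_real_derivative y) (at t) \<and> 0 \<le> y" if "g a \<le> t" for t
    proof -
      obtain c where c: "t = g c" using g(4) by blast
      then show ?thesis using db[of a c] that g(3)[of a c] by (intro exI[of _ "c - a"]) auto
    qed
    then show ?thesis by (intro DERIV_nonneg_imp_nondecreasing[OF True]) auto
  next
    case False
    have "\<exists>y. ((\<lambda>b. \<Phi> a b) has_real_derivative y) (at t) \<and> y \<le> 0" if "t \<le> g a" for t
    proof -
      obtain c where c: "t = g c" using g(4) by blast
      then show ?thesis using db[of a c] that g(3)[of c a] by (intro exI[of _ "c - a"]) auto
    qed
    moreover from False have "b \<le> g a" by simp
    ultimately show ?thesis by (intro DERIV_nonpos_imp_nonincreasing[of b "g a"]) auto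
  qed
  have up: "\<Phi> a (g c') - \<Phi> a (g c) \<le> (c' - a) * (g c' - g c)" if "c \<le> c'" for a c c'
  proof -
    have le: "g c \<le> g c'" using that g(3) by simp
    have "\<exists>y. ((\<lambda>b. \<Phi> a b - (c' - a) * b) has_real_derivative y) (at t) \<and> y \<le> 0" if "t \<le> g c'" for t
    proof -
      obtain d where d: "t = g d" using g(4) by blast
      then show ?thesis using that g(3)[of d c']
        by (intro exI[of _ "(d - a) - (c' - a)"]) (auto intro!: derivative_eq_intros db)
    qed
    then have "\<Phi> a (g c') - (c' - a) * g c' \<le> \<Phi> a (g c) - (c' - a) * g c"
      by (intro DERIV_nonpos_imp_nonincreasing[OF le]) auto
    then show ?thesis by (simp add: algebra_simps)
  qed
  have low: "\<Phi> a (g c') - \<Phi> a (g c) \<ge> (c - a) * (g c' - g c)" if "c \<le> c'" for a c c'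
  proof -
    have le: "g c \<le> g c'" using that g(3) by simp
    have "\<exists>y. ((\<lambda>b. \<Phi> a b - (c - a) * b) has_real_derivative y) (at t) \<and> 0 \<le> y" if "g c \<le> t" for t
    proof -
      obtain d where d: "t = g d" using g(4) by blast
      then show ?thesis using that g(3)[of c d]
        by (intro exI[of _ "(d - a) - (c - a)"]) (auto intro!: derivative_eq_intros db)
    qed
    then have "\<Phi> a (g c) - (c - a) * g c \<le> \<Phi> a (g c') - (c - a) * g c'"
      by (intro DERIV_nonneg_imp_nondecreasing[OF le]) auto
    then show ?thesis by (simp add: algebra_simps)
  qed
  \<comment> \<open>That \<open>\<Phi> a (g a)\<close> is constant cannot be obtained by
    differentiating, as \<open>g\<close> is only a homeomorphism. The quadratic bounds from
    \<open>low\<close> and \<open>up\<close>, combined with minimality in the first variable, give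
    monotonicity in both senses.\<close>
  have gm: "mono g" using g(3) by (auto intro: monoI)
  have le1: "\<Phi> a (g a) \<le> \<Phi> b (g b)" if "a \<le> b" for a b
  proof (rule mono_if_quadratic_lower_bound[OF gm _ that, where \<phi> = "\<lambda>a. \<Phi> a (g a)"])
    show "- (y - x) * (g y - g x) \<le> \<Phi> y (g y) - \<Phi> x (g x)" if "x \<le> y" for x y
      using low[OF that, of y] min_a[of x y] by (simp add: algebra_simps)
  qed
  have le2: "\<Phi> b (g b) \<le> \<Phi> a (g a)" if "a \<le> b" for a b
  proof -
    have "- \<Phi> a (g a) \<le> - \<Phi> b (g b)"
    proof (rule mono_if_quadratic_lower_bound[OF gm _ that, where \<phi> = "\<lambda>a. - \<Phi> a (g a)"])
      show "- (y - x) * (g y - g x) \<le> - \<Phi> y (g y) - - \<Phi> x (g x)" if "x \<le> y" for x y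
        using up[OF that, of x] min_a[of y x] by (simp add: algebra_simps)
    qed
    then show ?thesis by simp
  qed
  have const: "\<Phi> a (g a) = \<Phi> x (g x)" for a
    using le1[of a x] le1[of x a] le2[of a x] le2[of x a] by (cases "a \<le> x") auto
  have h: "(a - b)\<^sup>2 / 2 + S b = \<Phi> a b + (w b - w a)" for a b by (simp add: \<Phi>_def)
  have "(\<Sum>i<k. ((g ^^ i) x - (g ^^ Suc i) x)\<^sup>2 / 2 + S ((g ^^ Suc i) x)) =
      real k * \<Phi> x (g x) + (w ((g ^^ k) x) - w x)"
  proof -
    have "\<Phi> ((g ^^ i) x) ((g ^^ Suc i) x) = \<Phi> x (g x)" for i using const[of "(g ^^ i) x"] by simp
    then show ?thesis unfolding h sum.distrib using sum_lessThan_telescope[of "\<lambda>i. w ((g ^^ i) x)" k]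
      by (simp only:) simp
  qed
  also have "\<dots> \<le> (\<Sum>i<k. \<Phi> (y i) (y (Suc i))) + (w (y k) - w (y 0))"
  proof -
    have "\<Phi> x (g x) \<le> \<Phi> a b" for a b using min_b[of a b] const[of a] by simp
    then have "(\<Sum>i<k. \<Phi> x (g x)) \<le> (\<Sum>i<k. \<Phi> (y i) (y (Suc i)))" by (intro sum_mono)
    then show ?thesis using y by simp
  qed
  also have "\<dots> = (\<Sum>i<k. (y i - y (Suc i))\<^sup>2 / 2 + S (y (Suc i)))"
    unfolding h sum.distrib using sum_lessThan_telescope[of "\<lambda>i. w (y i)" k] by simp
  finally show ?thesis .
qed

section \<open>Displacement of orbits by periods of the force\<close>

lemma invariant_graph_rotation_uniform:
  assumes "invariant_graph S' \<rho> g"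
  shows "\<bar>(g ^^ n) x - x - (g ^^ n) 0\<bar> \<le> 1"
proof -
  note g = invariant_graphD[OF assms]
  have n1: "(g ^^ n) (t + 1) = (g ^^ n) t + 1" for t by (induction n) (simp_all add: g(5))
  have "\<bar>(g ^^ n) t - (g ^^ n) 0 - t\<bar> \<le> 1" if "t \<in> {0..1}" for t
    using g(9)[of n 0 t] g(9)[of n t 1] n1[of 0] that by auto
  then show ?thesis
    using unit_shift_displacement_bound[of "\<lambda>t. (g ^^ n) t - (g ^^ n) 0" 1 x] n1
    by (simp add: algebra_simps)
qed

text \<open>The orbit equation is symmetric in the next and the previous abscissa, so time can be
  reversed. The rotation number changes sign because the displacements of \<open>g ^^ n\<close> from
  different points agree up to 1.\<close>

lemma invariant_graph_inv:
  assumes ig: "invariant_graph S' \<rho> g"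
  shows "invariant_graph S' (- \<rho>) (inv g)"
proof -
  note g = invariant_graphD[OF ig]
  have inj: "inj g" by (rule injI) (metis g(3) order_antisym order_refl)
  have surj: "surj g" using g(4) by (metis surjI surj_def)
  have gh: "g (inv g y) = y" "inv g (g y) = y" for y
    using surj inj by (simp_all add: surj_f_inv_f)
  have mono: "strict_mono (inv g)"
    by (rule strict_monoI) (metis g(2) gh(1))
  have hn: "(inv g ^^ n) ((g ^^ n) y) = y" "(g ^^ n) ((inv g ^^ n) y) = y" for n y
    by (induction n arbitrary: y) (simp_all add: gh funpow_swap1)
  show ?thesis
    unfolding invariant_graph_def
  proof (intro conjI allI)
    show "continuous_on UNIV (inv g)"
    proof -
      have "isCont (inv g) y" for y
        using isCont_inverse_function[of 1 "inv g y" "inv g" g] gh g(1) by simp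
      then show ?thesis by (simp add: continuous_on_eq_continuous_at)
    qed
    show "inv g (x + 1) = inv g x + 1" for x
      using g(5)[of "inv g x"] gh by metis
    show "inv g (inv g x) + x = 2 * inv g x + S' (inv g x)" for x
      using g(6)[of "inv g (inv g x)"] by (simp add: gh)
    show "(\<lambda>n. (inv g ^^ n) x / real n) \<longlonglongrightarrow> - \<rho>" for x
    proof -
      have "\<bar>(inv g ^^ n) x + (g ^^ n) 0\<bar> \<le> 1 + \<bar>x\<bar>" for n
        using invariant_graph_rotation_uniform[OF ig, of n "(inv g ^^ n) x"] by (simp add: hn)
      then have "\<bar>(inv g ^^ n) x / real n + (g ^^ n) 0 / real n\<bar> \<le> (1 + \<bar>x\<bar>) / real n" for n
        by (simp add: add_divide_distrib[symmetric] divide_right_mono)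
      then have "(\<lambda>n. (inv g ^^ n) x / real n + (g ^^ n) 0 / real n) \<longlonglongrightarrow> 0"
        by (intro Lim_null_comparison[OF always_eventually lim_const_over_n]) auto
      from tendsto_diff[OF this g(7)[of 0]] show ?thesis by simp
    qed
  qed (use mono inj surj in \<open>auto simp: inj_imp_surj_inv\<close>)
qed

text \<open>For t a multiple of 1/q the map \<open>g\<close> need not commute with the translation.
  But the successor of y is 2 y + S' y minus its predecessor: when a step of the translated orbit
  lies below the graph, its starting point is to the right of the predecessor on the graph, which in
  turn puts the next step below the graph.\<close>

lemma orbit_of_translate_le:
  assumes ig: "invariant_graph S' \<rho> g" and per: "\<And>x. S' (x + t) = S' x"
    and z: "g z + t \<le> g (z + t)"
  shows "(g ^^ n) z + t \<le> (g ^^ n) (z + t)"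
proof -
  note g = invariant_graphD[OF ig]
  have below: "(g ^^ Suc n) z + t \<le> g ((g ^^ n) z + t)" for n
  proof (induction n)
    case (Suc n)
    obtain w where w: "(g ^^ Suc n) z + t = g w" using g(4) by blast
    then have "w \<le> (g ^^ n) z + t" using Suc g(3) by simp
    then show ?case
      using g(6)[of "(g ^^ n) z"] g(6)[of w] per[of "(g ^^ Suc n) z"] w by simp
  qed (use z in simp)
  show ?thesis
  proof (induction n)
    case (Suc n)
    then have "g ((g ^^ n) z + t) \<le> g ((g ^^ n) (z + t))" using g(3) by simp
    then show ?case using below[of n] by simp
  qed simp
qed

lemma growth_rate_ge:
  fixes x :: "nat \<Rightarrow> real"
  assumes lim: "(\<lambda>n. x n / real n) \<longlonglongrightarrow> \<rho>" and "k > 0" and x: "\<And>n. x n + t \<le> x (n + k)"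
  shows "t \<le> real k * \<rho>"
proof -
  have iter: "x 0 + real m * t \<le> x (m * k)" for m
  proof (induction m)
    case (Suc m)
    then show ?case using x[of "m * k"] by (simp add: algebra_simps)
  qed simp
  have lim1: "(\<lambda>m. x (m * k) / real (m * k) * real k) \<longlonglongrightarrow> \<rho> * real k"
  proof -
    have "filterlim (\<lambda>m. m * k) sequentially sequentially"
      by (rule filterlim_subseq) (use \<open>k > 0\<close> in \<open>auto simp: strict_mono_def\<close>)
    from tendsto_mult[OF filterlim_compose[OF lim this] tendsto_const]
    show ?thesis .
  qed
  have lim2: "(\<lambda>m. x 0 / real m + t) \<longlonglongrightarrow> 0 + t"
    by (intro tendsto_intros lim_const_over_n)
  have "x 0 / real m + t \<le> x (m * k) / real (m * k) * real k" if "m \<ge> 1" for m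
  proof -
    have "x 0 / real m + t = (x 0 + real m * t) / real m" using that by (simp add: add_divide_distrib)
    also have "\<dots> \<le> x (m * k) / real m" by (intro divide_right_mono iter) simp
    finally show ?thesis using \<open>k > 0\<close> by simp
  qed
  then have "0 + t \<le> \<rho> * real k" by (intro LIMSEQ_le[OF lim2 lim1]) blast
  then show ?thesis by (simp add: mult.commute)
qed

text \<open>The translate by t of an orbit of g is again an orbit of the twist map, though possibly on
  another curve; it stays on one side of the graph of g, either in the future or in the past.\<close>
lemma invariant_graph_displacement_less:
  assumes ig: "invariant_graph S' \<rho> g" and per: "\<And>x. S' (x + t) = S' x" and k: "real k * \<rho> < t"
  shows "(g ^^ k) z < z + t"
proof (rule ccontr)
  note g = invariant_graphD[OF ig]
  assume "\<not> ?thesis"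
  then have ge: "z + t \<le> (g ^^ k) z" by simp
  then have "k > 0" using k by (cases "k = 0") auto
  show False
  proof (cases "g z + t \<le> g (z + t)")
    case True
    have "(g ^^ n) z + t \<le> (g ^^ (n + k)) z" for n
    proof -
      have "(g ^^ n) (z + t) \<le> (g ^^ n) ((g ^^ k) z)" using ge g(9) by simp
      then show ?thesis using orbit_of_translate_le[OF ig per True, of n] by (simp add: funpow_add)
    qed
    from growth_rate_ge[OF g(7) \<open>k > 0\<close> this] k show False by simp
  next
    case False
    \<comment> \<open>If the first step of the translate lies above the graph, the equation at
      \<open>z + t\<close> puts the step before it on the side needed for \<open>inv g\<close>, and
      the growth estimate runs into the past.\<close>
    define h where "h = inv g"
    have igh: "invariant_graph S' (- \<rho>) h" unfolding h_def by (rule invariant_graph_inv[OF ig])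
    note h = invariant_graphD[OF igh]
    have "inj g" by (rule injI) (metis g(3) order_antisym order_refl)
    then have hg: "h (g y) = y" for y by (simp add: h_def)
    then have gh: "g (h y) = y" for y using g(4) by metis
    have hn: "(h ^^ n) ((g ^^ n) y) = y" for n y
      by (induction n arbitrary: y) (simp_all add: hg funpow_swap1)
    have "h z + t \<le> h (z + t)"
      using False g(6)[of "h z"] g(6)[of "h (z + t)"] per[of z] by (simp add: gh)
    then have *: "(h ^^ n) z + t \<le> (h ^^ n) (z + t)" for n by (rule orbit_of_translate_le[OF igh per])
    have past: "- (h ^^ n) ((g ^^ k) z) + t \<le> - (h ^^ (n + k)) ((g ^^ k) z)" for n
    proof -
      have "(h ^^ n) (z + t) \<le> (h ^^ n) ((g ^^ k) z)" using ge h(9) by simp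
      then show ?thesis using *[of n] by (simp add: funpow_add hn)
    qed
    have "(\<lambda>n. - (h ^^ n) ((g ^^ k) z) / real n) \<longlonglongrightarrow> \<rho>"
      using tendsto_minus[OF h(7)[of "(g ^^ k) z"]] by simp
    from growth_rate_ge[OF this \<open>k > 0\<close> past] k show False by simp
  qed
qed

lemma invariant_graph_displacement_greater:
  assumes ig: "invariant_graph S' \<rho> g" and per: "\<And>x. S' (x + t) = S' x" and k: "t < real k * \<rho>"
  shows "z + t < (g ^^ k) z"
proof -
  note g = invariant_graphD[OF ig]
  have "inj g" by (rule injI) (metis g(3) order_antisym order_refl)
  then have hn: "(inv g ^^ n) ((g ^^ n) y) = y" for n y
    by (induction n arbitrary: y) (simp_all add: funpow_swap1)
  have "S' (x + - t) = S' x" for x using per[of "x - t"] by simp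
  from invariant_graph_displacement_less[OF invariant_graph_inv[OF ig] this, of k "(g ^^ k) z"] k
  show ?thesis by (simp add: hn)
qed

section \<open>Slow minimizing orbits stay exponentially close to integers\<close>

text \<open>Discrete maximum principle: \<open>b\<close> is a supersolution that dominates
  \<open>\<bar>e\<bar>\<close> at both ends, and a positive interior maximum of
  \<open>\<bar>e\<bar> - b\<close> would contradict \<open>conv\<close>.\<close>

lemma discrete_decay:
  fixes e :: "nat \<Rightarrow> real"
  assumes "s > 0" and bd: "\<And>i. i \<le> 2 * M \<Longrightarrow> \<bar>e i\<bar> \<le> 1 / 4"
    and conv: "\<And>i. Suc i < 2 * M \<Longrightarrow> (2 + s\<^sup>2) * \<bar>e (Suc i)\<bar> \<le> \<bar>e (Suc (Suc i))\<bar> + \<bar>e i\<bar>"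
  shows "\<bar>e M\<bar> \<le> 1 / 2 / (1 + s) ^ M"
proof -
  define v where "v = 1 / (1 + s)"
  have v: "v > 0" "v \<le> 1" using \<open>s > 0\<close> by (auto simp: v_def)
  \<comment> \<open>The value 1 / (1 + s) lies between the roots of v^2 - (2 + s^2) v + 1, so its
    powers counted from either end are supersolutions.\<close>
  have v2: "v\<^sup>2 + 1 \<le> (2 + s\<^sup>2) * v"
  proof -
    have "(2 + s\<^sup>2) * (1 + s) - 1 - (1 + s)\<^sup>2 = s\<^sup>2 * s" by (simp add: power2_eq_square algebra_simps)
    then have "1 + (1 + s)\<^sup>2 \<le> (2 + s\<^sup>2) * (1 + s)" using \<open>s > 0\<close> by (smt (verit) mult_nonneg_nonneg zero_le_power2)
    then have "(1 + (1 + s)\<^sup>2) / (1 + s)\<^sup>2 \<le> (2 + s\<^sup>2) * (1 + s) / (1 + s)\<^sup>2"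
      by (intro divide_right_mono) auto
    moreover have "(1 + (1 + s)\<^sup>2) / (1 + s)\<^sup>2 = v\<^sup>2 + 1"
      using \<open>s > 0\<close> by (simp add: v_def power_divide add_divide_distrib)
    moreover have "(2 + s\<^sup>2) * (1 + s) / (1 + s)\<^sup>2 = (2 + s\<^sup>2) * v"
      using \<open>s > 0\<close> by (simp add: v_def power2_eq_square)
    ultimately show ?thesis by simp
  qed
  define b where "b i = 1 / 4 * (v ^ i + v ^ (2 * M - i))" for i
  have b: "b (Suc (Suc i)) + b i \<le> (2 + s\<^sup>2) * b (Suc i)" if "Suc i < 2 * M" for i
  proof -
    obtain j where j: "2 * M = Suc (Suc (i + j))" using le_Suc_ex[of "Suc (Suc i)" "2 * M"] \<open>Suc i < 2 * M\<close> by auto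
    have "v ^ Suc (Suc i) + v ^ i \<le> (2 + s\<^sup>2) * v ^ Suc i"
      using mult_right_mono[OF v2, of "v ^ i"] v by (simp add: power2_eq_square algebra_simps)
    moreover have "v ^ j + v ^ Suc (Suc j) \<le> (2 + s\<^sup>2) * v ^ Suc j"
      using mult_right_mono[OF v2, of "v ^ j"] v by (simp add: power2_eq_square algebra_simps)
    moreover have "2 * M - i = Suc (Suc j)" "2 * M - Suc i = Suc j" "2 * M - Suc (Suc i) = j"
      using j by auto
    moreover have "(2 + s\<^sup>2) * (1 / 4 * (v ^ Suc i + v ^ Suc j))
        = 1 / 4 * ((2 + s\<^sup>2) * v ^ Suc i) + 1 / 4 * ((2 + s\<^sup>2) * v ^ Suc j)"
      by (simp only: distrib_left mult.left_commute)
    ultimately show ?thesis unfolding b_def by (simp only:) argo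
  qed
  define d where "d i = \<bar>e i\<bar> - b i" for i
  obtain i0 where i0: "i0 \<le> 2 * M" "\<And>i. i \<le> 2 * M \<Longrightarrow> d i \<le> d i0"
  proof -
    have "finite (d ` {..2 * M})" "d ` {..2 * M} \<noteq> {}" by auto
    then have "Max (d ` {..2 * M}) \<in> d ` {..2 * M}" by (rule Max_in)
    then obtain i0 where "Max (d ` {..2 * M}) = d i0" "i0 \<in> {..2 * M}" by (rule imageE)
    moreover have "d i \<le> Max (d ` {..2 * M})" if "i \<le> 2 * M" for i using that by (intro Max_ge) auto
    ultimately show ?thesis by (intro that[of i0]) auto
  qed
  have "d i0 \<le> 0"
  proof (rule ccontr)
    assume pos: "\<not> ?thesis"
    have "b 0 \<ge> 1 / 4" "b (2 * M) \<ge> 1 / 4" using v by (auto simp: b_def)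
    then have "d 0 \<le> 0" "d (2 * M) \<le> 0" using bd[of 0] bd[of "2 * M"] unfolding d_def by linarith+
    then have "i0 \<noteq> 0" "i0 \<noteq> 2 * M" using pos by metis+
    then obtain i where i: "i0 = Suc i" "Suc i < 2 * M" using i0(1) by (cases i0) auto
    have "(2 + s\<^sup>2) * d i0 \<le> d (Suc (Suc i)) + d i"
      using conv[OF i(2)] b[OF i(2)] by (simp add: d_def i algebra_simps)
    also have "\<dots> \<le> 2 * d i0" using i0(2)[of "Suc (Suc i)"] i0(2)[of i] i by simp
    finally have "s\<^sup>2 * d i0 \<le> 0" by (simp add: algebra_simps)
    then show False using pos \<open>s > 0\<close> by (simp add: mult_le_0_iff)
  qed
  then have "\<bar>e M\<bar> \<le> b M" using i0(2)[of M] by (simp add: d_def)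
  also have "b M = 1 / 2 / (1 + s) ^ M" by (simp add: b_def v_def power_one_over)
  finally show ?thesis .
qed

text \<open>Competitors have prescribed ends and are otherwise arbitrary sequences; those used later
  are neither orbits nor monotone.\<close>

definition minimizing_orbit :: "(real \<Rightarrow> real) \<Rightarrow> (real \<Rightarrow> real) \<Rightarrow> (nat \<Rightarrow> real) \<Rightarrow> bool" where
  "minimizing_orbit S S' x \<longleftrightarrow>
     (\<forall>i. x i \<le> x (Suc i)) \<and> (\<forall>i. x (Suc (Suc i)) + x i = 2 * x (Suc i) + S' (x (Suc i))) \<and>
     (\<forall>i k y. y 0 = x i \<longrightarrow> y k = x (i + k) \<longrightarrow>
        (\<Sum>l<k. (x (i + l) - x (i + Suc l))\<^sup>2 / 2 + S (x (i + Suc l)))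
          \<le> (\<Sum>l<k. (y l - y (Suc l))\<^sup>2 / 2 + S (y (Suc l))))"

lemma unit_periodic_int:
  fixes f :: "real \<Rightarrow> 'a"
  assumes per: "\<And>x. f (x + 1) = f x"
  shows "f (x + of_int j) = f x"
proof -
  have n: "f (x + real n) = f x" for n x
  proof (induction n)
    case (Suc n)
    have "f (x + real (Suc n)) = f ((x + real n) + 1)" by (simp add: ac_simps)
    then show ?case using Suc per by simp
  qed simp
  show ?thesis
  proof (cases "j \<ge> 0")
    case True then show ?thesis using n[of x "nat j"] by simp
  next
    case False then show ?thesis using n[of "x + of_int j" "nat (- j)"] by simp
  qed
qed

text \<open>Magnifying by q and following the frame moving with velocity p turns orbits of the map
  generated by R into orbits of the map generated by S, with rotation number q\<omega> - p.\<close>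
lemma minimizing_orbit_rescaled:
  fixes q p :: int and S S' :: "real \<Rightarrow> real"
  defines "R \<equiv> \<lambda>x. S (of_int q * x) / (of_int q)\<^sup>2" and "R' \<equiv> \<lambda>x. S' (of_int q * x) / of_int q"
  assumes ig: "invariant_graph R' \<omega> g" and q: "q \<noteq> 0" and pos: "0 < of_int q * \<omega> - of_int p"
    and S: "\<And>x. (S has_real_derivative S' x) (at x)" and per: "\<And>x. S (x + 1) = S x" "\<And>x. S' (x + 1) = S' x"
  shows "\<exists>X. minimizing_orbit S S' X \<and> X n = c \<and>
    (\<forall>i k. real k * (of_int q * \<omega> - of_int p) < 1 \<longrightarrow> X (i + k) < X i + 1)"
proof -
  note g = invariant_graphD[OF ig]
  define Q where "Q = real_of_int q"
  define P where "P = real_of_int p"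
  have Q0: "Q \<noteq> 0" using q by (simp add: Q_def)
  have SP: "S (x + of_int j) = S x" "S' (x + of_int j) = S' x" for x j
    using unit_periodic_int[of S, OF per(1)] unit_periodic_int[of S', OF per(2)] by auto
  have S'P: "S' (x - real i * P) = S' x" "S (x - real i * P) = S x" for x i
    using SP(2)[of x "- (int i * p)"] SP(1)[of x "- (int i * p)"] by (simp_all add: P_def)
  have R'per: "R' (x + of_int j / Q) = R' x" for x j
    using SP(2)[of "Q * x" j] Q0 by (simp add: R'_def Q_def[symmetric] distrib_left)
  have Rd: "(R has_real_derivative R' x) (at x)" for x
  proof -
    have "((\<lambda>x. S (Q * x)) has_real_derivative S' (Q * x) * Q) (at x)"
      by (rule DERIV_chain'[OF _ S]) (auto intro!: derivative_eq_intros)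
    from DERIV_cdivide[OF this, of "Q\<^sup>2"] show ?thesis
      using Q0 by (simp add: R_def R'_def Q_def[symmetric] power2_eq_square)
  qed
  have "\<exists>z. t = (g ^^ n) z" for t n
  proof (induction n arbitrary: t)
    case (Suc n)
    obtain s where "t = g s" using g(4) by blast
    moreover obtain z where "s = (g ^^ n) z" using Suc by blast
    ultimately show ?case by auto
  qed simp
  \<comment> \<open>As \<open>g\<close> is onto, some orbit is exactly at c at time n, wherever c
    is; this is what allows the bump to be aimed freely.\<close>
  then obtain x where x: "(c + real n * P) / Q = (g ^^ n) x" by blast
  define X where "X i = Q * (g ^^ i) x - real i * P" for i
  have Xg: "(g ^^ i) x = (X i + real i * P) / Q" for i using Q0 by (simp add: X_def)
  have disp: "X (i + k) < X i + 1" if "real k * (of_int q * \<omega> - of_int p) < 1" for i k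
  proof -
    have k: "real k * \<omega> * Q < real k * P + 1" using that by (simp add: Q_def P_def algebra_simps)
    \<comment> \<open>An advance by 1 in the moving frame is a displacement by (k p + 1) / q, a
      period of \<open>R'\<close>. For negative q the inequality reverses, so both displacement
      bounds occur.\<close>
    have eq: "real k * P + 1 = of_int (int k * p + 1)" by (simp add: P_def)
    have "Q * (g ^^ k) ((g ^^ i) x) < Q * (g ^^ i) x + (real k * P + 1)"
    proof (cases "Q > 0")
      case True
      then have "real k * \<omega> < (real k * P + 1) / Q" using k by (simp add: pos_less_divide_eq)
      then have "(g ^^ k) ((g ^^ i) x) < (g ^^ i) x + (real k * P + 1) / Q"
        unfolding eq by (intro invariant_graph_displacement_less[OF ig] R'per)
      then show ?thesis using True by (simp add: field_simps)
    next
      case False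
      then have "(real k * P + 1) / Q < real k * \<omega>" using k Q0 by (simp add: neg_divide_less_eq)
      then have "(g ^^ i) x + (real k * P + 1) / Q < (g ^^ k) ((g ^^ i) x)"
        unfolding eq by (intro invariant_graph_displacement_greater[OF ig] R'per)
      then show ?thesis using False Q0 by (simp add: field_simps)
    qed
    moreover have "(g ^^ (i + k)) x = (g ^^ k) ((g ^^ i) x)" by (subst add.commute) (simp add: funpow_add)
    ultimately show ?thesis by (simp add: X_def algebra_simps)
  qed
  have inc: "X i \<le> X (Suc i)" for i
  proof -
    have "Q * (g ^^ i) x + P < Q * (g ^^ 1) ((g ^^ i) x)"
    proof (cases "Q > 0")
      case True
      then have "P / Q < real 1 * \<omega>" using pos by (simp add: Q_def P_def pos_divide_less_eq mult.commute)
      then have "(g ^^ i) x + P / Q < (g ^^ 1) ((g ^^ i) x)"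
        unfolding P_def by (intro invariant_graph_displacement_greater[OF ig] R'per)
      then show ?thesis using True by (simp add: field_simps)
    next
      case False
      then have "real 1 * \<omega> < P / Q" using pos Q0 by (simp add: Q_def P_def neg_less_divide_eq mult.commute)
      then have "(g ^^ 1) ((g ^^ i) x) < (g ^^ i) x + P / Q"
        unfolding P_def by (intro invariant_graph_displacement_less[OF ig] R'per)
      then show ?thesis using False Q0 by (simp add: field_simps)
    qed
    then show ?thesis by (simp add: X_def algebra_simps)
  qed
  have rec: "X (Suc (Suc i)) + X i = 2 * X (Suc i) + S' (X (Suc i))" for i
  proof -
    have "S' (X (Suc i)) = Q * R' ((g ^^ Suc i) x)"
      using Q0 unfolding X_def S'P R'_def Q_def by simp
    moreover have "Q * (g (g ((g ^^ i) x)) + (g ^^ i) x) = Q * (2 * g ((g ^^ i) x) + R' (g ((g ^^ i) x)))"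
      using g(6)[of "(g ^^ i) x"] by simp
    ultimately show ?thesis by (simp add: X_def algebra_simps)
  qed
  \<comment> \<open>Galilean invariance: the moving frame changes every link by a telescoping term
    and a constant, so minimality between fixed ends is preserved.\<close>
  have action: "(\<Sum>l<k. (w l - w (Suc l))\<^sup>2 / 2 + R (w (Suc l)))
      = ((\<Sum>l<k. (y l - y (Suc l))\<^sup>2 / 2 + S (y (Suc l))) - P * (y 0 - y k) + real k * P\<^sup>2 / 2) / Q\<^sup>2"
    if w: "\<And>l. w l = (y l + real (i + l) * P) / Q" for w y :: "nat \<Rightarrow> real" and k i
  proof -
    have "(w l - w (Suc l))\<^sup>2 / 2 + R (w (Suc l))
        = ((y l - y (Suc l))\<^sup>2 / 2 + S (y (Suc l)) - P * (y l - y (Suc l)) + P\<^sup>2 / 2) / Q\<^sup>2" for l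
    proof -
      have eq: "w l - w (Suc l) = (y l - y (Suc l) - P) / Q"
        by (simp add: w diff_divide_distrib add_divide_distrib algebra_simps)
      have sq: "u\<^sup>2 / 2 - P * u + P\<^sup>2 / 2 = (u - P)\<^sup>2 / 2" for u
        by (simp add: power2_eq_square algebra_simps diff_divide_distrib add_divide_distrib)
      have "(w l - w (Suc l))\<^sup>2 / 2 = ((y l - y (Suc l))\<^sup>2 / 2 - P * (y l - y (Suc l)) + P\<^sup>2 / 2) / Q\<^sup>2"
        unfolding eq sq power_divide by simp
      moreover have "R (w (Suc l)) = S (y (Suc l)) / Q\<^sup>2"
      proof -
        have "Q * w (Suc l) - real (i + Suc l) * P = y (Suc l)" using Q0 by (simp add: w)
        then have "S (Q * w (Suc l)) = S (y (Suc l))" by (metis S'P(2))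
        then show ?thesis by (simp add: R_def Q_def)
      qed
      ultimately show ?thesis by (simp add: add_divide_distrib diff_divide_distrib)
    qed
    then have "(\<Sum>l<k. (w l - w (Suc l))\<^sup>2 / 2 + R (w (Suc l)))
        = (\<Sum>l<k. (y l - y (Suc l))\<^sup>2 / 2 + S (y (Suc l)) - P * (y l - y (Suc l)) + P\<^sup>2 / 2) / Q\<^sup>2"
      by (simp add: sum_divide_distrib)
    also have "(\<Sum>l<k. (y l - y (Suc l))\<^sup>2 / 2 + S (y (Suc l)) - P * (y l - y (Suc l)) + P\<^sup>2 / 2)
        = (\<Sum>l<k. (y l - y (Suc l))\<^sup>2 / 2 + S (y (Suc l))) - P * (\<Sum>l<k. y l - y (Suc l)) + real k * P\<^sup>2 / 2"
      by (simp add: sum.distrib sum_subtractf sum_distrib_left right_diff_distrib)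
    also have "(\<Sum>l<k. y l - y (Suc l)) = y 0 - y k" by (rule sum_lessThan_telescope')
    finally show ?thesis .
  qed
  have minim: "(\<Sum>l<k. (X (i + l) - X (i + Suc l))\<^sup>2 / 2 + S (X (i + Suc l)))
          \<le> (\<Sum>l<k. (y l - y (Suc l))\<^sup>2 / 2 + S (y (Suc l)))"
    if y: "y 0 = X i" "y k = X (i + k)" for i k y
  proof -
    define z where "z = (g ^^ i) x"
    have gz: "(g ^^ l) z = (X (i + l) + real (i + l) * P) / Q" for l
      using Xg[of "i + l"] by (simp add: z_def funpow_add add.commute[of i l])
    define w where "w l = (y l + real (i + l) * P) / Q" for l
    have "w 0 = z" "w k = (g ^^ k) z" using gz[of 0] gz[of k] y by (simp_all add: w_def)
    from invariant_graph_minimizing[OF ig Rd this]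
    have "((\<Sum>l<k. (X (i + l) - X (i + Suc l))\<^sup>2 / 2 + S (X (i + Suc l))) - P * (X (i + 0) - X (i + k)) + real k * P\<^sup>2 / 2) / Q\<^sup>2
        \<le> ((\<Sum>l<k. (y l - y (Suc l))\<^sup>2 / 2 + S (y (Suc l))) - P * (y 0 - y k) + real k * P\<^sup>2 / 2) / Q\<^sup>2"
      unfolding action[OF gz] action[of w y i, OF w_def] .
    then show ?thesis using y Q0 by (simp add: divide_le_cancel)
  qed
  have "X n = c" using x Q0 by (simp add: X_def field_simps)
  then show ?thesis
    using inc rec minim disp unfolding minimizing_orbit_def by (intro exI[of _ X] conjI allI impI) blast+
qed

text \<open>Here r is a time scale and not an order of smoothness: crossing a cell in r steps costs
  about 1 / r, resting in the middle half of a cell costs at least 1 / r^2 per step, and near an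
  integer the force repels at rate about 1 / r per step. The wells are minima of \<open>S\<close>,
  yet hyperbolic, since the force is added to the second difference with a plus sign.\<close>

locale periodic_well =
  fixes S S' :: "real \<Rightarrow> real" and r :: nat
  assumes r1: "r \<ge> 1"
    and deriv: "(S has_real_derivative S' x) (at x)"
    and per: "S' (x + 1) = S' x"
    and nonneg: "0 \<le> S x" and upper: "S x \<le> 3 / (real r)\<^sup>2"
    and zero: "S (of_int m) = 0"
    and top: "of_int m + 1 / 4 \<le> x \<Longrightarrow> x \<le> of_int m + 3 / 4 \<Longrightarrow> 1 / (real r)\<^sup>2 \<le> S x"
    and well: "\<bar>e\<bar> \<le> 1 / 4 \<Longrightarrow> e\<^sup>2 / (real r)\<^sup>2 \<le> e * S' (of_int m + e)"
begin

text \<open>Otherwise it would be cheaper to walk down to the integer, wait there and walk back.\<close>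
lemma few_steps_on_top:
  assumes mo: "minimizing_orbit S S' x" and z: "of_int m + 1 / 4 \<le> x j" "x (j + n) \<le> of_int m + 3 / 4"
  shows "n \<le> 10 * r"
proof (cases "r \<le> n")
  case True
  define A where "A = 1 / (real r)\<^sup>2"
  have A: "A > 0" using r1 by (simp add: A_def)
  define z where "z = x j"
  define e where "e = x (j + n)"
  have xm: "x i \<le> x k" if "i \<le> k" for i k
    using mo that by (auto simp: minimizing_orbit_def intro: lift_Suc_mono_le)
  have orb: "z \<le> x (j + i)" "i \<le> n \<Longrightarrow> x (j + i) \<le> e" for i
    by (auto simp: e_def z_def intro: xm)
  \<comment> \<open>A linear ramp of r steps; \<open>y\<close> uses it to reach the integer and,
    reversed, to leave it. The case \<open>r \<le> n\<close> ensures that each ramp has ended at the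
    far end of the segment.\<close>
  define p where "p i = max 0 (1 - real i / real r)" for i
  define y where "y i = of_int m + (z - of_int m) * p i + (e - of_int m) * p (n - i)" for i
  have p0: "p 0 = 1" and pr: "p i = 0" if "r \<le> i" for i
    using that r1 by (auto simp: p_def)
  have pd: "\<bar>p i - p (Suc i)\<bar> \<le> 1 / real r" for i
  proof -
    have "\<bar>max 0 a - max 0 b\<bar> \<le> \<bar>a - b\<bar>" for a b :: real by auto
    from this[of "1 - real i / real r" "1 - real (Suc i) / real r"]
    show ?thesis by (simp add: p_def add_divide_distrib)
  qed
  have ze: "\<bar>z - of_int m\<bar> \<le> 1" "\<bar>e - of_int m\<bar> \<le> 1"
    using z orb(2)[of 0] orb(1)[of n] by (auto simp: e_def z_def)
  \<comment> \<open>On a ramp, even where the two overlap, a step has length at most 2 / r and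
    kinetic cost at most \<open>2 * A\<close>; the potential adds at most \<open>3 * A\<close>. Two
    ramps of r steps thus cost \<open>10 * r * A\<close>, the origin of the bound.\<close>
  have step: "(y i - y (Suc i))\<^sup>2 / 2 + S (y (Suc i))
      \<le> 5 * A * (if i < r then 1 else 0) + 5 * A * (if n - i \<le> r then 1 else 0)" if "i < n" for i
  proof (cases "i < r \<or> n - i \<le> r")
    case True
    have "n - i = Suc (n - Suc i)" using that by simp
    then have 1: "\<bar>p (n - i) - p (n - Suc i)\<bar> \<le> 1 / real r"
      using pd[of "n - Suc i"] by (simp add: abs_minus_commute)
    have "y i - y (Suc i) = (z - of_int m) * (p i - p (Suc i)) + (e - of_int m) * (p (n - i) - p (n - Suc i))"
      by (simp add: y_def algebra_simps)
    also have "\<bar>\<dots>\<bar> \<le> \<bar>z - of_int m\<bar> * \<bar>p i - p (Suc i)\<bar> + \<bar>e - of_int m\<bar> * \<bar>p (n - i) - p (n - Suc i)\<bar>"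
      unfolding abs_mult[symmetric] by (rule abs_triangle_ineq)
    also have "\<dots> \<le> 1 * (1 / real r) + 1 * (1 / real r)"
      using ze pd[of i] 1 by (intro add_mono mult_mono) auto
    finally have "(y i - y (Suc i))\<^sup>2 \<le> (2 / real r)\<^sup>2"
      by (intro abs_le_square_iff[THEN iffD1]) auto
    then have "(y i - y (Suc i))\<^sup>2 / 2 \<le> 2 * A" by (simp add: A_def power_divide)
    moreover have "S (y (Suc i)) \<le> 3 * A" using upper by (simp add: A_def)
    ultimately show ?thesis using True A by auto
  next
    case False
    then have "y i = of_int m" "y (Suc i) = of_int m" by (auto simp: y_def pr)
    then show ?thesis using False zero by simp
  qed
  have "real n * A = (\<Sum>i<n. A)" by simp
  also have "\<dots> \<le> (\<Sum>i<n. (x (j + i) - x (j + Suc i))\<^sup>2 / 2 + S (x (j + Suc i)))"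
  proof (rule sum_mono)
    fix i assume "i \<in> {..<n}"
    then have "A \<le> S (x (j + Suc i))"
      unfolding A_def using z orb(1)[of "Suc i"] orb(2)[of "Suc i"] e_def z_def by (intro top[of m]) auto
    then show "A \<le> (x (j + i) - x (j + Suc i))\<^sup>2 / 2 + S (x (j + Suc i))"
      using zero_le_power2[of "x (j + i) - x (j + Suc i)"] by linarith
  qed
  also have "\<dots> \<le> (\<Sum>i<n. (y i - y (Suc i))\<^sup>2 / 2 + S (y (Suc i)))"
  proof -
    have "y 0 = x j" "y n = x (j + n)" using True by (auto simp: y_def p0 pr e_def z_def)
    then show ?thesis using mo unfolding minimizing_orbit_def by blast
  qed
  also have "\<dots> \<le> (\<Sum>i<n. 5 * A * (if i < r then 1 else 0) + 5 * A * (if n - i \<le> r then 1 else 0))"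
    using step by (intro sum_mono) auto
  also have "\<dots> = 5 * A * real (card {i. i < n \<and> i < r}) + 5 * A * real (card {i. i < n \<and> n - i \<le> r})"
    by (simp add: sum.distrib sum_distrib_left[symmetric] sum.If_cases Collect_conj_eq lessThan_def)
  also have "\<dots> \<le> 5 * A * real r + 5 * A * real r"
  proof -
    have "card {i. i < n \<and> i < r} \<le> card {..<r}" by (intro card_mono) auto
    moreover have "card {i. i < n \<and> n - i \<le> r} \<le> card {n - r..<n}" by (intro card_mono) auto
    ultimately show ?thesis using A True by (intro add_mono mult_left_mono) auto
  qed
  finally have "real n * A \<le> real (10 * r) * A" by (simp add: ac_simps)
  then show ?thesis using A by simp
qed simp

text \<open>By \<open>few_steps_on_top\<close> the monotone orbit needs at most
  \<open>10 * r\<close> steps to leave each of the two adjacent middle zones. For the rest of the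
  time it is within 1/4 of the integer, where repulsion at rate 1 / r in both time directions forces
  exponential smallness halfway.\<close>

lemma orbit_close_to_integer:
  assumes mo: "minimizing_orbit S S' X"
    and z: "of_int m - 3 / 4 \<le> X j" "X (j + 2 * M) \<le> of_int m + 3 / 4" and M: "10 * r + 1 < M"
  shows "\<bar>X (j + M) - of_int m\<bar> \<le> 1 / 2 / (1 + 1 / real r) ^ (M - 10 * r - 1)"
proof -
  define N where "N = 10 * r + 1"
  define x where "x i = X (j + i)" for i
  have x: "x i \<le> x k" if "i \<le> k" for i k
    using mo that unfolding x_def by (auto simp: minimizing_orbit_def intro: lift_Suc_mono_le)
  have left: "of_int m - 1 / 4 \<le> x i" if "N \<le> i" for i
  proof (rule ccontr)
    assume "\<not> ?thesis"
    then have "i \<le> 10 * r" using z(1)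
      by (intro few_steps_on_top[OF mo, of "m - 1" j i]) (auto simp: x_def)
    then show False using that by (simp add: N_def)
  qed
  have right: "x i \<le> of_int m + 1 / 4" if "i + N \<le> 2 * M" for i
  proof (rule ccontr)
    assume *: "\<not> ?thesis"
    have "x (i + N) \<le> of_int m + 3 / 4" using x[OF that] z(2) by (simp add: x_def)
    then have "N \<le> 10 * r" using *
      by (intro few_steps_on_top[OF mo, of m "j + i" N]) (auto simp: x_def add.assoc)
    then show False by (simp add: N_def)
  qed
  define e where "e i = x (N + i) - of_int m" for i
  have "\<bar>e (M - N)\<bar> \<le> 1 / 2 / (1 + 1 / real r) ^ (M - N)"
  proof (rule discrete_decay)
    show bd: "\<bar>e i\<bar> \<le> 1 / 4" if "i \<le> 2 * (M - N)" for i
    proof -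
      have "(N + i) + N \<le> 2 * M" using that M by (simp add: N_def)
      then show ?thesis using left[of "N + i"] right[of "N + i"] unfolding e_def by linarith
    qed
    show "(2 + (1 / real r)\<^sup>2) * \<bar>e (Suc i)\<bar> \<le> \<bar>e (Suc (Suc i))\<bar> + \<bar>e i\<bar>" if "Suc i < 2 * (M - N)" for i
    proof (cases "e (Suc i) = 0")
      case False
      have "e (Suc (Suc i)) + e i = 2 * e (Suc i) + S' (of_int m + e (Suc i))"
        using mo unfolding minimizing_orbit_def by (simp add: e_def x_def)
      then have "e (Suc i) * (e (Suc (Suc i)) + e i) = 2 * (e (Suc i))\<^sup>2 + e (Suc i) * S' (of_int m + e (Suc i))"
        by (simp add: algebra_simps power2_eq_square)
      also have "\<dots> \<ge> 2 * (e (Suc i))\<^sup>2 + (e (Suc i))\<^sup>2 / (real r)\<^sup>2"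
        using well[OF bd[of "Suc i"]] that by simp
      finally have "(2 + (1 / real r)\<^sup>2) * \<bar>e (Suc i)\<bar> * \<bar>e (Suc i)\<bar> \<le> e (Suc i) * (e (Suc (Suc i)) + e i)"
        by (simp add: algebra_simps power_divide power2_eq_square)
      also have "\<dots> \<le> \<bar>e (Suc i)\<bar> * \<bar>e (Suc (Suc i)) + e i\<bar>" by (metis abs_ge_self abs_mult)
      also have "\<dots> \<le> (\<bar>e (Suc (Suc i))\<bar> + \<bar>e i\<bar>) * \<bar>e (Suc i)\<bar>"
        by (simp add: mult.commute mult_left_mono abs_triangle_ineq)
      finally show ?thesis using False by simp
    qed simp
  qed (use r1 in simp)
  then show ?thesis using M by (simp add: e_def x_def N_def)
qed

end

section \<open>The cost of passing through the bump\<close>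

text \<open>Pigeonhole: of \<open>Suc N\<close> equal cells in [1/4, 3/4] at least one contains no
  point of \<open>T\<close>, and c is its midpoint.\<close>

lemma exists_gap:
  fixes T :: "real set"
  assumes "finite T" "card T \<le> N"
  obtains c where "1 / 4 + 1 / (4 * real (Suc N)) \<le> c" "c \<le> 3 / 4 - 1 / (4 * real (Suc N))"
    "\<And>t. t \<in> T \<Longrightarrow> 1 / (4 * real (Suc N)) \<le> \<bar>t - c\<bar>"
proof -
  define w where "w = 1 / (2 * real (Suc N))"
  have w: "w > 0" "real (Suc N) * w = 1 / 2" by (auto simp: w_def field_simps)
  define f where "f t = nat \<lfloor>(t - 1 / 4) / w\<rfloor>" for t
  have "card (f ` T) \<le> N" using card_image_le[OF assms(1), of f] assms(2) by simp
  then have "\<not> {..N} \<subseteq> f ` T"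
    using card_mono[of "f ` T" "{..N}"] assms(1) by auto
  then obtain j where j: "j \<le> N" "j \<notin> f ` T" by auto
  define c where "c = 1 / 4 + (real j + 1 / 2) * w"
  have w2: "1 / (4 * real (Suc N)) = w / 2" by (simp add: w_def)
  have "(real j + 1 / 2) * w + w / 2 \<le> real (Suc N) * w"
    using j(1) w(1) by (auto simp: algebra_simps intro!: mult_right_mono)
  then have "c \<le> 3 / 4 - w / 2" using w(2) by (simp add: c_def)
  moreover have "1 / 4 + w / 2 \<le> c" using w(1) by (simp add: c_def algebra_simps)
  moreover have "w / 2 \<le> \<bar>t - c\<bar>" if "t \<in> T" for t
  proof (rule ccontr)
    assume "\<not> ?thesis"
    then have "c - w / 2 < t" "t < c + w / 2" by linarith+
    then have "real j * w < t - 1 / 4" "t - 1 / 4 < (real j + 1) * w"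
      by (auto simp: c_def algebra_simps)
    then have "real j < (t - 1 / 4) / w" "(t - 1 / 4) / w < real j + 1"
      using w(1) by (auto simp: pos_less_divide_eq pos_divide_less_eq)
    then have "\<lfloor>(t - 1 / 4) / w\<rfloor> = int j" by (intro floor_unique) auto
    then have "f t = j" by (simp add: f_def)
    then show False using j(2) that by blast
  qed
  ultimately show ?thesis by (intro that[of c]) (simp_all only: w2)
qed

text \<open>The bump leaves a definite margin, so almost minimal transitions suffice and the
  existence of minimizers need not be discussed.\<close>

lemma approximate_minimizer:
  fixes J :: "'a \<Rightarrow> real"
  assumes "y0 \<in> K" "\<And>y. y \<in> K \<Longrightarrow> 0 \<le> J y" "\<eta> > 0"
  obtains y where "y \<in> K" "\<And>z. z \<in> K \<Longrightarrow> J y \<le> J z + \<eta>"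
proof -
  have bdd: "bdd_below (J ` K)" using assms(2) by (intro bdd_belowI[of _ 0]) auto
  have "\<exists>v\<in>J ` K. v < Inf (J ` K) + \<eta>"
    using assms by (intro cInf_lessD) auto
  then obtain y where y: "y \<in> K" "J y < Inf (J ` K) + \<eta>" by auto
  show ?thesis
  proof (rule that[OF y(1)])
    fix z assume "z \<in> K"
    then have "Inf (J ` K) \<le> J z" using bdd by (intro cInf_lower) auto
    then show "J y \<le> J z + \<eta>" using y(2) by simp
  qed
qed

lemma sin_pi_ge:
  fixes x :: real
  assumes "0 \<le> x" "x \<le> 1 / 2"
  shows "2 * x \<le> sin (pi * x)"
proof -
  have "convex_on {0..1 / 2} (\<lambda>x. - sin (pi * x))"
  proof (rule f''_ge0_imp_convex)
    show "((\<lambda>x. - sin (pi * x)) has_real_derivative (- (pi * cos (pi * x)))) (at x)" for x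
      by (auto intro!: derivative_eq_intros)
    show "((\<lambda>x. - (pi * cos (pi * x))) has_real_derivative (pi\<^sup>2 * sin (pi * x))) (at x)" for x
      by (auto intro!: derivative_eq_intros simp: power2_eq_square)
    show "0 \<le> pi\<^sup>2 * sin (pi * x)" if "x \<in> {0..1 / 2}" for x
      using that by (intro mult_nonneg_nonneg sin_ge_zero) (auto simp: field_simps)
  qed auto
  from convex_onD[OF this, of "2 * x" 0 "1 / 2"] assms show ?thesis by simp
qed

text \<open>Only the first and the last link change. As those links have length at most 4 and
  \<open>d \<le> 1\<close>, each change costs at most \<open>5 * d\<close>.\<close>

lemma change_endpoints:
  fixes y :: "nat \<Rightarrow> real"
  assumes "2 \<le> L" and d: "\<bar>p - y 0\<bar> \<le> d" "\<bar>q - y L\<bar> \<le> d" "d \<le> 1"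
    and s: "\<bar>y 0 - y 1\<bar> \<le> 4" "\<bar>y (L - 1) - y L\<bar> \<le> 4"
  defines "Y \<equiv> y(0 := p, L := q)"
  shows "(\<Sum>i<L. (Y i - Y (Suc i))\<^sup>2 / 2) \<le> (\<Sum>i<L. (y i - y (Suc i))\<^sup>2 / 2) + 10 * d"
proof -
  obtain M where M: "L = Suc (Suc M)" using assms(1) by (metis add_2_eq_Suc le_Suc_ex)
  have split: "(\<Sum>i<L. f i) = f 0 + (\<Sum>i<M. f (Suc i)) + f (Suc M)" for f :: "nat \<Rightarrow> real"
    unfolding M sum.lessThan_Suc_shift[of f "Suc M"] sum.lessThan_Suc[of "\<lambda>i. f (Suc i)" M] by simp
  have sq: "(a - c)\<^sup>2 / 2 \<le> (b - c)\<^sup>2 / 2 + 5 * d" if "\<bar>a - b\<bar> \<le> d" "\<bar>b - c\<bar> \<le> 4" for a b c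
  proof -
    have "(a - c)\<^sup>2 - (b - c)\<^sup>2 = (a - b) * ((a - b) + 2 * (b - c))"
      by (simp add: power2_eq_square algebra_simps)
    also have "\<dots> \<le> \<bar>a - b\<bar> * \<bar>(a - b) + 2 * (b - c)\<bar>" by (metis abs_ge_self abs_mult)
    also have "\<dots> \<le> d * 10" using that d(3) by (intro mult_mono) auto
    finally show ?thesis by simp
  qed
  have "(Y 0 - Y 1)\<^sup>2 / 2 \<le> (y 0 - y 1)\<^sup>2 / 2 + 5 * d"
    using sq[of p "y 0" "y 1"] d s by (simp add: Y_def M)
  moreover have "(Y (Suc M) - Y (Suc (Suc M)))\<^sup>2 / 2 \<le> (y (Suc M) - y (Suc (Suc M)))\<^sup>2 / 2 + 5 * d"
    using sq[of q "y L" "y (Suc M)"] d s by (simp add: Y_def M power2_commute abs_minus_commute)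
  moreover have "(\<Sum>i<M. (Y (Suc i) - Y (Suc (Suc i)))\<^sup>2 / 2) = (\<Sum>i<M. (y (Suc i) - y (Suc (Suc i)))\<^sup>2 / 2)"
    by (intro sum.cong) (auto simp: Y_def M)
  ultimately show ?thesis unfolding split by simp
qed

lemma frac_sin_pi_sq: "(sin (pi * (y - c)))\<^sup>2 = (sin (pi * (frac y - c)))\<^sup>2"
proof -
  have *: "(sin x)\<^sup>2 = (1 - cos (2 * x)) / 2" for x :: real
    using cos_double_sin[of x] by simp
  have "2 * (pi * (y - c)) = 2 * (pi * (frac y - c)) + 2 * pi * of_int \<lfloor>y\<rfloor>"
    by (simp add: frac_def algebra_simps)
  then have "cos (2 * (pi * (y - c))) = cos (2 * (pi * (frac y - c)))"
    by (metis cos_add cos_int_2pin sin_int_2pin diff_zero mult.right_neutral mult_zero_right)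
  then show ?thesis by (simp only: *)
qed

lemma sin_pi_sq_ge:
  assumes "0 \<le> h" "h \<le> \<bar>u\<bar>" "\<bar>u\<bar> \<le> 1 - h"
  shows "(2 * h)\<^sup>2 \<le> (sin (pi * u))\<^sup>2"
proof -
  have "2 * h \<le> sin (pi * \<bar>u\<bar>)"
  proof (cases "\<bar>u\<bar> \<le> 1 / 2")
    case True then show ?thesis using sin_pi_ge[of "\<bar>u\<bar>"] assms by simp
  next
    case False
    have "sin (pi * \<bar>u\<bar>) = sin (pi * (1 - \<bar>u\<bar>))" using sin_pi_minus[of "pi * \<bar>u\<bar>"] by (simp add: algebra_simps)
    then show ?thesis using sin_pi_ge[of "1 - \<bar>u\<bar>"] False assms by simp
  qed
  then have "(2 * h)\<^sup>2 \<le> (sin (pi * \<bar>u\<bar>))\<^sup>2" using assms(1) by (intro power_mono) auto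
  also have "(sin (pi * \<bar>u\<bar>))\<^sup>2 = (sin (pi * u))\<^sup>2" by (cases "0 \<le> u") auto
  finally show ?thesis .
qed

lemma sin_pi_sq_ge_half:
  assumes "of_int m + 1 / 4 \<le> x" "x \<le> of_int m + 3 / 4"
  shows "1 / 2 \<le> (sin (pi * x))\<^sup>2"
proof -
  have "frac x = x - of_int m" using assms by (subst frac_unique_iff) auto
  then have "(sin (pi * x))\<^sup>2 = (sin (pi * (x - of_int m)))\<^sup>2"
    using frac_sin_pi_sq[of x 0] by simp
  moreover have "(sin y)\<^sup>2 = (1 - cos (2 * y)) / 2" for y :: real
    using cos_double_sin[of y] by simp
  moreover have "cos (2 * (pi * (x - of_int m))) \<le> 0"
  proof -
    define t where "t = 2 * (pi * (x - of_int m)) - pi"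
    have "2 * pi * (1 / 4) \<le> 2 * pi * (x - of_int m)" "2 * pi * (x - of_int m) \<le> 2 * pi * (3 / 4)"
      using assms by (intro mult_left_mono; simp)+
    then have "- (pi / 2) \<le> t" "t \<le> pi / 2" unfolding t_def by linarith+
    then have "0 \<le> cos t" by (rule cos_ge_zero)
    then show ?thesis by (simp add: t_def)
  qed
  ultimately show ?thesis by simp
qed

text \<open>The bump at c is placed in a gap of a nearly minimal transition y from 0 to 1 of the
  potential without bump; a transition through c then costs noticeably more than y.\<close>
lemma no_slow_minimizing_orbit:
  fixes K :: "real \<Rightarrow> real \<Rightarrow> real" and S' :: "real \<Rightarrow> real \<Rightarrow> real" and r \<tau> :: nat and a \<kappa> :: real
  defines "S \<equiv> \<lambda>c x. (sin (pi * x))\<^sup>2 * (2 / (real r)\<^sup>2 + a * K c x)"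
  assumes well: "\<And>c. periodic_well (S c) (S' c) r"
    and K0: "\<And>c x. 0 \<le> K c x" and K1: "\<And>c. K c c = 1"
    and Kfar: "\<And>c x. (1 / (2 * real (Suc (4 * r))))\<^sup>2 \<le> (sin (pi * (x - c)))\<^sup>2 \<Longrightarrow> K c x \<le> \<kappa>"
    and \<kappa>: "16 * real r * \<kappa> \<le> 1" and a: "0 < a" "a \<le> 1 / real r" and \<tau>: "10 * r + 1 < \<tau>"
    and small: "80 * (1 / 2 / (1 + 1 / real r) ^ (\<tau> - 10 * r - 1)) < a"
  shows "\<exists>c. \<forall>x. x (2 * \<tau>) = c \<and> x (2 * \<tau>) < x 0 + 1 \<and> x (4 * \<tau>) < c + 1 \<longrightarrow> \<not> minimizing_orbit (S c) (S' c) x"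
proof -
  have r: "r \<ge> 1" using periodic_well.r1[OF well] .
  define d where "d = 1 / 2 / (1 + 1 / real r) ^ (\<tau> - 10 * r - 1)"
  have d: "0 < d" "d \<le> 1" "80 * d < a"
  proof -
    have "1 \<le> (1 + 1 / real r) ^ (\<tau> - 10 * r - 1)" by (intro one_le_power) simp
    moreover have "0 < 1 / 2 / P \<and> 1 / 2 / P \<le> 1" if "1 \<le> P" for P :: real
      using that by (auto simp: field_simps)
    ultimately have "0 < d \<and> d \<le> 1" unfolding d_def by blast
    then show "0 < d" "d \<le> 1" by auto
    show "80 * d < a" using small by (simp add: d_def)
  qed
  define L where "L = 2 * \<tau>"
  have L: "2 \<le> L" "r \<le> L" "Suc (L - 1) = L" using \<tau> by (auto simp: L_def)
  define u where "u x = 2 / (real r)\<^sup>2 * (sin (pi * x))\<^sup>2" for x :: real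
  have u0: "0 \<le> u x" "u 0 = 0" "u 1 = 0" "u x \<le> 2 / (real r)\<^sup>2" for x
    using r by (auto simp: u_def field_simps abs_square_le_1 sin_zero_iff_int2 mult_left_le)
  define E where "E y = (\<Sum>i<L. (y i - y (Suc i))\<^sup>2 / 2)" for y :: "nat \<Rightarrow> real"
  define J where "J y = E y + (\<Sum>i<L. u (y (Suc i)))" for y :: "nat \<Rightarrow> real"
  have E0: "0 \<le> E y" for y unfolding E_def by (intro sum_nonneg) auto
  define D where "D = {y :: nat \<Rightarrow> real. y 0 = 0 \<and> y L = 1}"
  \<comment> \<open>A ramp of r steps, each costing at most 1 / r^2 in kinetic and 2 / r^2 in
    potential action, bounds the minimal action by 3 / r.\<close>
  define y1 where "y1 i = min 1 (real i / real r)" for i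
  have y1D: "y1 \<in> D" using L r by (auto simp: D_def y1_def field_simps)
  have Jy1: "J y1 \<le> 3 / real r"
  proof -
    have step: "(y1 i - y1 (Suc i))\<^sup>2 / 2 + u (y1 (Suc i)) \<le> (if i < r then 3 / (real r)\<^sup>2 else 0)" for i
    proof (cases "i < r")
      case True
      then have "real i / real r \<le> 1" "real (Suc i) / real r \<le> 1" using r by simp_all
      then have "y1 i - y1 (Suc i) = - (1 / real r)"
        by (simp add: y1_def min_absorb2 add_divide_distrib del: divide_le_eq_1)
      then have "(y1 i - y1 (Suc i))\<^sup>2 / 2 = 1 / 2 / (real r)\<^sup>2" by (simp add: power_divide)
      also have "\<dots> \<le> 1 / (real r)\<^sup>2" by (intro divide_right_mono) auto
      finally show ?thesis using True u0(4)[of "y1 (Suc i)"] by (simp add: add_divide_distrib[symmetric] flip: add_divide_distrib)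
    next
      case False
      then have "y1 i = 1" "y1 (Suc i) = 1" using r by (auto simp: y1_def field_simps)
      then show ?thesis using False u0 by simp
    qed
    have "J y1 = (\<Sum>i<L. (y1 i - y1 (Suc i))\<^sup>2 / 2 + u (y1 (Suc i)))"
      by (simp add: J_def E_def sum.distrib)
    also have "\<dots> \<le> (\<Sum>i<L. if i < r then 3 / (real r)\<^sup>2 else 0)" by (intro sum_mono step)
    also have "\<dots> = (\<Sum>i<r. 3 / (real r)\<^sup>2)" using L(2)
      by (intro sum.mono_neutral_cong_right) auto
    also have "\<dots> = 3 / real r" using r by (simp add: power2_eq_square)
    finally show ?thesis .
  qed
  obtain y where y: "y \<in> D" "\<And>z. z \<in> D \<Longrightarrow> J y \<le> J z + a / 8"
  proof (rule approximate_minimizer[OF y1D, of J "a / 8"])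
    show "0 \<le> J z" for z unfolding J_def using E0[of z] u0(1) by (intro add_nonneg_nonneg sum_nonneg) auto
  qed (use a in auto)
  have Jy: "J y \<le> 4 / real r"
  proof -
    have "a / 8 \<le> 1 / real r" using a by simp
    then have "J y \<le> 3 / real r + 1 / real r" using y(2)[OF y1D] Jy1 by linarith
    then show ?thesis by simp
  qed
  have uy: "(\<Sum>i<L. u (y (Suc i))) \<le> 4 / real r" and Ey: "E y \<le> 4 / real r"
    using Jy E0[of y] sum_nonneg[of "{..<L}" "\<lambda>i. u (y (Suc i))"] u0(1) by (auto simp: J_def)
  \<comment> \<open>Each point of y in a middle half costs at least 1 / r^2 out of a total of 4 / r.
    So there are at most \<open>4 * r\<close> of them, however many steps y takes, and they leave a
    gap of width about 1 / r.\<close>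
  define I where "I = {i. i < L \<and> frac (y (Suc i)) \<in> {1 / 4..3 / 4}}"
  have "card I \<le> 4 * r"
  proof -
    have "finite I" by (simp add: I_def)
    have "real (card I) * (1 / (real r)\<^sup>2) = (\<Sum>i\<in>I. 1 / (real r)\<^sup>2)" by simp
    also have "\<dots> \<le> (\<Sum>i\<in>I. u (y (Suc i)))"
    proof (rule sum_mono)
      fix i assume "i \<in> I"
      then have "1 / 2 \<le> (sin (pi * frac (y (Suc i))))\<^sup>2"
        by (intro sin_pi_sq_ge_half[of 0]) (auto simp: I_def)
      then have "1 / 2 \<le> (sin (pi * y (Suc i)))\<^sup>2" using frac_sin_pi_sq[of "y (Suc i)" 0] by simp
      then have "2 / (real r)\<^sup>2 * (1 / 2) \<le> u (y (Suc i))" unfolding u_def by (intro mult_left_mono) auto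
      then show "1 / (real r)\<^sup>2 \<le> u (y (Suc i))" by simp
    qed
    also have "\<dots> \<le> (\<Sum>i<L. u (y (Suc i)))" using u0(1) by (intro sum_mono2) (auto simp: I_def)
    also have "\<dots> \<le> 4 / real r" by (rule uy)
    finally have "real (card I) \<le> 4 / real r * (real r)\<^sup>2" using r by (simp add: pos_divide_le_eq)
    then have "real (card I) \<le> real (4 * r)" using r by (simp add: power2_eq_square)
    then show ?thesis by (simp only: of_nat_le_iff)
  qed
  moreover have "finite I" by (simp add: I_def)
  ultimately have T: "finite ((\<lambda>i. frac (y (Suc i))) ` I)" "card ((\<lambda>i. frac (y (Suc i))) ` I) \<le> 4 * r"
    using card_image_le[of I] order_trans by auto
  define h where "h = 1 / (4 * real (Suc (4 * r)))"
  obtain c where c: "1 / 4 + h \<le> c" "c \<le> 3 / 4 - h" "\<And>i. i \<in> I \<Longrightarrow> h \<le> \<bar>frac (y (Suc i)) - c\<bar>"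
    using exists_gap[OF T] by (metis (no_types, lifting) h_def image_eqI)
  have h: "0 < h" "h \<le> 1 / 4" by (auto simp: h_def field_simps)
  define V where "V x = a * (sin (pi * x))\<^sup>2 * K c x" for x
  have V0: "0 \<le> V x" for x using K0[of c x] a by (simp add: V_def)
  have SuV: "S c x = u x + V x" for x by (simp add: S_def u_def V_def algebra_simps)
  \<comment> \<open>Off the gap the kernel is at most \<open>\<kappa>\<close>. Counting steps would
    lose a factor \<open>L\<close>, much larger than r; instead the common factor
    \<open>sin\<^sup>2\<close> bounds the bump by a multiple of \<open>u\<close>, whose sum along y
    is already controlled.\<close>
  have Vy: "(\<Sum>i<L. V (y (Suc i))) \<le> a / 8"
  proof -
    have "V (y (Suc i)) \<le> a * \<kappa> * ((real r)\<^sup>2 / 2) * u (y (Suc i))" if "i < L" for i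
    proof -
      let ?f = "frac (y (Suc i))"
      have f: "0 \<le> ?f" "?f < 1" by (auto simp: frac_lt_1)
      have "h \<le> \<bar>?f - c\<bar>"
      proof (cases "?f \<in> {1 / 4..3 / 4}")
        case True then show ?thesis using c(3)[of i] that by (simp add: I_def)
      next
        case False then show ?thesis using c(1,2) by auto
      qed
      moreover have "\<bar>?f - c\<bar> \<le> 1 - h" using f c(1,2) by linarith
      ultimately have "(2 * h)\<^sup>2 \<le> (sin (pi * (?f - c)))\<^sup>2" using h by (intro sin_pi_sq_ge) auto
      also have "\<dots> = (sin (pi * (y (Suc i) - c)))\<^sup>2" by (rule frac_sin_pi_sq[symmetric])
      also have "2 * h = 1 / (2 * real (Suc (4 * r)))" by (simp add: h_def del: of_nat_Suc)
      finally have "K c (y (Suc i)) \<le> \<kappa>" by (rule Kfar)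
      then have "V (y (Suc i)) \<le> a * (sin (pi * y (Suc i)))\<^sup>2 * \<kappa>"
        unfolding V_def using a by (intro mult_left_mono) auto
      also have "\<dots> = a * \<kappa> * ((real r)\<^sup>2 / 2) * u (y (Suc i))" using r by (simp add: u_def)
      finally show ?thesis .
    qed
    then have "(\<Sum>i<L. V (y (Suc i))) \<le> (\<Sum>i<L. a * \<kappa> * ((real r)\<^sup>2 / 2) * u (y (Suc i)))"
      by (intro sum_mono) auto
    also have "\<dots> = a * \<kappa> * ((real r)\<^sup>2 / 2) * (\<Sum>i<L. u (y (Suc i)))" by (simp add: sum_distrib_left)
    also have "\<dots> \<le> a * \<kappa> * ((real r)\<^sup>2 / 2) * (4 / real r)"
    proof -
      have "0 \<le> \<kappa>"
      proof -
        have "1 = (sin (pi * ((c + 1 / 2) - c)))\<^sup>2" by simp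
        moreover have "(1 / (2 * real (Suc (4 * r))))\<^sup>2 \<le> (1 :: real)\<^sup>2" by (intro power_mono) (auto simp: field_simps)
        ultimately have "K c (c + 1 / 2) \<le> \<kappa>" by (intro Kfar) (simp only: one_power2)
        then show ?thesis using K0 order_trans by blast
      qed
      then show ?thesis using a by (intro mult_left_mono uy) auto
    qed
    also have "\<dots> = a / 8 * (16 * real r * \<kappa>)" using r by (simp add: power2_eq_square)
    also have "\<dots> \<le> a / 8 * 1" using \<kappa> a by (intro mult_left_mono) auto
    finally show ?thesis by simp
  qed
  show ?thesis
  proof (intro exI[of _ c] allI impI notI, elim conjE)
    fix x
    assume x: "x (2 * \<tau>) = c" "x (2 * \<tau>) < x 0 + 1" "x (4 * \<tau>) < c + 1"
      and mo: "minimizing_orbit (S c) (S' c) x"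
    interpret periodic_well "S c" "S' c" r by (rule well)
    \<comment> \<open>Only times from \<open>\<tau>\<close> to \<open>3 * \<tau>\<close> are
      compared: at these two times the orbit is within d of 0 and of 1, and midway it is at
      c.\<close>
    define p where "p = x \<tau>"
    define X where "X i = x (\<tau> + i)" for i
    have X\<tau>: "X \<tau> = c" using x(1) by (simp add: X_def mult_2)
    have close0: "\<bar>p - 0\<bar> \<le> d"
      using orbit_close_to_integer[OF mo, of 0 0 \<tau>] x c(1,2) h \<tau> by (simp add: p_def d_def)
    have close1: "\<bar>X L - 1\<bar> \<le> d"
    proof -
      have "\<tau> + L = 2 * \<tau> + \<tau>" "2 * \<tau> + 2 * \<tau> = 4 * \<tau>" by (auto simp: L_def)
      then show ?thesis
        using orbit_close_to_integer[OF mo, of 1 "2 * \<tau>" \<tau>] x c(1,2) h \<tau> by (simp add: X_def d_def)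
    qed
    have Xm: "X i \<le> X j" if "i \<le> j" for i j
      using mo that unfolding X_def by (auto simp: minimizing_orbit_def intro: lift_Suc_mono_le)
    have X0: "X 0 = p" by (simp add: X_def p_def)
    \<comment> \<open>Exchange of ends: \<open>Y\<close> is \<open>y\<close> with the ends of
      \<open>X\<close> and competes with \<open>X\<close>, while \<open>Z\<close> is
      \<open>X\<close> with the ends of \<open>y\<close> and competes with \<open>y\<close>.\<close>
    define Y where "Y = y(0 := p, L := X L)"
    define Z where "Z = X(0 := 0, L := 1)"
    have y0: "y 0 = 0" "y L = 1" using y(1) by (auto simp: D_def)
    have ystep: "\<bar>y i - y (Suc i)\<bar> \<le> 4" if "i < L" for i
    proof -
      have "(y i - y (Suc i))\<^sup>2 / 2 \<le> E y"
        unfolding E_def using that by (intro member_le_sum) auto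
      also have "\<dots> \<le> 4 / real r" by (rule Ey)
      also have "\<dots> \<le> 4" using r by (simp add: divide_le_eq)
      finally have "(y i - y (Suc i))\<^sup>2 \<le> 4\<^sup>2" by simp
      then show ?thesis using abs_le_square_iff[of "y i - y (Suc i)" 4] by simp
    qed
    have EY: "E Y \<le> E y + 10 * d"
      unfolding E_def Y_def
      by (rule change_endpoints) (use L close0 close1 y0 d ystep[of 0] ystep[of "L - 1"] in auto)
    have EZ: "E Z \<le> E X + 10 * d"
      unfolding E_def Z_def
      by (rule change_endpoints)
        (use L X0 close0 close1 d Xm[of 0 1] Xm[of 1 L] Xm[of "L - 1" L] Xm[of 0 "L - 1"] in \<open>auto simp: abs_le_iff\<close>)
    have split: "(\<Sum>i<L. f (Suc i)) = (\<Sum>i<L - 1. f (Suc i)) + f L" for f :: "nat \<Rightarrow> real"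
      using sum.lessThan_Suc[of "\<lambda>i. f (Suc i)" "L - 1"] L(3) by simp
    have inner: "(\<Sum>i<L - 1. f ((w(0 := p', L := q')) (Suc i))) = (\<Sum>i<L - 1. f (w (Suc i)))"
      for f :: "real \<Rightarrow> real" and w p' q'
      by (intro sum.cong) auto
    have minimal: "E X + (\<Sum>i<L. S c (X (Suc i))) \<le> E Y + (\<Sum>i<L. S c (Y (Suc i)))"
    proof -
      have "(\<Sum>i<L. (X i - X (Suc i))\<^sup>2 / 2 + S c (X (Suc i))) \<le> (\<Sum>i<L. (Y i - Y (Suc i))\<^sup>2 / 2 + S c (Y (Suc i)))"
      proof -
        have "Y 0 = x \<tau>" "Y L = x (\<tau> + L)" using L by (auto simp: Y_def X_def p_def)
        then show ?thesis using mo unfolding minimizing_orbit_def X_def by blast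
      qed
      then show ?thesis by (simp add: E_def sum.distrib)
    qed
    have 1: "E X + (\<Sum>i<L - 1. S c (X (Suc i))) \<le> E Y + (\<Sum>i<L - 1. S c (y (Suc i)))"
    proof -
      have "(\<Sum>i<L - 1. S c (Y (Suc i))) = (\<Sum>i<L - 1. S c (y (Suc i)))" unfolding Y_def by (rule inner)
      moreover have "Y L = X L" by (simp add: Y_def)
      ultimately show ?thesis using minimal
        unfolding split[of "\<lambda>i. S c (X i)"] split[of "\<lambda>i. S c (Y i)"] by simp
    qed
    have "Z \<in> D" using L by (auto simp: Z_def D_def)
    have 2: "E y + (\<Sum>i<L. u (y (Suc i))) \<le> E Z + (\<Sum>i<L - 1. u (X (Suc i))) + a / 8"
    proof -
      have "(\<Sum>i<L - 1. u (Z (Suc i))) = (\<Sum>i<L - 1. u (X (Suc i)))" unfolding Z_def by (rule inner)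
      moreover have "Z L = 1" by (simp add: Z_def)
      ultimately show ?thesis using y(2)[OF \<open>Z \<in> D\<close>]
        unfolding J_def split[of "\<lambda>i. u (Z i)"] by (simp add: u0)
    qed
    have 3: "a / 2 \<le> (\<Sum>i<L - 1. V (X (Suc i)))"
    proof -
      have "1 / 2 \<le> (sin (pi * c))\<^sup>2" using c(1,2) h by (intro sin_pi_sq_ge_half[of 0]) auto
      then have "a * (1 / 2) \<le> V c" unfolding V_def K1 using a by (simp add: mult_left_mono)
      also have "V c = V (X (Suc (\<tau> - 1)))" using \<tau> X\<tau> by simp
      also have "\<dots> \<le> (\<Sum>i<L - 1. V (X (Suc i)))"
        using \<tau> V0 by (intro member_le_sum) (auto simp: L_def)
      finally show ?thesis by simp
    qed
    have 4: "(\<Sum>i<L - 1. S c (y (Suc i))) \<le> (\<Sum>i<L. u (y (Suc i))) + a / 8"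
    proof -
      have "(\<Sum>i<L - 1. S c (y (Suc i))) \<le> (\<Sum>i<L. S c (y (Suc i)))"
        by (intro sum_mono2) (auto simp: nonneg)
      also have "\<dots> = (\<Sum>i<L. u (y (Suc i))) + (\<Sum>i<L. V (y (Suc i)))" by (simp add: SuV sum.distrib)
      finally show ?thesis using Vy by simp
    qed
    have 5: "(\<Sum>i<L - 1. S c (X (Suc i))) = (\<Sum>i<L - 1. u (X (Suc i))) + (\<Sum>i<L - 1. V (X (Suc i)))"
      by (simp add: SuV sum.distrib)
    \<comment> \<open>The orbit pays at least a/2 for the bump. What it can save is at most a/8 for
      the bump along y, a/8 for the inexact minimality of y, and \<open>20 * d\<close> for the two
      exchanges of ends; together this is less than a/2 because \<open>80 * d < a\<close>.\<close>
    show False using 1 2 3 4 5 EY EZ d(3) by linarith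
  qed
qed

section \<open>The perturbation\<close>

lemma trig_bounded_sin_sq: "trig_bounded 1 1 (\<lambda>x. (sin (pi * x))\<^sup>2)"
proof -
  have "(sin (pi * x))\<^sup>2 = 1 / 2 + (- 1 / 2) * cos (2 * pi * of_int 1 * x)" for x
    using cos_double_sin[of "pi * x"] by (simp add: mult.assoc diff_divide_distrib)
  moreover have "trig_bounded 1 (\<bar>1 / 2\<bar> + \<bar>- 1 / 2\<bar> * 1) (\<lambda>x. 1 / 2 + (- 1 / 2) * cos (2 * pi * of_int 1 * x))"
    by (intro trig_bounded_add trig_bounded_const trig_bounded_scale trig_bounded_cos_sin) simp
  ultimately show ?thesis by simp
qed

lemma trig_bounded_sin_sq_mult:
  assumes "trig_bounded M B k" "0 \<le> B" "0 \<le> a"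
  shows "trig_bounded (Suc M) (a * B) (\<lambda>x. a * ((sin (pi * x))\<^sup>2 * k x))"
  using trig_bounded_scale[OF trig_bounded_mult[OF trig_bounded_sin_sq assms(1,2)], of a] assms(3) by simp

text \<open>The bare well repels with twice the required strength. The bump has a minimum at every
  integer, so its derivative vanishes there, and \<open>small\<close> bounds its second derivative
  by 1 / r^2; it can destroy at most half of the repulsion.\<close>

lemma periodic_well_bump:
  fixes r :: nat
  defines "S \<equiv> \<lambda>a k x. (sin (pi * x))\<^sup>2 * (2 / (real r)\<^sup>2 + a * k x)"
  assumes r: "r \<ge> 1" and k: "trig_bounded M B k" "\<And>x. 0 \<le> k x" and "0 \<le> B" "0 \<le> a"
    and small: "(2 * pi * real (Suc M))\<^sup>2 * (a * B) \<le> 1 / (real r)\<^sup>2"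
  shows "periodic_well (S a k) (deriv (S a k)) r"
proof -
  define u where "u x = 2 / (real r)\<^sup>2 * (sin (pi * x))\<^sup>2" for x :: real
  define V where "V x = a * ((sin (pi * x))\<^sup>2 * k x)" for x
  have S: "S a k = (\<lambda>x. u x + V x)" by (simp add: S_def u_def V_def algebra_simps)
  have V: "trig_bounded (Suc M) (a * B) V"
    unfolding V_def by (rule trig_bounded_sin_sq_mult) (use assms in auto)
  have u: "trig_bounded 1 (2 / (real r)\<^sup>2) u"
    unfolding u_def using trig_bounded_scale[OF trig_bounded_sin_sq, of "2 / (real r)\<^sup>2"] by simp
  have "trig_bounded (Suc M) (2 / (real r)\<^sup>2 + a * B) (S a k)"
    unfolding S by (intro trig_bounded_add V trig_bounded_degree_mono[OF u]) simp
  note St = trig_bounded_deriv[OF this] and Vt = trig_bounded_deriv[OF V] and ut = trig_bounded_deriv[OF u]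
  have V0: "0 \<le> V x" for x using assms by (simp add: V_def)
  have aB: "a * B \<le> 1 / (real r)\<^sup>2"
  proof -
    have "1 \<le> 2 * pi * real (Suc M)" using pi_gt3 by (intro mult_ge1_I) auto
    then have "1 \<le> (2 * pi * real (Suc M))\<^sup>2" by (rule one_le_power)
    then have "1 * (a * B) \<le> (2 * pi * real (Suc M))\<^sup>2 * (a * B)" using assms by (intro mult_right_mono) auto
    then show ?thesis using small by simp
  qed
  have sinm: "sin (pi * of_int m) = 0" for m by (simp add: mult.commute)
  show ?thesis
  proof
    show "r \<ge> 1" by (rule r)
    show "(S a k has_real_derivative deriv (S a k) x) (at x)" for x by (rule St(1))
    show "deriv (S a k) (x + 1) = deriv (S a k) x" for x by (rule trig_bounded_deriv(3)[OF St(2)])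
    show "0 \<le> S a k x" for x unfolding S using V0[of x] by (simp add: u_def)
    show "S a k x \<le> 3 / (real r)\<^sup>2" for x
    proof -
      have "u x \<le> 2 / (real r)\<^sup>2" using trig_bounded_abs_le[OF u, of x] by simp
      moreover have "V x \<le> 1 / (real r)\<^sup>2" using trig_bounded_abs_le[OF V, of x] aB by simp
      moreover have "2 / (real r)\<^sup>2 + 1 / (real r)\<^sup>2 = 3 / (real r)\<^sup>2" by (simp add: add_divide_distrib[symmetric])
      ultimately show ?thesis unfolding S by linarith
    qed
    show "S a k (of_int m) = 0" for m by (simp add: S_def sinm)
    show "1 / (real r)\<^sup>2 \<le> S a k x" if "of_int m + 1 / 4 \<le> x" "x \<le> of_int m + 3 / 4" for m x
    proof -
      have "2 / (real r)\<^sup>2 * (1 / 2) \<le> u x"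
        unfolding u_def by (intro mult_left_mono sin_pi_sq_ge_half[OF that]) auto
      then show ?thesis using V0[of x] by (simp add: S)
    qed
    show "e\<^sup>2 / (real r)\<^sup>2 \<le> e * deriv (S a k) (of_int m + e)" if e: "\<bar>e\<bar> \<le> 1 / 4" for e m
    proof -
      let ?x = "of_int m + e"
      have dS: "deriv (S a k) ?x = deriv u ?x + deriv V ?x"
        unfolding S by (intro DERIV_imp_deriv DERIV_add ut(1) Vt(1))
      have du: "deriv u ?x = 2 * pi / (real r)\<^sup>2 * sin (2 * pi * e)"
      proof -
        have "((\<lambda>x. C * (sin (pi * x))\<^sup>2) has_real_derivative C * (2 * sin (pi * x) * (cos (pi * x) * pi))) (at x)" for C x
          by (auto intro!: derivative_eq_intros)
        then have "deriv u ?x = 2 / (real r)\<^sup>2 * (2 * sin (pi * ?x) * (cos (pi * ?x) * pi))"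
          unfolding u_def by (intro DERIV_imp_deriv)
        also have "\<dots> = 2 * pi / (real r)\<^sup>2 * sin (2 * (pi * ?x))" unfolding sin_double by simp
        also have "2 * (pi * ?x) = 2 * pi * e + 2 * pi * of_int m" by (simp add: algebra_simps)
        also have "sin (2 * pi * e + 2 * pi * of_int m) = sin (2 * pi * e)" unfolding sin_add by simp
        finally show ?thesis .
      qed
      have "4 * \<bar>e\<bar> \<le> sin (2 * pi * \<bar>e\<bar>)"
        using sin_pi_ge[of "2 * \<bar>e\<bar>"] e by (simp add: mult.left_commute mult.assoc)
      then have "4 * \<bar>e\<bar> * \<bar>e\<bar> \<le> sin (2 * pi * \<bar>e\<bar>) * \<bar>e\<bar>" by (intro mult_right_mono) auto
      then have "4 * e\<^sup>2 \<le> e * sin (2 * pi * e)"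
        by (cases "0 \<le> e") (simp_all add: power2_eq_square mult.commute)
      then have "2 * pi / (real r)\<^sup>2 * (4 * e\<^sup>2) \<le> 2 * pi / (real r)\<^sup>2 * (e * sin (2 * pi * e))"
        by (intro mult_left_mono) auto
      moreover have "2 * (e\<^sup>2 / (real r)\<^sup>2) \<le> 2 * pi / (real r)\<^sup>2 * (4 * e\<^sup>2)"
      proof -
        have "2 * (e\<^sup>2 / (real r)\<^sup>2) \<le> 8 * pi * (e\<^sup>2 / (real r)\<^sup>2)" using pi_gt3 by (intro mult_right_mono) auto
        then show ?thesis by simp
      qed
      ultimately have 1: "2 * (e\<^sup>2 / (real r)\<^sup>2) \<le> e * deriv u ?x" unfolding du by (simp add: mult.left_commute)
      have "deriv V (of_int m) = 0"
      proof (rule DERIV_local_min[OF Vt(1), of 1])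
        show "\<forall>y. \<bar>of_int m - y\<bar> < 1 \<longrightarrow> V (of_int m) \<le> V y" using V0 by (simp add: V_def sinm)
      qed simp
      moreover have "norm (deriv V ?x - deriv V (of_int m)) \<le> 1 / (real r)\<^sup>2 * norm (?x - of_int m)"
      proof (rule field_differentiable_bound[of UNIV])
        show "(deriv V has_real_derivative deriv (deriv V) z) (at z within UNIV)" for z
          using trig_bounded_deriv(1)[OF Vt(2)] by simp
        show "norm (deriv (deriv V) z) \<le> 1 / (real r)\<^sup>2" for z
          using trig_bounded_abs_le[OF trig_bounded_deriv(2)[OF Vt(2)], of z] small
          by (simp add: power2_eq_square mult.assoc)
      qed auto
      ultimately have "\<bar>deriv V ?x\<bar> \<le> 1 / (real r)\<^sup>2 * \<bar>e\<bar>" by simp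
      then have "\<bar>e\<bar> * \<bar>deriv V ?x\<bar> \<le> \<bar>e\<bar> * (1 / (real r)\<^sup>2 * \<bar>e\<bar>)" by (intro mult_left_mono) auto
      then have "\<bar>e * deriv V ?x\<bar> \<le> e\<^sup>2 / (real r)\<^sup>2" by (simp add: abs_mult power2_eq_square)
      then show ?thesis using 1 unfolding dS distrib_left by linarith
    qed
  qed
qed

text \<open>The powers of s make the kernel small outside the gap: there \<open>fejer n\<close> is
  at most (10 r / n)^2 = 1 / (4 s^2), whose fourth power is 1 / (256 r). The constant
  \<open>10 ^ 6\<close> in \<open>a\<close> exceeds 72^2 * 32 = 165888, which comes from two
  derivatives of a bump of degree at most 9 n and Wiener norm 32 a.\<close>

lemma destroying_trig_poly:
  fixes s \<tau> n r :: nat and q p :: int and a \<omega> :: real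
  defines "r \<equiv> s ^ 8" and "n \<equiv> 20 * s ^ 9" and "a \<equiv> 1 / (10 ^ 6 * (real n)\<^sup>2 * (real r)\<^sup>2)"
  assumes s: "s \<ge> 1" and \<tau>: "10 * r + 1 < \<tau>"
    and small: "80 * (1 / 2 / (1 + 1 / real r) ^ (\<tau> - 10 * r - 1)) < a"
    and q: "q \<noteq> 0" and pos: "0 < of_int q * \<omega> - of_int p"
    and slow: "real (2 * \<tau>) * (of_int q * \<omega> - of_int p) < 1"
  shows "\<exists>A B. \<not> has_invariant_circle_freq
        (twist_map (\<lambda>x x'. (x - x')\<^sup>2 / 2 + trig_poly (Suc (8 * n) * nat \<bar>q\<bar>) A B x')) \<omega> \<and>
      (\<forall>j x. j \<le> 2 \<longrightarrow> \<bar>(deriv ^^ j) (trig_poly (Suc (8 * n) * nat \<bar>q\<bar>) A B) x\<bar>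
          \<le> 129 * real (nat \<bar>q\<bar>) ^ j / ((real (nat \<bar>q\<bar>))\<^sup>2 * (real r)\<^sup>2))"
proof -
  have r: "r \<ge> 1" and n: "n \<ge> 20" using s by (auto simp: r_def n_def)
  have a: "a > 0" using r n by (simp add: a_def)
  define K where "K c x = (fejer n (x - c)) ^ 4" for c x
  define S where "S = (\<lambda>c x. (sin (pi * x))\<^sup>2 * (2 / (real r)\<^sup>2 + a * K c x))"
  have Kt: "trig_bounded (8 * n) 32 (K c)" for c
  proof -
    have f: "trig_bounded (2 * n) 2 (fejer n)" using n by (intro trig_bounded_fejer) simp
    have "trig_bounded (2 * n + (2 * n + (2 * n + 2 * n))) (2 * (2 * (2 * 2)))
      (\<lambda>x. fejer n x * (fejer n x * (fejer n x * fejer n x)))"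
      by (intro trig_bounded_mult f) auto
    moreover have "2 * n + (2 * n + (2 * n + 2 * n)) = 8 * n" "2 * (2 * (2 * 2)) = (16 :: real)" by simp_all
    moreover have "(\<lambda>x. fejer n x * (fejer n x * (fejer n x * fejer n x))) = (\<lambda>x. (fejer n x) ^ 4)"
      by (simp add: eval_nat_numeral)
    ultimately have "trig_bounded (8 * n) 16 (\<lambda>x. (fejer n x) ^ 4)" by (simp only:)
    from trig_bounded_shift[OF this, of c] show ?thesis by (simp add: K_def[abs_def])
  qed
  have bump: "(2 * pi * real (Suc (8 * n)))\<^sup>2 * (a * 32) \<le> 1 / (real r)\<^sup>2"
  proof -
    have "2 * pi * real (Suc (8 * n)) \<le> 8 * (9 * real n)"
      using pi_less_4 n by (intro mult_mono) auto
    then have "(2 * pi * real (Suc (8 * n)))\<^sup>2 \<le> (72 * real n)\<^sup>2" by (intro power_mono) auto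
    then have "(2 * pi * real (Suc (8 * n)))\<^sup>2 * (a * 32) \<le> (72 * real n)\<^sup>2 * (a * 32)"
      using a by (intro mult_right_mono) auto
    also have "\<dots> = 165888 / 10 ^ 6 * (1 / (real r)\<^sup>2)"
      using n r by (simp add: a_def power_mult_distrib)
    also have "\<dots> \<le> 1 * (1 / (real r)\<^sup>2)" by (intro mult_right_mono) auto
    finally show ?thesis by simp
  qed
  have "\<exists>c. \<forall>x. x (2 * \<tau>) = c \<and> x (2 * \<tau>) < x 0 + 1 \<and> x (4 * \<tau>) < c + 1 \<longrightarrow>
      \<not> minimizing_orbit (\<lambda>x. (sin (pi * x))\<^sup>2 * (2 / (real r)\<^sup>2 + a * K c x)) (deriv (S c)) x"
  proof (rule no_slow_minimizing_orbit[where \<kappa> = "1 / (256 * real r)"])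
    show "periodic_well (\<lambda>x. (sin (pi * x))\<^sup>2 * (2 / (real r)\<^sup>2 + a * K c x)) (deriv (S c)) r" for c
      unfolding S_def using a r bump
      by (intro periodic_well_bump[OF _ Kt[of c]]) (auto simp: K_def fejer_nonneg)
    show "0 \<le> K c x" for c x by (simp add: K_def fejer_nonneg)
    show "K c c = 1" for c using n by (simp add: K_def fejer_0)
    show "K c x \<le> 1 / (256 * real r)"
      if far: "(1 / (2 * real (Suc (4 * r))))\<^sup>2 \<le> (sin (pi * (x - c)))\<^sup>2" for c x
    proof -
      have "(1 / (10 * real r))\<^sup>2 \<le> (1 / (2 * real (Suc (4 * r))))\<^sup>2"
        using r by (intro power_mono divide_left_mono) auto
      from this far have "(1 / (10 * real r))\<^sup>2 \<le> (sin (pi * (x - c)))\<^sup>2" by (rule order_trans)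
      then have "fejer n (x - c) * (1 / (10 * real r))\<^sup>2 \<le> fejer n (x - c) * (sin (pi * (x - c)))\<^sup>2"
        by (rule mult_left_mono[OF _ fejer_nonneg])
      also have "\<dots> \<le> 1 / (real n)\<^sup>2" using n by (intro fejer_decay) simp
      finally have "fejer n (x - c) \<le> 1 / (real n)\<^sup>2 * (10 * real r)\<^sup>2"
        using r by (simp add: power_divide pos_divide_le_eq)
      also have "\<dots> = 1 / (4 * (real s)\<^sup>2)"
      proof -
        have "(real n)\<^sup>2 = 400 * (real r)\<^sup>2 * (real s)\<^sup>2" by (simp add: n_def r_def power_mult_distrib eval_nat_numeral)
        then show ?thesis using r by (simp add: power_mult_distrib)
      qed
      finally have "K c x \<le> (1 / (4 * (real s)\<^sup>2)) ^ 4"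
        unfolding K_def by (intro power_mono fejer_nonneg)
      also have "\<dots> = 1 / (256 * real r)" by (simp add: r_def power_divide power_mult_distrib flip: power_mult)
      finally show ?thesis .
    qed
    show "16 * real r * (1 / (256 * real r)) \<le> 1" using r by simp
    show "0 < a" by (rule a)
    show "a \<le> 1 / real r"
    proof -
      have "1 * 1 * real r \<le> 10 ^ 6 * (real n)\<^sup>2 * (real r)\<^sup>2"
        using r n by (intro mult_mono self_le_power one_le_power) auto
      then show ?thesis unfolding a_def using r by (intro divide_left_mono) auto
    qed
  qed (use \<tau> small in auto)
  then obtain c where c: "\<And>x. x (2 * \<tau>) = c \<Longrightarrow> x (2 * \<tau>) < x 0 + 1 \<Longrightarrow> x (4 * \<tau>) < c + 1 \<Longrightarrow>
      \<not> minimizing_orbit (S c) (deriv (S c)) x"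
    unfolding S_def by blast
  define Q where "Q = nat \<bar>q\<bar>"
  have Q: "real Q > 0" "(of_int q)\<^sup>2 = (real Q)\<^sup>2" "real Q = \<bar>of_int q\<bar>" using q by (auto simp: Q_def)
  define N where "N = Suc (8 * n) * Q"
  define u where "u x = 2 / (real r)\<^sup>2 * (sin (pi * x))\<^sup>2" for x :: real
  define V where "V x = a * ((sin (pi * x))\<^sup>2 * K c x)" for x
  have S_uV: "S c = (\<lambda>x. u x + V x)" by (simp add: S_def u_def V_def algebra_simps)
  have Vt: "trig_bounded (Suc (8 * n)) (a * 32) V"
    unfolding V_def by (rule trig_bounded_sin_sq_mult[OF Kt]) (use a in auto)
  have ut: "trig_bounded 1 (2 / (real r)\<^sup>2) u"
    unfolding u_def using trig_bounded_scale[OF trig_bounded_sin_sq, of "2 / (real r)\<^sup>2"] by simp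
  have St: "trig_bounded (Suc (8 * n)) (2 / (real r)\<^sup>2 + a * 32) (S c)"
    unfolding S_uV by (intro trig_bounded_add Vt trig_bounded_degree_mono[OF ut]) simp
  define R where "R x = S c (of_int q * x) / (of_int q)\<^sup>2" for x
  have scaled: "trig_bounded (D * Q) (E / (real Q)\<^sup>2) (\<lambda>x. f (of_int q * x) / (of_int q)\<^sup>2)"
    if "trig_bounded D E f" for D E f
    using trig_bounded_scale[OF trig_bounded_dilate[OF that, of q], of "1 / (real Q)\<^sup>2"]
    unfolding Q(2) by (simp flip: Q_def)
  have Rt: "trig_bounded N ((2 / (real r)\<^sup>2 + a * 32) / (real Q)\<^sup>2) R"
    unfolding R_def N_def by (rule scaled[OF St])
  then obtain A B where AB: "R = trig_poly N A B" unfolding trig_bounded_def by blast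
  have circle: "\<not> has_invariant_circle_freq (twist_map (\<lambda>x x'. (x - x')\<^sup>2 / 2 + R x')) \<omega>"
  proof
    assume circ: "has_invariant_circle_freq (twist_map (\<lambda>x x'. (x - x')\<^sup>2 / 2 + R x')) \<omega>"
    define R' where "R' x = deriv (S c) (of_int q * x) / of_int q" for x
    have Rd: "(R has_real_derivative R' x) (at x)" for x
    proof -
      have "((\<lambda>x. S c (of_int q * x)) has_real_derivative deriv (S c) (of_int q * x) * of_int q) (at x)"
        by (rule DERIV_chain'[OF _ trig_bounded_deriv(1)[OF St]]) (auto intro!: derivative_eq_intros)
      from DERIV_cdivide[OF this, of "(of_int q)\<^sup>2"] show ?thesis
        using q by (simp add: R_def[abs_def] R'_def power2_eq_square)
    qed
    have "isCont (deriv (S c)) x" for x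
      by (rule DERIV_isCont[OF trig_bounded_deriv(1)[OF trig_bounded_deriv(2)[OF St]]])
    then have c1: "isCont (\<lambda>x. deriv (S c) (of_int q * x)) x" for x
      by (rule isCont_o2[rotated]) (intro continuous_intros)
    have R'c: "continuous_on UNIV R'"
    proof (rule continuous_at_imp_continuous_on, rule ballI)
      show "isCont R' x" for x
        unfolding R'_def[abs_def] by (rule isCont_divide[OF c1]) (use q in auto)
    qed
    obtain g where "invariant_graph R' \<omega> g"
      using graph_of_invariant_circle[OF Rd trig_bounded_deriv(3)[OF Rt] R'c circ] by blast
    then have "invariant_graph (\<lambda>x. deriv (S c) (of_int q * x) / of_int q) \<omega> g" by (simp add: R'_def[abs_def])
    from minimizing_orbit_rescaled[OF this q pos trig_bounded_deriv(1)[OF St] trig_bounded_deriv(3)[OF St]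
        trig_bounded_deriv(3)[OF trig_bounded_deriv(2)[OF St]], of "2 * \<tau>" c]
    obtain X where X: "minimizing_orbit (S c) (deriv (S c)) X" "X (2 * \<tau>) = c"
      "\<And>i. X (i + 2 * \<tau>) < X i + 1" using slow by blast
    show False using c[of X] X X(3)[of 0] X(3)[of "2 * \<tau>"] by simp
  qed
  \<comment> \<open>The two parts are estimated separately, for the bound would be too large if the
    full degree \<open>N\<close> were charged to the well. The well has degree \<open>Q\<close> and
    contributes 128 = 2 * 8^2; the bump has degree \<open>N\<close> but \<open>a\<close> is so small
    that it contributes only 1.\<close>
  have norm: "\<bar>(deriv ^^ j) R x\<bar> \<le> 129 * real Q ^ j / ((real Q)\<^sup>2 * (real r)\<^sup>2)" if j: "j \<le> 2" for j x
  proof -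
    define f where "f x = u (of_int q * x) / (of_int q)\<^sup>2" for x
    define h where "h x = V (of_int q * x) / (of_int q)\<^sup>2" for x
    have fh: "trig_bounded Q (2 / (real r)\<^sup>2 / (real Q)\<^sup>2) f" "trig_bounded N (a * 32 / (real Q)\<^sup>2) h"
      using scaled[OF ut] scaled[OF Vt] by (simp_all add: f_def[abs_def] h_def[abs_def] N_def)
    have pw: "(y :: real) ^ j \<le> y\<^sup>2" if "1 \<le> y" for y using power_increasing[OF j that] .
    have "\<bar>(deriv ^^ j) f x\<bar> \<le> (2 * pi * real Q) ^ j * (2 / (real r)\<^sup>2 / (real Q)\<^sup>2)"
      by (rule trig_bounded_abs_le[OF trig_bounded_funpow_deriv[OF fh(1)]])
    also have "\<dots> = (2 * pi) ^ j * 2 * (real Q ^ j / ((real Q)\<^sup>2 * (real r)\<^sup>2))" by (simp add: power_mult_distrib ac_simps)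
    also have "\<dots> \<le> 8\<^sup>2 * 2 * (real Q ^ j / ((real Q)\<^sup>2 * (real r)\<^sup>2))"
    proof -
      have "(2 * pi) ^ j \<le> (2 * pi)\<^sup>2" using pi_gt3 by (intro pw) simp
      also have "\<dots> \<le> 8\<^sup>2" using pi_less_4 by (intro power_mono) auto
      finally show ?thesis by (intro mult_right_mono) auto
    qed
    finally have 1: "\<bar>(deriv ^^ j) f x\<bar> \<le> 128 * (real Q ^ j / ((real Q)\<^sup>2 * (real r)\<^sup>2))" by simp
    have "\<bar>(deriv ^^ j) h x\<bar> \<le> (2 * pi * real N) ^ j * (a * 32 / (real Q)\<^sup>2)"
      by (rule trig_bounded_abs_le[OF trig_bounded_funpow_deriv[OF fh(2)]])
    also have "\<dots> = (2 * pi * real (Suc (8 * n))) ^ j * (a * 32) * (real Q ^ j / (real Q)\<^sup>2)"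
      by (simp add: N_def power_mult_distrib del: of_nat_Suc mult_Suc)
    also have "\<dots> \<le> 1 / (real r)\<^sup>2 * (real Q ^ j / (real Q)\<^sup>2)"
    proof -
      have "1 \<le> 2 * pi * real (Suc (8 * n))" using pi_gt3 by (intro mult_ge1_I) auto
      then have "(2 * pi * real (Suc (8 * n))) ^ j * (a * 32) \<le> (2 * pi * real (Suc (8 * n)))\<^sup>2 * (a * 32)"
        using a by (intro mult_right_mono pw) auto
      also have "\<dots> \<le> 1 / (real r)\<^sup>2" by (rule bump)
      finally show ?thesis by (intro mult_right_mono) auto
    qed
    finally have 2: "\<bar>(deriv ^^ j) h x\<bar> \<le> real Q ^ j / ((real Q)\<^sup>2 * (real r)\<^sup>2)" by (simp add: mult.commute)
    have "R = (\<lambda>x. f x + h x)" by (simp add: fun_eq_iff R_def S_uV f_def h_def add_divide_distrib)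
    then have "(deriv ^^ j) R x = (deriv ^^ j) f x + (deriv ^^ j) h x"
      using funpow_deriv_add_trig[OF fh, of j] by simp
    then have "\<bar>(deriv ^^ j) R x\<bar> \<le> 129 * (real Q ^ j / ((real Q)\<^sup>2 * (real r)\<^sup>2))" using 1 2 by linarith
    then show ?thesis by simp
  qed
  show ?thesis
    using circle norm unfolding AB N_def Q_def by blast
qed

section \<open>Diophantine input and choice of parameters\<close>

text \<open>Dirichlet's theorem provides k \<le> Q with error below 1 / Q. Apart from finitely many
  k the error is at least k powr (-1 - \<mu>), so k cannot be much smaller than Q. Changing the sign
  of k makes the error positive.\<close>

lemma badly_approximable_denominators:
  assumes bad: "badly_approximable \<omega>" and \<mu>: "\<mu> > 0"
  shows "\<exists>Q0. \<forall>Q\<ge>Q0. \<exists>q p :: int. q \<noteq> 0 \<and> 0 < of_int q * \<omega> - of_int p \<and>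
    of_int q * \<omega> - of_int p < 1 / real Q \<and> nat \<bar>q\<bar> \<le> Q \<and> real Q \<le> real (nat \<bar>q\<bar>) powr (1 + \<mu>)"
proof -
  have irr: "\<omega> \<notin> \<rat>" using bad by (simp add: badly_approximable_def)
  have nz: "of_int k * \<omega> - of_int h \<noteq> 0" if "k \<noteq> 0" for k h :: int
  proof
    assume "of_int k * \<omega> - of_int h = 0"
    then have "\<omega> = of_int h / of_int k" using that by (simp add: field_simps)
    then show False using irr by simp
  qed
  define A where "A = {q::nat. q > 0 \<and> (\<exists>p::int. \<bar>real q * \<omega> - of_int p\<bar> < real q powr (-1 - \<mu>))}"
  have "finite A" using bad \<mu> by (simp add: A_def badly_approximable_def mu_well_approximable_def)
  then have "\<exists>m. \<forall>q\<in>A. q < m" unfolding finite_nat_set_iff_bounded .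
  then obtain q1 where q1: "\<And>q. q \<in> A \<Longrightarrow> q < q1" by blast
  \<comment> \<open>The errors of the possibly exceptional small denominators; all are positive by
    irrationality, so for 1 / Q below their minimum Dirichlet's theorem cannot return such a
    denominator.\<close>
  define D where "D = insert 1 ((\<lambda>q::nat. \<bar>real q * \<omega> - of_int (round (real q * \<omega>))\<bar>) ` {1..<q1})"
  have "0 < Min D"
  proof -
    have "0 < d" if "d \<in> D" for d
      using that nz[of "int q" "round (real q * \<omega>)" for q] by (auto simp: D_def)
    then show ?thesis by (subst Min_gr_iff) (auto simp: D_def)
  qed
  then obtain Q0 :: nat where Q0: "Q0 > 0" "1 / real Q0 < Min D"
    using real_arch_inverse[of "Min D"] by (auto simp: inverse_eq_divide)
  show ?thesis
  proof (intro exI[of _ Q0] allI impI)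
    fix Q assume Q: "Q0 \<le> Q"
    obtain h k where hk: "0 < k" "k \<le> int Q" "\<bar>of_int k * \<omega> - of_int h\<bar> < 1 / real Q"
      by (rule Dirichlet_approx[of Q \<omega>]) (use Q Q0 in auto)
    define q where "q = nat k"
    have q: "q > 0" "of_int k = real q" "q \<le> Q" using hk by (auto simp: q_def)
    have "q1 \<le> q"
    proof (rule ccontr)
      assume "\<not> ?thesis"
      then have "Min D \<le> \<bar>real q * \<omega> - of_int (round (real q * \<omega>))\<bar>"
        using q by (intro Min_le) (auto simp: D_def)
      also have "\<dots> \<le> \<bar>real q * \<omega> - of_int h\<bar>" by (rule round_diff_minimal)
      also have "\<dots> < 1 / real Q" using hk q by simp
      also have "\<dots> \<le> 1 / real Q0" using Q Q0 by (simp add: frac_le)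
      finally show False using Q0 by simp
    qed
    then have "q \<notin> A" using q1[of q] by auto
    then have "real q powr (-1 - \<mu>) \<le> \<bar>real q * \<omega> - of_int h\<bar>"
      using q(1) by (auto simp: A_def not_less)
    also have "\<dots> < 1 / real Q" using hk q by simp
    finally have "1 / real q powr (1 + \<mu>) < 1 / real Q" by (simp add: powr_minus_divide[symmetric])
    moreover have "1 / real Q \<le> 1 / real q powr (1 + \<mu>)" if "real q powr (1 + \<mu>) < real Q"
      using that q by (intro frac_le) auto
    ultimately have Qq: "real Q \<le> real q powr (1 + \<mu>)" by linarith
    have kq: "nat \<bar>k\<bar> = q" "nat \<bar>- k\<bar> = q" using hk(1) by (auto simp: q_def)
    show "\<exists>q p :: int. q \<noteq> 0 \<and> 0 < of_int q * \<omega> - of_int p \<and>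
      of_int q * \<omega> - of_int p < 1 / real Q \<and> nat \<bar>q\<bar> \<le> Q \<and> real Q \<le> real (nat \<bar>q\<bar>) powr (1 + \<mu>)"
    proof (cases "0 < of_int k * \<omega> - of_int h")
      case True
      moreover from this hk(3) have "of_int k * \<omega> - of_int h < 1 / real Q" by linarith
      ultimately show ?thesis using hk(1) kq q(3) Qq by (intro exI[of _ k] exI[of _ h] conjI) simp_all
    next
      case False
      moreover have "of_int k * \<omega> - of_int h \<noteq> 0" using hk(1) by (intro nz) simp
      ultimately have "0 < of_int (- k) * \<omega> - of_int (- h)" "of_int (- k) * \<omega> - of_int (- h) < 1 / real Q"
        using hk(3) unfolding of_int_minus by linarith+
      then show ?thesis using hk(1) kq q(3) Qq by (intro exI[of _ "- k"] exI[of _ "- h"] conjI) simp_all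
    qed
  qed
qed

text \<open>With r at most 256 q^(3/4) and about q / 4 steps left, (1 + 1 / r)^k is at least
  exp(q^(1/4) / 2048), using exp(x / 2) \<le> 1 + x on [0, 1]. The bump height is only polynomially
  small, with 34 = 2 * 9 + 2 * 8 powers of s.\<close>

lemma parameters_eventually:
  fixes s :: "nat \<Rightarrow> nat"
  defines "s \<equiv> \<lambda>q. nat \<lceil>real q powr (3 / 32)\<rceil>"
  shows "eventually (\<lambda>q. 1 \<le> s q \<and> real q powr (3 / 32) \<le> real (s q) \<and> real (s q) \<le> 2 * real q powr (3 / 32) \<and>
    10 * s q ^ 8 + 1 < (q - 1) div 2 \<and>
    80 * (1 / 2 / (1 + 1 / real (s q ^ 8)) ^ ((q - 1) div 2 - 10 * s q ^ 8 - 1))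
      < 1 / (10 ^ 6 * (real (20 * s q ^ 9))\<^sup>2 * (real (s q ^ 8))\<^sup>2)) sequentially"
proof -
  have A: "eventually (\<lambda>t::real. 1 \<le> t \<and> 10 * (256 * t powr (3 / 4)) + 2 < t / 2 - 1 \<and>
      t / 4 \<le> t / 2 - 3 - 10 * (256 * t powr (3 / 4)) \<and>
      40 * exp (- (t powr (1 / 4) / 2048)) < 1 / (4 * 10 ^ 8 * (2 ^ 34 * t ^ 4))) at_top"
    by (intro eventually_conj eventually_ge_at_top; real_asymp)
  have "eventually (\<lambda>q. 1 \<le> real q \<and> 10 * (256 * real q powr (3 / 4)) + 2 < real q / 2 - 1 \<and>
      real q / 4 \<le> real q / 2 - 3 - 10 * (256 * real q powr (3 / 4)) \<and>
      40 * exp (- (real q powr (1 / 4) / 2048)) < 1 / (4 * 10 ^ 8 * (2 ^ 34 * real q ^ 4))) sequentially"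
    by (rule eventually_compose_filterlim[OF A filterlim_real_sequentially])
  then show ?thesis
  proof eventually_elim
    case (elim q)
    define t where "t = real q"
    have t: "1 \<le> t" "10 * (256 * t powr (3 / 4)) + 2 < t / 2 - 1"
      "t / 4 \<le> t / 2 - 3 - 10 * (256 * t powr (3 / 4))"
      "40 * exp (- (t powr (1 / 4) / 2048)) < 1 / (4 * 10 ^ 8 * (2 ^ 34 * t ^ 4))"
      using elim by (auto simp: t_def)
    have one: "1 \<le> t powr (3 / 32)" using t by (intro ge_one_powr_ge_zero) auto
    have s1: "t powr (3 / 32) \<le> real (s q)" unfolding s_def t_def by linarith
    have "real (s q) \<le> t powr (3 / 32) + 1" unfolding s_def t_def using one by (simp add: t_def)
    then have s2: "real (s q) \<le> 2 * t powr (3 / 32)" using one by linarith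
    have s0: "1 \<le> s q" using s1 one by linarith
    define r where "r = s q ^ 8"
    have r1: "1 \<le> r" using s0 by (simp add: r_def)
    have "real r \<le> (2 * t powr (3 / 32)) ^ 8" unfolding r_def of_nat_power by (intro power_mono s2) auto
    also have "\<dots> = 256 * t powr (3 / 4)" using t by (simp add: power_mult_distrib powr_power)
    finally have r2: "real r \<le> 256 * t powr (3 / 4)" .
    define \<tau> where "\<tau> = (q - 1) div 2"
    have "q \<le> 2 * \<tau> + 2" unfolding \<tau>_def by linarith
    then have \<tau>: "t / 2 - 1 \<le> real \<tau>" unfolding t_def by linarith
    have "real (10 * r + 1) < real \<tau>" using r2 t(2) \<tau> by simp
    then have \<tau>r: "10 * r + 1 < \<tau>" by (simp only: of_nat_less_iff)
    define k where "k = \<tau> - 10 * r - 1"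
    have "real k = real \<tau> - 10 * real r - 1" using \<tau>r by (simp add: k_def)
    then have k: "t / 4 \<le> real k" using r2 t(3) \<tau> by linarith
    have e: "exp (x / 2) \<le> 1 + x" if "0 \<le> x" "x \<le> 1" for x :: real
    proof -
      have "exp (x / 2) \<le> 1 + x / 2 + (x / 2)\<^sup>2" using that by (intro exp_bound) auto
      also have "(x / 2)\<^sup>2 \<le> x / 2"
        using mult_left_le[of "x / 2" "x / 2"] that by (simp add: power2_eq_square)
      finally show ?thesis by simp
    qed
    have "t powr (1 / 4) / 2048 \<le> real k * (1 / real r / 2)"
    proof -
      have "t powr (1 / 4) * t powr (3 / 4) = t" using t powr_add[of t "1 / 4" "3 / 4"] by simp
      then have "t powr (1 / 4) = t / t powr (3 / 4)" using t(1) by (simp add: eq_divide_eq)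
      then have "t powr (1 / 4) / 2048 = (t / 4) * (1 / (256 * t powr (3 / 4)) / 2)" by simp
      also have "\<dots> \<le> real k * (1 / real r / 2)"
        using k r1 r2 t(1) by (intro mult_mono divide_right_mono divide_left_mono) auto
      finally show ?thesis .
    qed
    then have "exp (t powr (1 / 4) / 2048) \<le> exp (real k * (1 / real r / 2))" by simp
    also have "\<dots> = exp (1 / real r / 2) ^ k" by (rule exp_of_nat_mult)
    also have "\<dots> \<le> (1 + 1 / real r) ^ k" using r1 by (intro power_mono e) auto
    finally have big: "exp (t powr (1 / 4) / 2048) \<le> (1 + 1 / real r) ^ k" .
    have "80 * (1 / 2 / (1 + 1 / real r) ^ k) = 40 / (1 + 1 / real r) ^ k" by simp
    also have "\<dots> \<le> 40 / exp (t powr (1 / 4) / 2048)"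
      using big by (intro divide_left_mono) (auto intro!: mult_pos_pos zero_less_power add_pos_nonneg)
    also have "\<dots> = 40 * exp (- (t powr (1 / 4) / 2048))" by (simp add: exp_minus field_simps)
    also have "\<dots> < 1 / (4 * 10 ^ 8 * (2 ^ 34 * t ^ 4))" by (rule t(4))
    also have "\<dots> \<le> 1 / (4 * 10 ^ 8 * real (s q) ^ 34)"
    proof -
      have "real (s q) ^ 34 \<le> (2 * t powr (3 / 32)) ^ 34" by (intro power_mono s2) auto
      also have "\<dots> = 2 ^ 34 * t powr (102 / 32)" using t by (simp add: power_mult_distrib powr_power)
      also have "\<dots> \<le> 2 ^ 34 * t powr 4" using t by (intro mult_left_mono powr_mono) auto
      also have "t powr 4 = t ^ 4" using t by (simp add: powr_numeral)
      finally show ?thesis using s0 t(1) by (intro divide_left_mono mult_left_mono) auto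
    qed
    also have "4 * 10 ^ 8 * real (s q) ^ 34 = 10 ^ 6 * (real (20 * s q ^ 9))\<^sup>2 * (real (s q ^ 8))\<^sup>2"
      by (simp add: power_mult_distrib flip: power_mult power_add)
    finally have "80 * (1 / 2 / (1 + 1 / real r) ^ k) < 1 / (10 ^ 6 * (real (20 * s q ^ 9))\<^sup>2 * (real (s q ^ 8))\<^sup>2)" .
    then show ?case using s0 s1 s2 \<tau>r unfolding t_def k_def \<tau>_def r_def by simp
  qed
qed

text \<open>On an invariant graph \<open>2 * x + R' x\<close> is the sum of the increasing functions
  \<open>g\<close> and \<open>inv g\<close>, so its derivative \<open>2 + D\<close> cannot be
  negative.\<close>

lemma invariant_graph_derivative_ge:
  assumes ig: "invariant_graph R' \<omega> g" and R': "(R' has_real_derivative D) (at z)"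
  shows "-2 \<le> D"
proof (rule ccontr)
  note g = invariant_graphD[OF ig]
  assume "\<not> ?thesis"
  moreover have "((\<lambda>x. 2 * x + R' x) has_real_derivative 2 + D) (at z)"
    using R' by (auto intro!: derivative_eq_intros)
  ultimately obtain d where d: "d > 0" "\<And>h. 0 < h \<Longrightarrow> h < d \<Longrightarrow> 2 * (z + h) + R' (z + h) < 2 * z + R' z"
    using DERIV_neg_dec_right[of "\<lambda>x. 2 * x + R' x" "2 + D" z] by auto
  obtain v w where vw: "z = g v" "z + d / 2 = g w" using g(4) by meson
  have "v < w" using vw d(1) g(2)[of v w] by simp
  then have "g (g v) + v < g (g w) + w" using g(2) by (intro add_strict_mono) auto
  then show False using d(2)[of "d / 2"] d(1) g(6)[of v] g(6)[of w] vw by simp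
qed

text \<open>For r < 1 only the supremum of \<open>R\<close> itself counts, so N of order
  \<epsilon>^(-1/2) already makes the second derivative at 0 at most - 2 pi^2 < -2. This exponent is
  admissible, as 3 / (2 (3 - r)) \<ge> 1/2.\<close>

lemma destroying_trig_poly_C0:
  assumes r: "0 \<le> r" "r < 1" and \<epsilon>: "0 < \<epsilon>" "\<epsilon> < 1"
  shows "\<exists>N a b. real N \<le> 2 * \<epsilon> powr (- 3 / (2 * (3 - r))) \<and> Cr_norm r (trig_poly N a b) < \<epsilon> \<and>
    \<not> has_invariant_circle_freq (twist_map (\<lambda>x x'. (x - x')\<^sup>2 / 2 + trig_poly N a b x')) \<omega>"
proof -
  define N where "N = nat \<lceil>\<epsilon> powr (- 1 / 2)\<rceil>"
  have one: "1 \<le> \<epsilon> powr (- 1 / 2)" using powr_mono'[of "- 1 / 2" 0 \<epsilon>] \<epsilon> by simp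
  have N1: "\<epsilon> powr (- 1 / 2) \<le> real N" unfolding N_def by linarith
  have "real N \<le> \<epsilon> powr (- 1 / 2) + 1" unfolding N_def using one by linarith
  then have "real N \<le> 2 * \<epsilon> powr (- 1 / 2)" using one by linarith
  also have "\<dots> \<le> 2 * \<epsilon> powr (- 3 / (2 * (3 - r)))"
    using \<epsilon> r by (intro mult_left_mono powr_mono') (auto simp: field_simps)
  finally have N2: "real N \<le> 2 * \<epsilon> powr (- 3 / (2 * (3 - r)))" .
  have N0: "0 < N" using N1 one by linarith
  define R where "R x = \<epsilon> / 2 * cos (2 * pi * of_int (int N) * x)" for x
  have Rt: "trig_bounded N (\<epsilon> / 2) R"
    unfolding R_def[abs_def] using trig_bounded_scale[OF trig_bounded_cos_sin(1)[of "int N" N], of "\<epsilon> / 2"] \<epsilon> by simp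
  define R' where "R' x = - (\<epsilon> / 2 * (2 * pi * real N) * sin (2 * pi * real N * x))" for x
  have R': "(R has_real_derivative R' x) (at x)" for x
    unfolding R_def[abs_def] R'_def by (auto intro!: derivative_eq_intros)
  have R'': "(R' has_real_derivative - (\<epsilon> / 2 * (2 * pi * real N)\<^sup>2)) (at 0)"
    unfolding R'_def[abs_def] by (auto intro!: derivative_eq_intros simp: power2_eq_square)
  have large: "2 < \<epsilon> / 2 * (2 * pi * real N)\<^sup>2"
  proof -
    have "(\<epsilon> powr (- 1 / 2))\<^sup>2 = \<epsilon> powr (- 1)" unfolding power2_eq_square powr_add[symmetric] by simp
    then have "1 = \<epsilon> * (\<epsilon> powr (- 1 / 2))\<^sup>2" using \<epsilon> by (simp add: powr_minus)
    also have "\<dots> \<le> \<epsilon> * (real N)\<^sup>2" using \<epsilon> N1 by (intro mult_left_mono power_mono) auto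
    finally have "2 * pi\<^sup>2 * 1 \<le> 2 * pi\<^sup>2 * (\<epsilon> * (real N)\<^sup>2)" by (intro mult_left_mono) auto
    moreover have "1 < pi\<^sup>2" using pi_gt3 by (intro one_less_power) auto
    moreover have "\<epsilon> / 2 * (2 * pi * real N)\<^sup>2 = 2 * pi\<^sup>2 * (\<epsilon> * (real N)\<^sup>2)"
      by (simp add: power_mult_distrib)
    ultimately show ?thesis by linarith
  qed
  have circ: "\<not> has_invariant_circle_freq (twist_map (\<lambda>x x'. (x - x')\<^sup>2 / 2 + R x')) \<omega>"
  proof
    assume circ: "has_invariant_circle_freq (twist_map (\<lambda>x x'. (x - x')\<^sup>2 / 2 + R x')) \<omega>"
    have "continuous_on UNIV R'" unfolding R'_def[abs_def] by (intro continuous_intros)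
    then obtain g where "invariant_graph R' \<omega> g"
      using graph_of_invariant_circle[OF R' trig_bounded_deriv(3)[OF Rt] _ circ] by blast
    from invariant_graph_derivative_ge[OF this R''] large show False by simp
  qed
  have "Cr_norm r R \<le> \<epsilon> / 2"
  proof (rule Cr_norm_le)
    fix j x assume "real j \<le> r"
    then have "j = 0" using r by linarith
    then show "\<bar>(deriv ^^ j) R x\<bar> \<le> \<epsilon> / 2" using trig_bounded_abs_le[OF Rt] by simp
  qed (rule r)
  moreover obtain a b where "R = trig_poly N a b" using Rt unfolding trig_bounded_def by blast
  ultimately show ?thesis using N2 circ \<epsilon> by (intro exI[of _ N] exI[of _ a] exI[of _ b]) simp
qed

lemma destroying_trig_poly_Cm:
  fixes m :: nat
  assumes bad: "badly_approximable \<omega>" and m: "1 \<le> m" "m \<le> 2"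
    and r: "real m \<le> r" "r < real m + 1"
  shows "\<exists>C>0. \<exists>\<epsilon>0>0. \<forall>\<epsilon>. 0 < \<epsilon> \<and> \<epsilon> < \<epsilon>0 \<longrightarrow>
           (\<exists>N a b. real N \<le> C * \<epsilon> powr (- 3 / (2 * (3 - r))) \<and> Cr_norm r (trig_poly N a b) < \<epsilon> \<and>
              \<not> has_invariant_circle_freq (twist_map (\<lambda>x x'. (x - x')\<^sup>2 / 2 + trig_poly N a b x')) \<omega>)"
proof -
  \<comment> \<open>Derivatives up to order m are of size q powr (- \<sigma>): 2 from the rescaling
    and 3/2 from the depth of the wells, less m from differentiation.\<close>
  define \<sigma> where "\<sigma> = 7 / 2 - real m"
  have \<sigma>: "3 / 2 \<le> \<sigma>" using m by (simp add: \<sigma>_def)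
  \<comment> \<open>From Q \<ge> y powr e and Q \<le> q powr (60 / 59) it follows that q powr
    \<sigma> \<ge> y, the bound needed to make the norm small.\<close>
  define e where "e = 60 / (59 * \<sigma>)"
  have e: "0 < e" using \<sigma> by (simp add: e_def)
  define s where "s q = nat \<lceil>real q powr (3 / 32)\<rceil>" for q :: nat
  obtain q0 where q0: "\<And>q. q \<ge> q0 \<Longrightarrow> 1 \<le> s q \<and> real q powr (3 / 32) \<le> real (s q) \<and> real (s q) \<le> 2 * real q powr (3 / 32) \<and>
    10 * s q ^ 8 + 1 < (q - 1) div 2 \<and>
    80 * (1 / 2 / (1 + 1 / real (s q ^ 8)) ^ ((q - 1) div 2 - 10 * s q ^ 8 - 1))
      < 1 / (10 ^ 6 * (real (20 * s q ^ 9))\<^sup>2 * (real (s q ^ 8))\<^sup>2)"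
    using parameters_eventually unfolding eventually_sequentially s_def by blast
  obtain Q0 where Q0: "\<And>Q. Q \<ge> Q0 \<Longrightarrow> \<exists>q p :: int. q \<noteq> 0 \<and> 0 < of_int q * \<omega> - of_int p \<and>
    of_int q * \<omega> - of_int p < 1 / real Q \<and> nat \<bar>q\<bar> \<le> Q \<and> real Q \<le> real (nat \<bar>q\<bar>) powr (1 + 1 / 59)"
    using badly_approximable_denominators[OF bad, of "1 / 59"] by auto
  \<comment> \<open>Q \<ge> B guarantees both that Q is large enough for the Diophantine lemma and
    that the resulting q is at least \<open>q0\<close>.\<close>
  define B where "B = real Q0 + real q0 powr (60 / 59) + 1"
  have B: "1 \<le> B" by (simp add: B_def)
  define \<epsilon>0 where "\<epsilon>0 = min 1 (130 / B powr (1 / e))"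
  define C where "C = (82432 * (4 * 130\<^sup>2) :: real)"
  have C: "C > 0" by (simp add: C_def)
  have \<epsilon>0: "\<epsilon>0 > 0" using B by (simp add: \<epsilon>0_def)
  have main: "\<exists>N a b. real N \<le> C * \<epsilon> powr (- 3 / (2 * (3 - r))) \<and> Cr_norm r (trig_poly N a b) < \<epsilon> \<and>
              \<not> has_invariant_circle_freq (twist_map (\<lambda>x x'. (x - x')\<^sup>2 / 2 + trig_poly N a b x')) \<omega>"
    if \<epsilon>: "0 < \<epsilon>" "\<epsilon> < \<epsilon>0" for \<epsilon>
  proof -
    \<comment> \<open>The norm will be at most 129 / y; taking 130 makes it strictly less than
      \<open>\<epsilon>\<close>.\<close>
    define y where "y = 130 / \<epsilon>"
    have \<epsilon>1: "\<epsilon> < 1" using \<epsilon> by (simp add: \<epsilon>0_def)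
    have y: "1 \<le> y" using \<epsilon> \<epsilon>1 by (simp add: y_def)
    have "\<epsilon> \<le> 130 / B powr (1 / e)" using \<epsilon> by (simp add: \<epsilon>0_def)
    then have "B powr (1 / e) \<le> y" using \<epsilon> B by (simp add: y_def field_simps)
    then have "(B powr (1 / e)) powr e \<le> y powr e" using e by (intro powr_mono2) auto
    then have By: "B \<le> y powr e" using e B by (simp add: powr_powr)
    define Q where "Q = nat \<lceil>y powr e\<rceil>"
    have Q1: "y powr e \<le> real Q" unfolding Q_def by linarith
    have "real Q \<le> y powr e + 1" unfolding Q_def by (simp add: le_nat_iff) 
    then have Q2: "real Q \<le> 2 * y powr e" using By B by linarith
    have "real Q0 \<le> real Q" using Q1 By powr_ge_zero[of "real q0" "60 / 59"] unfolding B_def by linarith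
    then have "Q0 \<le> Q" by simp
    then obtain z p :: int where z: "z \<noteq> 0" "0 < of_int z * \<omega> - of_int p"
      "of_int z * \<omega> - of_int p < 1 / real Q" "nat \<bar>z\<bar> \<le> Q" "real Q \<le> real (nat \<bar>z\<bar>) powr (60 / 59)"
      using Q0[of Q] by auto
    define q where "q = nat \<bar>z\<bar>"
    have q: "q \<ge> 1" "q \<le> Q" "real Q \<le> real q powr (60 / 59)" using z by (auto simp: q_def)
    have "real q0 powr (60 / 59) \<le> real q powr (60 / 59)" using q(3) Q1 By by (simp add: B_def)
    then have "q0 \<le> q"
      using powr_less_mono2[of "60 / 59" "real q" "real q0"] by (cases "q < q0") auto
    note par = q0[OF this]
    define \<tau> where "\<tau> = (q - 1) div 2"
    define n where "n = 20 * s q ^ 9"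
    define N where "N = Suc (8 * n) * q"
    have slow: "real (2 * \<tau>) * (of_int z * \<omega> - of_int p) < 1"
    proof -
      have "2 * \<tau> \<le> Q" using q by (simp add: \<tau>_def)
      then have "real (2 * \<tau>) * (of_int z * \<omega> - of_int p) \<le> real Q * (of_int z * \<omega> - of_int p)"
        using z(2) by (intro mult_right_mono) (simp_all only: of_nat_le_iff)
      also have "\<dots> < 1" using z(3) q by (simp add: pos_less_divide_eq mult.commute)
      finally show ?thesis .
    qed
    obtain a b where circ: "\<not> has_invariant_circle_freq (twist_map (\<lambda>x x'. (x - x')\<^sup>2 / 2 + trig_poly N a b x')) \<omega>"
      and bd: "\<And>j x. j \<le> 2 \<Longrightarrow> \<bar>(deriv ^^ j) (trig_poly N a b) x\<bar> \<le> 129 * real q ^ j / ((real q)\<^sup>2 * (real (s q ^ 8))\<^sup>2)"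
      using destroying_trig_poly[of "s q" \<tau> z \<omega> p] par z(1,2) slow
      unfolding N_def n_def q_def[symmetric] \<tau>_def by blast
    have norm: "Cr_norm r (trig_poly N a b) \<le> 129 * (\<epsilon> / 130)"
    proof (rule Cr_norm_le)
      show "0 \<le> r" using r by simp
      fix j x assume "real j \<le> r"
      then have j: "j \<le> m" using r by linarith
      have "\<bar>(deriv ^^ j) (trig_poly N a b) x\<bar> \<le> 129 * real q ^ j / ((real q)\<^sup>2 * (real (s q ^ 8))\<^sup>2)"
        using j m by (intro bd) simp
      also have "\<dots> \<le> 129 * real q ^ m / ((real q)\<^sup>2 * real q powr (3 / 2))"
      proof -
        have "real q powr (3 / 2) = (real q powr (3 / 32)) ^ 16" using q by (simp add: powr_power)
        also have "\<dots> \<le> real (s q) ^ 16" using par by (intro power_mono) auto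
        also have "\<dots> = (real (s q ^ 8))\<^sup>2" by (simp flip: power_mult)
        finally show ?thesis using q j
          by (intro frac_le mult_left_mono power_increasing mult_pos_pos) auto
      qed
      also have "\<dots> = 129 / real q powr \<sigma>"
      proof -
        have "(real q)\<^sup>2 * real q powr (3 / 2) = real q powr (7 / 2)"
          using q powr_add[of "real q" 2 "3 / 2"] by (simp add: powr_numeral)
        then have "real q ^ m / ((real q)\<^sup>2 * real q powr (3 / 2)) = real q powr (real m - 7 / 2)"
          using q by (simp add: powr_diff powr_realpow)
        also have "\<dots> = 1 / real q powr \<sigma>" by (simp add: \<sigma>_def powr_minus_divide[symmetric])
        finally show ?thesis by simp
      qed
      also have "\<dots> \<le> 129 / y"
      proof -
        have "y powr e \<le> real q powr (60 / 59)" using Q1 q by linarith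
        then have "(y powr e) powr (59 * \<sigma> / 60) \<le> (real q powr (60 / 59)) powr (59 * \<sigma> / 60)"
          using \<sigma> by (intro powr_mono2) auto
        then have "y \<le> real q powr \<sigma>" using \<sigma> y by (simp add: powr_powr e_def)
        then show ?thesis using y q(1) by (intro divide_left_mono mult_pos_pos) auto
      qed
      finally show "\<bar>(deriv ^^ j) (trig_poly N a b) x\<bar> \<le> 129 * (\<epsilon> / 130)" by (simp add: y_def)
    qed
    have "real N \<le> 161 * real (s q) ^ 9 * real q"
    proof -
      have "1 \<le> s q ^ 9" using par by simp
      then have "Suc (8 * n) \<le> 161 * s q ^ 9" by (simp add: n_def)
      then have "N \<le> 161 * s q ^ 9 * q" unfolding N_def by (intro mult_right_mono) auto
      then have "real N \<le> real (161 * s q ^ 9 * q)" by (simp only: of_nat_le_iff)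
      then show ?thesis by simp
    qed
    also have "\<dots> \<le> 161 * (2 * real q powr (3 / 32)) ^ 9 * real q"
      using par by (intro mult_right_mono mult_left_mono power_mono) auto
    also have "\<dots> = 82432 * (real q powr (27 / 32) * real q powr 1)" using q by (simp add: power_mult_distrib powr_power)
    also have "\<dots> = 82432 * real q powr (59 / 32)" unfolding powr_add[symmetric] by simp
    also have "\<dots> \<le> 82432 * (2 * y powr e) powr (59 / 32)"
      using q Q2 by (intro mult_left_mono powr_mono2) auto
    also have "(2 * y powr e) powr (59 / 32) = 2 powr (59 / 32) * y powr (15 / (8 * \<sigma>))"
      using \<sigma> by (simp add: powr_mult powr_powr e_def)
    also have "\<dots> \<le> 4 * (130\<^sup>2 * \<epsilon> powr (- 3 / (2 * (3 - r))))"
    proof (rule mult_mono)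
      have "(2 :: real) powr (59 / 32) \<le> 2 powr 2" by (intro powr_mono) auto
      then show "(2 :: real) powr (59 / 32) \<le> 4" by simp
      have "y powr (15 / (8 * \<sigma>)) = 130 powr (15 / (8 * \<sigma>)) * \<epsilon> powr (- (15 / (8 * \<sigma>)))"
        using \<epsilon> by (simp add: y_def powr_divide powr_minus_divide)
      also have "\<dots> \<le> 130 powr 2 * \<epsilon> powr (- 3 / (2 * (3 - r)))"
      proof (rule mult_mono)
        have "15 / (8 * \<sigma>) \<le> 2" using \<sigma> by (simp add: field_simps)
        then show "(130 :: real) powr (15 / (8 * \<sigma>)) \<le> 130 powr 2" by (intro powr_mono) auto
        \<comment> \<open>The exponent obtained is 3/4 for m = 1 and 5/4 for m = 2, against at least
          3/4 and 3/2 allowed; equality occurs only at r = 1.\<close>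
        have "m = 1 \<or> m = 2" using m by auto
        then have "15 / (8 * \<sigma>) \<le> 3 / (2 * (3 - r))" using r
          by (auto simp: \<sigma>_def field_simps)
        then show "\<epsilon> powr (- (15 / (8 * \<sigma>))) \<le> \<epsilon> powr (- 3 / (2 * (3 - r)))"
          using \<epsilon> \<epsilon>1 by (intro powr_mono') auto
      qed auto
      finally show "y powr (15 / (8 * \<sigma>)) \<le> 130\<^sup>2 * \<epsilon> powr (- 3 / (2 * (3 - r)))" by simp
    qed auto
    finally have "real N \<le> C * \<epsilon> powr (- 3 / (2 * (3 - r)))" by (simp add: C_def mult.assoc)
    moreover have "Cr_norm r (trig_poly N a b) < \<epsilon>" using norm \<epsilon> by linarith
    ultimately show ?thesis using circ by blast
  qed
  show ?thesis using C \<epsilon>0 main by blast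
qed

theorem theorem1p2:
  fixes \<omega> r :: real
  assumes "\<omega> \<notin> \<rat>" and "badly_approximable \<omega>" and "0 \<le> r" and "r < 3"
  shows "\<exists>C>0. \<exists>\<epsilon>0>0. \<forall>\<epsilon>. 0 < \<epsilon> \<and> \<epsilon> < \<epsilon>0 \<longrightarrow>
           (\<exists>N a b. real N \<le> C * \<epsilon> powr (- 3 / (2 * (3 - r))) \<and>
              Cr_norm r (trig_poly N a b) < \<epsilon> \<and>
              \<not> has_invariant_circle_freq
                  (twist_map (\<lambda>x x'. (x - x')\<^sup>2 / 2 + trig_poly N a b x')) \<omega>)"
proof (cases "r < 1")
  case True
  show ?thesis
    by (rule exI[of _ 2], intro conjI, simp, rule exI[of _ 1])
       (use destroying_trig_poly_C0[OF assms(3) True] in auto)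
next
  case False
  define m where "m = nat \<lfloor>r\<rfloor>"
  have "real m \<le> r" "r < real m + 1" using False unfolding m_def by linarith+
  moreover have "1 \<le> m" "m \<le> 2" using False assms(4) unfolding m_def by linarith+
  ultimately show ?thesis by (intro destroying_trig_poly_Cm[OF assms(2), of m])
qed

end
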